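(* Let $\Sigma\le\mathrm{GL}(n,\mathcal{O}_K)$ be a finite unitary complex reflection group defined over the ring of integers $\mathcal{O}_K$ of a number field $K\subset\mathbb{C}$, let $G\le\Sigma$ be a subgroup of index $\ell$, and let $\theta_*=(\theta_1,\dots,\theta_\ell)$ be a set of secondaries for $K[V]^G$ over $K[V]^\Sigma$. If $\mathcal{O}_K$ is a PID, then $\mho(\theta_* )=\dfrac{\det M(\theta_* )}{\Delta(G)}$ up to multiplication by a unit in $\mathcal{O}_K$; that is, $\Delta(G)$ is the primitive part of $\det M(\theta_* )$.
   Context: $\Sigma$ is generated by reflections, where a reflection is a non-identity element of $\Sigma$ fixing a hyperplane pointwise. $V=K^n$, $K[V]=K[x_1,\dots,x_n]$ and $\mathcal{O}_K[V]=\mathcal{O}_K[x_1,\dots,x_n]$ with action $(g\cdot f)(v)=f(g^{-1}v)$. $K[V]^\Sigma$ is a polynomial ring. A set of secondaries is a minimal set of homogeneous generators $\theta_1,\dots,\theta_\ell\in\mathcal{O}_K[V]^G$ of $K[V]^G$ as a $K[V]^\Sigma$-module (it has $\ell$ elements and is a basis). Let $\gamma_1,\dots,\gamma_\ell$ be left coset representatives of $G$ in $\Sigma$; $M(\theta_* )=[\gamma_i\theta_j]_{1\le i,j\le\ell}$. When $\mathcal{O}_K$ is a PID, the content of a polynomial in $\mathcal{O}_K[V]$ is the gcd of its coefficients (up to units), its primitive part is its quotient by its content, and $\mho(\theta_* )$ is the content of $\det M(\theta_* )$. Let $\mathcal{P}$ be the set of reflecting hyperplanes of $\Sigma$. For $P\in\mathcal{P}$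 let $L_P\in\mathcal{O}_K[V]$ be a linear form with zero set $P$, chosen primitive (content a unit) when $\mathcal{O}_K$ is a PID; let $C_P$ be the cyclic subgroup of elements of $\Sigma$ fixing $P$ pointwise, and $g_P$ a generator of $C_P$. For $\sigma\in\Sigma$, $b_i(\sigma)$ is the number of cycles of length $i$ of $\sigma$ acting by left multiplication on the set of left cosets $\Sigma/G$. Put $e(G,P)=\sum_{i\ge2}\frac{|C_P|}{2}b_i(g_P)(i-1)$, an integer. The $G$-discriminant is $\Delta(G)=\prod_{P\in\mathcal{P}}L_P^{e(G,P)}$; when $\mathcal{O}_K$ is a PID it is defined up to a unit of $\mathcal{O}_K$. *)

theory Defs
  imports
    "HOL-Library.Poly_Mapping"
    "HOL-Combinatorics.Orbits"
    "HOL-Algebra.Left_Coset"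
    "HOL-Algebra.Generated_Groups"
    "HOL-Algebra.Embedded_Algebras"
    "HOL-Algebra.Ring_Divisibility"
    "HOL-Algebra.Algebraic_Closure_Type"
    "Jordan_Normal_Form.Determinant"
    "Jordan_Normal_Form.Schur_Decomposition"
begin

abbreviation complex_field :: "complex ring"
  where "complex_field \<equiv> ring_of_type_algebra"

definition number_field :: "complex set \<Rightarrow> bool"
  where "number_field K \<longleftrightarrow>
    subfield K complex_field \<and> ring.finite_dimension complex_field \<rat> K"

definition ring_of_integers :: "complex set \<Rightarrow> complex ring"
  where "ring_of_integers K = complex_field \<lparr>carrier := {z \<in> K. algebraic_int z}\<rparr>"

text \<open>A monomial is an exponent vector; the variables are indexed from 0.\<close>

type_synonym mpoly = "(nat \<Rightarrow>\<^sub>0 nat) \<Rightarrow>\<^sub>0 complex"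

definition mconst :: "complex \<Rightarrow> mpoly"
  where "mconst c = Poly_Mapping.single 0 c"

definition mvar :: "nat \<Rightarrow> mpoly"
  where "mvar i = Poly_Mapping.single (Poly_Mapping.single i 1) 1"

definition polys :: "nat \<Rightarrow> complex set \<Rightarrow> mpoly set"
  where "polys n A = {f. (\<forall>m. Poly_Mapping.lookup f m \<in> A) \<and>
                         (\<forall>m\<in>Poly_Mapping.keys f. Poly_Mapping.keys m \<subseteq> {..<n})}"

definition homogeneous :: "nat \<Rightarrow> mpoly \<Rightarrow> bool"
  where "homogeneous d f \<longleftrightarrow>
    (\<forall>m\<in>Poly_Mapping.keys f. (\<Sum>i\<in>Poly_Mapping.keys m. Poly_Mapping.lookup m i) = d)"

definition poly_subst :: "(nat \<Rightarrow> mpoly) \<Rightarrow> mpoly \<Rightarrow> mpoly"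
  where "poly_subst s f =
    (\<Sum>m\<in>Poly_Mapping.keys f. mconst (Poly_Mapping.lookup f m) *
       (\<Prod>i\<in>Poly_Mapping.keys m. s i ^ Poly_Mapping.lookup m i))"

definition poly_eval :: "complex vec \<Rightarrow> mpoly \<Rightarrow> complex"
  where "poly_eval v f =
    (\<Sum>m\<in>Poly_Mapping.keys f. Poly_Mapping.lookup f m *
       (\<Prod>i\<in>Poly_Mapping.keys m. (v $ i) ^ Poly_Mapping.lookup m i))"

text \<open>Contents are only determined up to a unit, hence a relation.\<close>

definition is_content :: "complex ring \<Rightarrow> mpoly \<Rightarrow> complex \<Rightarrow> bool"
  where "is_content R f c \<longleftrightarrow>
    c \<in> carrier R \<and>
    (\<forall>m. c divides\<^bsub>R\<^esub> Poly_Mapping.lookup f m) \<and>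
    (\<forall>d\<in>carrier R. (\<forall>m. d divides\<^bsub>R\<^esub> Poly_Mapping.lookup f m) \<longrightarrow> d divides\<^bsub>R\<^esub> c)"

definition is_primitive :: "complex ring \<Rightarrow> mpoly \<Rightarrow> bool"
  where "is_primitive R f \<longleftrightarrow> (\<exists>u\<in>Units R. is_content R f u)"

definition is_primitive_part :: "complex ring \<Rightarrow> mpoly \<Rightarrow> mpoly \<Rightarrow> bool"
  where "is_primitive_part R f p \<longleftrightarrow> (\<exists>c. is_content R f c \<and> c \<noteq> 0 \<and> f = mconst c * p)"

definition GL :: "nat \<Rightarrow> complex set \<Rightarrow> complex mat monoid"
  where "GL n A = units_of
    \<lparr>carrier = {M \<in> carrier_mat n n. elements_mat M \<subseteq> A}, monoid.mult = (*), one = 1\<^sub>m n\<rparr>"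

text \<open>Unitarity is with respect to some positive definite Hermitian form, not necessarily the
  standard one: a reflection group is rarely unitary for the standard form in a basis for which
  its matrices have entries in the ring of integers.\<close>

definition unitary_for_some_form :: "nat \<Rightarrow> complex mat set \<Rightarrow> bool"
  where "unitary_for_some_form n S \<longleftrightarrow>
    (\<exists>H\<in>carrier_mat n n. mat_adjoint H = H \<and>
       (\<forall>v\<in>carrier_vec n. v \<noteq> 0\<^sub>v n \<longrightarrow> 0 < Re ((H *\<^sub>v v) \<bullet>c v)) \<and>
       (\<forall>g\<in>S. mat_adjoint g * H * g = H))"

text \<open>\<open>(g \<cdot> f)(v) = f(g\<^sup>-\<^sup>1 v)\<close>, i.e. the i-th variable is replaced by the i-th
  coordinate of \<open>g\<^sup>-\<^sup>1\<close> applied to the vector of variables.\<close>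

definition poly_act :: "complex mat monoid \<Rightarrow> complex mat \<Rightarrow> mpoly \<Rightarrow> mpoly"
  where "poly_act \<Gamma> g f =
    (let h = inv\<^bsub>\<Gamma>\<^esub> g in
     poly_subst (\<lambda>i. \<Sum>j<dim_col h. mconst (h $$ (i, j)) * mvar j) f)"

definition invariants ::
  "complex mat monoid \<Rightarrow> nat \<Rightarrow> complex set \<Rightarrow> complex mat set \<Rightarrow> mpoly set"
  where "invariants \<Gamma> n A G = {f \<in> polys n A. \<forall>g\<in>G. poly_act \<Gamma> g f = f}"

definition vecs :: "nat \<Rightarrow> complex set \<Rightarrow> complex vec set"
  where "vecs n K = {v \<in> carrier_vec n. set\<^sub>v v \<subseteq> K}"

definition hyperplane :: "nat \<Rightarrow> complex set \<Rightarrow> complex vec set \<Rightarrow> bool"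
  where "hyperplane n K P \<longleftrightarrow>
    (\<exists>a\<in>vecs n K. a \<noteq> 0\<^sub>v n \<and> P = {v \<in> vecs n K. a \<bullet> v = 0})"

definition pointwise_stabilizer :: "complex mat set \<Rightarrow> complex vec set \<Rightarrow> complex mat set"
  where "pointwise_stabilizer S P = {g \<in> S. \<forall>v\<in>P. g *\<^sub>v v = v}"

definition reflections :: "nat \<Rightarrow> complex set \<Rightarrow> complex mat set \<Rightarrow> complex mat set"
  where "reflections n K S =
    {g \<in> S. g \<noteq> 1\<^sub>m n \<and> (\<exists>P. hyperplane n K P \<and> g \<in> pointwise_stabilizer S P)}"

definition reflecting_hyperplanes ::
  "nat \<Rightarrow> complex set \<Rightarrow> complex mat set \<Rightarrow> complex vec set set"
  where "reflecting_hyperplanes n K S =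
    {P. hyperplane n K P \<and> (\<exists>g\<in>pointwise_stabilizer S P. g \<noteq> 1\<^sub>m n)}"

definition unitary_reflection_group ::
  "complex mat monoid \<Rightarrow> nat \<Rightarrow> complex set \<Rightarrow> complex mat set \<Rightarrow> bool"
  where "unitary_reflection_group \<Gamma> n K S \<longleftrightarrow>
    subgroup S \<Gamma> \<and> finite S \<and> unitary_for_some_form n S \<and>
    generate \<Gamma> (reflections n K S) = S"

definition module_generates ::
  "mpoly set \<Rightarrow> mpoly set \<Rightarrow> (nat \<Rightarrow> mpoly) \<Rightarrow> nat set \<Rightarrow> bool"
  where "module_generates A B \<theta> I \<longleftrightarrow>
    B = {(\<Sum>j\<in>I. c j * \<theta> j) | c. \<forall>j\<in>I. c j \<in> A}"

text \<open>Here \<open>\<theta>\<close> lists the secondaries with indices below \<open>l\<close>, the index of \<open>G\<close> in \<open>S\<close>.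
  Minimality means that no proper subfamily generates.\<close>

definition secondaries ::
  "complex mat monoid \<Rightarrow> nat \<Rightarrow> complex set \<Rightarrow> complex mat set \<Rightarrow> complex mat set \<Rightarrow>
   nat \<Rightarrow> (nat \<Rightarrow> mpoly) \<Rightarrow> bool"
  where "secondaries \<Gamma> n K S G l \<theta> \<longleftrightarrow>
    (\<forall>j<l. \<theta> j \<in> invariants \<Gamma> n (carrier (ring_of_integers K)) G \<and>
           (\<exists>d. homogeneous d (\<theta> j))) \<and>
    module_generates (invariants \<Gamma> n K S) (invariants \<Gamma> n K G) \<theta> {..<l} \<and>
    (\<forall>I. I \<subset> {..<l} \<longrightarrow>
       \<not> module_generates (invariants \<Gamma> n K S) (invariants \<Gamma> n K G) \<theta> I)"

definition secondary_matrix ::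
  "complex mat monoid \<Rightarrow> nat \<Rightarrow> (nat \<Rightarrow> complex mat) \<Rightarrow> (nat \<Rightarrow> mpoly) \<Rightarrow> mpoly mat"
  where "secondary_matrix \<Gamma> l \<gamma> \<theta> = mat l l (\<lambda>(i, j). poly_act \<Gamma> (\<gamma> i) (\<theta> j))"

definition left_cosets ::
  "complex mat monoid \<Rightarrow> complex mat set \<Rightarrow> complex mat set \<Rightarrow> complex mat set set"
  where "left_cosets \<Gamma> S G = lcosets\<^bsub>\<Gamma>\<lparr>carrier := S\<rparr>\<^esub> G"

definition num_cycles ::
  "complex mat monoid \<Rightarrow> complex mat set \<Rightarrow> complex mat set \<Rightarrow> nat \<Rightarrow> complex mat \<Rightarrow> nat"
  where "num_cycles \<Gamma> S G i \<sigma> =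
    card {c \<in> orbit (\<lambda>C. \<sigma> <#\<^bsub>\<Gamma>\<^esub> C) ` left_cosets \<Gamma> S G. card c = i}"

definition disc_exponent ::
  "complex mat monoid \<Rightarrow> complex mat set \<Rightarrow> complex mat set \<Rightarrow>
   complex vec set \<Rightarrow> complex mat \<Rightarrow> rat"
  where "disc_exponent \<Gamma> S G P g =
    (\<Sum>i\<in>{2..card (left_cosets \<Gamma> S G)}.
       of_nat (card (pointwise_stabilizer S P)) / 2 * of_nat (num_cycles \<Gamma> S G i g) *
       (of_nat i - 1))"

text \<open>The exponent is a nonnegative integer, so that the floor is harmless: cycle lengths divide
  the order of the pointwise stabilizer, hence are all odd if that order is odd.\<close>

definition discriminant ::
  "complex mat monoid \<Rightarrow> nat \<Rightarrow> complex set \<Rightarrow> complex mat set \<Rightarrow> complex mat set \<Rightarrow>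
   (complex vec set \<Rightarrow> complex mat) \<Rightarrow> (complex vec set \<Rightarrow> mpoly) \<Rightarrow> mpoly"
  where "discriminant \<Gamma> n K S G g L =
    (\<Prod>P\<in>reflecting_hyperplanes n K S. L P ^ nat \<lfloor>disc_exponent \<Gamma> S G P (g P)\<rfloor>)"

end

theory Submission
  imports Defs
begin

text \<open>Let \<open>F\<close> be the determinant of the secondary matrix and \<open>\<Delta>\<close> the discriminant. The theorem
says that \<open>F = c \<Delta>\<close> with a nonzero constant \<open>c\<close> and that \<open>\<Delta>\<close> is primitive; by Gauss's lemma
the content of \<open>F\<close> is then \<open>c\<close> up to a unit.

\<^bold>\<open>Proportionality.\<close> Both polynomials are restricted to complex lines \<open>v\<^sub>0 + t (v\<^sub>1 - v\<^sub>0)\<close>. A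
generic line meets the fixed spaces of the non-identity elements of \<open>S\<close> only in points \<open>u\<close> that
lie on exactly one reflecting hyperplane \<open>P\<close>, and it crosses \<open>P\<close> transversally. The stabilizer of
such a \<open>u\<close> is the cyclic group generated by \<open>g = g P\<close>, of order \<open>e\<close> say; elsewhere on the line
the stabilizer is trivial. At every point of the line \<open>F\<close> and \<open>\<Delta>\<close> vanish to the same order
(\<open>line_orders\<close>), so their restrictions are proportional. The factor is determined by the values at
the fixed base point \<open>v\<^sub>0\<close>, hence it is the same for all generic \<open>v\<^sub>1\<close>, and two polynomials that
are proportional on generic points are proportional (\<open>sec_det_eq\<close>).

\<^bold>\<open>The order at a point \<open>u\<close> of \<open>P\<close>.\<close> Choose the coordinate \<open>y\<close> along the eigenvector of \<open>g\<close> with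
eigenvalue \<open>\<zeta> \<noteq> 1\<close> and a coordinate \<open>x\<close> along the component of the line inside \<open>P\<close>. The rows of
the secondary matrix are indexed by the cosets of \<open>G\<close>, and \<open>g\<close> permutes them while it multiplies
\<open>y\<close> by a primitive \<open>e\<close>-th root of unity. On a cycle of length \<open>m\<close> a discrete Fourier transform
replaces the rows by eigenvectors of \<open>g\<close>, and these are divisible by \<open>y\<close> to the powers
\<open>0, e/m, ..., (m-1) e/m\<close>. The sum \<open>e (m - 1) / 2\<close> of these exponents is the contribution of the
cycle to the exponent of the linear form of \<open>P\<close> in \<open>\<Delta>\<close>. So the order of \<open>F\<close> is at least this
exponent (\<open>det_divisible\<close>). For the converse, every \<open>G\<close>-invariant \<open>f\<close> and all its powers are
combinations of the \<open>\<theta> j\<close> with \<open>S\<close>-invariant coefficients, so \<open>F\<close> divides the Vandermonde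
determinant of the translates of \<open>f\<close> by the cosets. Two rows in the same cycle of length \<open>m\<close> agree
for a generic \<open>f\<close> to the order \<open>e/m\<close>, and rows in different cycles differ at \<open>u\<close>, so the
Vandermonde determinant has exactly the required order (\<open>vandermonde_order\<close>). Together these give
\<open>line_det_order\<close>.

Working over the complex numbers is harmless because every invariant is a complex combination of
averages of monomials, which have coefficients in \<open>K\<close> (\<open>spans_if_generates\<close>).

\<^bold>\<open>Primitivity.\<close> A primitive polynomial over a principal ideal domain has a coefficient outside each
prime ideal, and this property passes to products (\<open>avoids_mult\<close>). If \<open>d\<close> divides all
coefficients of \<open>c \<Delta>\<close>, then the integers \<open>x\<close> for which \<open>d\<close> divides \<open>c x\<close> form an ideal that
contains the coefficients of \<open>\<Delta>\<close>; it lies in no prime ideal, so \<open>d\<close> divides \<open>c\<close>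
(\<open>divides_from_coefficients\<close>). With \<open>d = 1\<close> this shows that \<open>c\<close> is integral, and in general
that it is a greatest common divisor of the coefficients of \<open>c \<Delta>\<close>.\<close>

section \<open>Substitution homomorphisms\<close>

no_notation fps_nth (infixl \<open>$\<close> 75)

abbreviation keys :: "('a \<Rightarrow>\<^sub>0 'b::zero) \<Rightarrow> 'a set"
  where "keys \<equiv> Poly_Mapping.keys"

abbreviation lookup :: "('a \<Rightarrow>\<^sub>0 'b::zero) \<Rightarrow> 'a \<Rightarrow> 'b"
  where "lookup \<equiv> Poly_Mapping.lookup"

definition monom_val :: "(nat \<Rightarrow> 'a::comm_ring_1) \<Rightarrow> (nat \<Rightarrow>\<^sub>0 nat) \<Rightarrow> 'a"
  where "monom_val s m = (\<Prod>i\<in>keys m. s i ^ lookup m i)"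

text \<open>Substitution of polynomials, evaluation at a point and restriction to a line or a plane are all of
this form, for different coefficient maps \<open>c\<close> into different rings; the ring homomorphism property
and the naturality \<open>hom_subst_hom\<close> are therefore proved only once.\<close>

definition subst_hom :: "(complex \<Rightarrow> 'a::comm_ring_1) \<Rightarrow> (nat \<Rightarrow> 'a) \<Rightarrow> mpoly \<Rightarrow> 'a"
  where "subst_hom c s f =
    (\<Sum>m\<in>keys f. c (lookup f m) * monom_val s m)"

lemma monom_val_superset:
  assumes "finite I" "keys m \<subseteq> I"
  shows "monom_val s m = (\<Prod>i\<in>I. s i ^ lookup m i)"
  unfolding monom_val_def using assms
  by (intro prod.mono_neutral_left) (auto simp: in_keys_iff)

lemma monom_val_add: "monom_val s (m + m') = monom_val s m * monom_val s m'"
proof -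
  let ?I = "keys m \<union> keys m'"
  have "monom_val s (m + m') = (\<Prod>i\<in>?I. s i ^ lookup (m + m') i)"
    by (rule monom_val_superset) (auto simp: in_keys_iff lookup_add)
  also have "\<dots> = (\<Prod>i\<in>?I. s i ^ lookup m i) * (\<Prod>i\<in>?I. s i ^ lookup m' i)"
    by (simp add: lookup_add power_add prod.distrib)
  also have "\<dots> = monom_val s m * monom_val s m'"
    by (simp add: monom_val_superset[of ?I m] monom_val_superset[of ?I m'])
  finally show ?thesis .
qed

lemma monom_val_0 [simp]: "monom_val s 0 = 1"
  by (simp add: monom_val_def)

lemma monom_val_single [simp]: "monom_val s (Poly_Mapping.single i k) = s i ^ k"
  by (cases "k = 0") (auto simp: monom_val_def)

lemma sum_of_terms:
  fixes f :: "'a \<Rightarrow>\<^sub>0 'b::comm_monoid_add"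
  assumes "finite A" "keys f \<subseteq> A"
  shows "f = (\<Sum>m\<in>A. Poly_Mapping.single m (lookup f m))"
proof (rule poly_mapping_eqI)
  fix k
  have "lookup f k = (\<Sum>m\<in>A. if m = k then lookup f m else 0)"
    using assms by (auto simp: in_keys_iff)
  then show "lookup f k =
      lookup (\<Sum>m\<in>A. Poly_Mapping.single m (lookup f m)) k"
    by (simp add: lookup_sum lookup_single when_def)
qed

lemma mpoly_mult_terms:
  fixes f g :: mpoly
  shows "f * g = (\<Sum>m\<in>keys f. \<Sum>m'\<in>keys g.
      Poly_Mapping.single (m + m') (lookup f m * lookup g m'))"
proof -
  have "f * g = (\<Sum>m\<in>keys f. Poly_Mapping.single m (lookup f m)) *
      (\<Sum>m\<in>keys g. Poly_Mapping.single m (lookup g m))"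
    by (rule arg_cong2[of _ _ _ _ "(*)"]; rule sum_of_terms; simp)
  then show ?thesis
    by (simp add: sum_product mult_single)
qed

lemma poly_subst_conv: "poly_subst s = subst_hom mconst s"
  by (simp add: fun_eq_iff poly_subst_def subst_hom_def monom_val_def)

lemma poly_eval_conv: "poly_eval v = subst_hom (\<lambda>c. c) (\<lambda>i. v $ i)"
  by (simp add: fun_eq_iff poly_eval_def subst_hom_def monom_val_def)

locale coeff_hom = comm_ring_hom c for c :: "complex \<Rightarrow> 'a::comm_ring_1"
begin

lemma subst_hom_superset:
  assumes "finite A" "keys f \<subseteq> A"
  shows "subst_hom c s f = (\<Sum>m\<in>A. c (lookup f m) * monom_val s m)"
  unfolding subst_hom_def using assms
  by (intro sum.mono_neutral_left) (auto simp: in_keys_iff hom_zero)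

lemma subst_hom_single: "subst_hom c s (Poly_Mapping.single m a) = c a * monom_val s m"
  by (cases "a = 0") (simp_all add: subst_hom_def hom_zero)

lemma subst_hom_zero: "subst_hom c s 0 = 0"
  by (simp add: subst_hom_def)

lemma subst_hom_add: "subst_hom c s (f + g) = subst_hom c s f + subst_hom c s g"
proof -
  let ?A = "keys f \<union> keys g"
  have "subst_hom c s (f + g) = (\<Sum>m\<in>?A. c (lookup (f + g) m) * monom_val s m)"
    by (rule subst_hom_superset) (auto simp: in_keys_iff lookup_add)
  also have "\<dots> = subst_hom c s f + subst_hom c s g"
    by (simp add: subst_hom_superset[of ?A f] subst_hom_superset[of ?A g] lookup_add hom_add
        distrib_right sum.distrib)
  finally show ?thesis .
qed

lemma subst_hom_sum: "subst_hom c s (sum F I) = (\<Sum>i\<in>I. subst_hom c s (F i))"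
  by (induction I rule: infinite_finite_induct) (simp_all add: subst_hom_zero subst_hom_add)

lemma subst_hom_mult: "subst_hom c s (f * g) = subst_hom c s f * subst_hom c s g"
proof -
  have "subst_hom c s (f * g) = (\<Sum>m\<in>keys f. \<Sum>m'\<in>keys g.
      (c (lookup f m) * monom_val s m) * (c (lookup g m') * monom_val s m'))"
    by (simp add: mpoly_mult_terms[of f g] subst_hom_sum subst_hom_single hom_mult monom_val_add ac_simps)
  then show ?thesis
    by (simp add: sum_product subst_hom_def)
qed

lemma subst_hom_one: "subst_hom c s 1 = 1"
  using subst_hom_single[of s 0 1] by (simp add: hom_one)

sublocale subst: comm_ring_hom "subst_hom c s" for s
  by unfold_locales (simp_all add: subst_hom_zero subst_hom_add subst_hom_mult subst_hom_one)

lemma subst_hom_mconst: "subst_hom c s (mconst a) = c a"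
  by (simp add: mconst_def subst_hom_single)

lemma subst_hom_mvar: "subst_hom c s (mvar i) = s i"
  by (simp add: mvar_def subst_hom_single hom_one)

end

lemma hom_subst_hom:
  assumes "comm_ring_hom h"
  shows "h (subst_hom c s f) = subst_hom (\<lambda>a. h (c a)) (\<lambda>i. h (s i)) f"
proof -
  interpret comm_ring_hom h by fact
  show ?thesis
    by (simp add: subst_hom_def monom_val_def hom_sum hom_prod hom_mult hom_power)
qed

lemma coeff_hom_mconst: "coeff_hom mconst"
  by unfold_locales (simp_all add: mconst_def single_add mult_single)

text \<open>The entries of vectors and matrices are unspecified outside their dimensions, so substitutions can
only be compared on the variables that occur.\<close>

lemma subst_hom_cong:
  assumes "f \<in> polys n A" "\<And>i. i < n \<Longrightarrow> s i = s' i"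
  shows "subst_hom c s f = subst_hom c s' f"
proof -
  have "s i = s' i" if "m \<in> keys f" "i \<in> keys m" for m i
    using assms that by (auto simp: polys_def)
  then show ?thesis
    unfolding subst_hom_def monom_val_def
    by (intro sum.cong refl arg_cong2[of _ _ _ _ "(*)"] prod.cong) auto
qed

lemma (in coeff_hom) subst_hom_poly_subst:
  "subst_hom c s (poly_subst t f) = subst_hom c (\<lambda>i. subst_hom c s (t i)) f"
  unfolding poly_subst_conv
  by (simp add: hom_subst_hom[OF subst.comm_ring_hom_axioms] subst_hom_mconst)

section \<open>Coefficient rings\<close>

definition subring_set :: "complex set \<Rightarrow> bool"
  where "subring_set A \<longleftrightarrow> 0 \<in> A \<and> 1 \<in> A \<and> (\<forall>x\<in>A. \<forall>y\<in>A. x + y \<in> A \<and> x * y \<in> A)"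

lemma subring_set_sum: "subring_set A \<Longrightarrow> (\<And>i. i \<in> I \<Longrightarrow> F i \<in> A) \<Longrightarrow> sum F I \<in> A"
  by (induction I rule: infinite_finite_induct) (auto simp: subring_set_def)

lemma polys_add:
  assumes "subring_set A" "f \<in> polys n A" "g \<in> polys n A"
  shows "f + g \<in> polys n A"
proof -
  have "keys (f + g) \<subseteq> keys f \<union> keys g"
    by (rule keys_add)
  then show ?thesis
    using assms by (fastforce simp: polys_def lookup_add subring_set_def)
qed

lemma polys_zero: "subring_set A \<Longrightarrow> 0 \<in> polys n A"
  by (auto simp: polys_def subring_set_def)

lemma polys_sum:
  "subring_set A \<Longrightarrow> (\<And>i. i \<in> I \<Longrightarrow> F i \<in> polys n A) \<Longrightarrow> sum F I \<in> polys n A"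
  by (induction I rule: infinite_finite_induct) (auto simp: polys_zero polys_add)

lemma polys_single:
  assumes "subring_set A" "a \<in> A" "keys m \<subseteq> {..<n}"
  shows "Poly_Mapping.single m a \<in> polys n A"
  using assms by (auto simp: polys_def lookup_single when_def subring_set_def split: if_splits)

lemma polys_mult:
  assumes "subring_set A" "f \<in> polys n A" "g \<in> polys n A"
  shows "f * g \<in> polys n A"
proof -
  have k: "keys (m + m') \<subseteq> {..<n}"
    if "m \<in> keys f" "m' \<in> keys g" for m m'
    using keys_add[of m m'] that assms by (fastforce simp: polys_def)
  show "f * g \<in> polys n A" unfolding mpoly_mult_terms[of f g]
    using assms k by (intro polys_sum polys_single) (auto simp: polys_def subring_set_def)
qed

lemma polys_one: "subring_set A \<Longrightarrow> 1 \<in> polys n A"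
  using polys_single[of A 1 0 n] by (simp add: subring_set_def)

lemma polys_mconst: "subring_set A \<Longrightarrow> a \<in> A \<Longrightarrow> mconst a \<in> polys n A"
  by (simp add: mconst_def polys_single)

lemma polys_mvar: "subring_set A \<Longrightarrow> i < n \<Longrightarrow> mvar i \<in> polys n A"
  by (simp add: mvar_def polys_single subring_set_def)

lemma polys_power: "subring_set A \<Longrightarrow> f \<in> polys n A \<Longrightarrow> f ^ k \<in> polys n A"
  by (induction k) (auto simp: polys_one polys_mult)

lemma polys_prod:
  "subring_set A \<Longrightarrow> (\<And>i. i \<in> I \<Longrightarrow> F i \<in> polys n A) \<Longrightarrow> prod F I \<in> polys n A"
  by (induction I rule: infinite_finite_induct) (auto simp: polys_one polys_mult)

lemma polys_poly_subst:
  assumes A: "subring_set A" and f: "f \<in> polys m A" and s: "\<And>i. i < m \<Longrightarrow> s i \<in> polys n A"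
  shows "poly_subst s f \<in> polys n A"
  unfolding poly_subst_def
proof (intro polys_sum polys_mult polys_mconst polys_prod polys_power A s)
  show "lookup f k \<in> A" for k
    using f by (simp add: polys_def)
  show "i < m" if "k \<in> keys f" "i \<in> keys k" for k i
    using f that by (auto simp: polys_def)
qed

lemma polys_mono: "A \<subseteq> B \<Longrightarrow> polys n A \<subseteq> polys n B"
  by (auto simp: polys_def)

lemma subring_set_UNIV: "subring_set UNIV"
  by (simp add: subring_set_def)

section \<open>Restriction to lines and planes\<close>

text \<open>\<open>line u w f\<close> is the polynomial \<open>f (u + t w)\<close> in \<open>t\<close>. \<open>plane u p a f\<close> is \<open>f (u + x p + y a)\<close> as
a polynomial in \<open>y\<close> whose coefficients are polynomials in \<open>x\<close>. The diagonal \<open>x = y\<close> of the plane is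
the line in direction \<open>p + a\<close>, and \<open>x = 0\<close> is the line in direction \<open>a\<close>. Two variables are needed
because a reflection acts diagonally on \<open>(x, y)\<close> but does not preserve a transversal line.\<close>

definition line :: "complex vec \<Rightarrow> complex vec \<Rightarrow> mpoly \<Rightarrow> complex poly"
  where "line u w = subst_hom (\<lambda>c. [:c:]) (\<lambda>i. [:u $ i, w $ i:])"

definition plane :: "complex vec \<Rightarrow> complex vec \<Rightarrow> complex vec \<Rightarrow> mpoly \<Rightarrow> complex poly poly"
  where "plane u p a = subst_hom (\<lambda>c. [:[:c:]:]) (\<lambda>i. [:[:u $ i, p $ i:], [:a $ i:]:])"

interpretation coeff_hom_poly: coeff_hom "\<lambda>c. [:c:]"
  by unfold_locales simp_all

interpretation coeff_hom_poly_poly: coeff_hom "\<lambda>c. [:[:c:]:]"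
  by unfold_locales simp_all

interpretation coeff_hom_mconst: coeff_hom mconst
  by (rule coeff_hom_mconst)

interpretation line: comm_ring_hom "line u w"
  unfolding line_def by (rule coeff_hom_poly.subst.comm_ring_hom_axioms)

interpretation plane: comm_ring_hom "plane u p a"
  unfolding plane_def by (rule coeff_hom_poly_poly.subst.comm_ring_hom_axioms)

interpretation poly_eval: comm_ring_hom "poly_eval v"
proof -
  have "coeff_hom (\<lambda>c. c)"
    by unfold_locales (rule refl)+
  then interpret coeff_hom "\<lambda>c. c" .
  show "comm_ring_hom (poly_eval v)"
    unfolding poly_eval_conv by (rule subst.comm_ring_hom_axioms)
qed

lemma poly_line:
  assumes "f \<in> polys n UNIV" "u \<in> carrier_vec n" "w \<in> carrier_vec n"
  shows "poly (line u w f) t = poly_eval (u + t \<cdot>\<^sub>v w) f"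
proof -
  have hom: "comm_ring_hom (\<lambda>q. poly q t)" by unfold_locales simp_all
  show ?thesis unfolding line_def poly_eval_conv hom_subst_hom[OF hom]
    using assms by (simp, intro subst_hom_cong[OF assms(1)]) auto
qed

lemma pcompose_line:
  assumes "f \<in> polys n UNIV" "u \<in> carrier_vec n" "w \<in> carrier_vec n"
  shows "pcompose (line u w f) [:t, 1:] = line (u + t \<cdot>\<^sub>v w) w f"
proof -
  have hom: "comm_ring_hom (\<lambda>q::complex poly. pcompose q [:t, 1:])"
    by unfold_locales (simp_all add: pcompose_add pcompose_mult pcompose_1)
  show ?thesis unfolding line_def hom_subst_hom[OF hom]
    using assms by (simp add: pcompose_pCons, intro subst_hom_cong[OF assms(1)]) (auto simp: pcompose_pCons)
qed

lemma poly_plane_diag: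
  assumes "f \<in> polys n UNIV" "u \<in> carrier_vec n" "p \<in> carrier_vec n" "a \<in> carrier_vec n"
  shows "poly (plane u p a f) [:0, 1:] = line u (p + a) f"
proof -
  have hom: "comm_ring_hom (\<lambda>q::complex poly poly. poly q [:0, 1:])" by unfold_locales simp_all
  show ?thesis unfolding plane_def line_def hom_subst_hom[OF hom]
    using assms by (simp, intro subst_hom_cong[OF assms(1)]) (auto simp: add.commute)
qed

lemma map_poly_eval0_hom: "comm_ring_hom (map_poly (\<lambda>q::complex poly. poly q 0))"
proof -
  have hom: "comm_ring_hom (\<lambda>q::complex poly. poly q 0)" by unfold_locales simp_all
  interpret map_poly_comm_ring_hom "\<lambda>q::complex poly. poly q 0" ..
  show ?thesis ..
qed

lemma coeff_plane_0:
  "poly (coeff (plane u p a f) k) 0 = coeff (line u a f) k"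
proof -
  have hom: "comm_ring_hom (map_poly (\<lambda>q::complex poly. poly q 0))" by (rule map_poly_eval0_hom)
  have "map_poly (\<lambda>q. poly q 0) (plane u p a f) = line u a f"
    unfolding plane_def line_def hom_subst_hom[OF hom]
    by (simp add: Polynomial.map_poly_pCons)
  then show ?thesis
    by (metis coeff_map_poly poly_0)
qed

lemma coeff_plane_scale:
  assumes "f \<in> polys n UNIV" "a \<in> carrier_vec n"
  shows "coeff (plane u p (z \<cdot>\<^sub>v a) f) k = [:z ^ k:] * coeff (plane u p a f) k"
proof -
  have hom: "comm_ring_hom (\<lambda>q::complex poly poly. pcompose q [:0, [:z:]:])"
    by unfold_locales (simp_all add: pcompose_add pcompose_mult pcompose_1)
  have "plane u p (z \<cdot>\<^sub>v a) f = pcompose (plane u p a f) [:0, [:z:]:]"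
    unfolding plane_def hom_subst_hom[OF hom]
    using assms by (simp add: pcompose_pCons, intro subst_hom_cong[OF assms(1)]) (auto simp: pcompose_pCons)
  then show ?thesis
    by (simp add: coeff_pcompose_linear poly_const_pow)
qed

lemma coeff_line_scale:
  assumes "f \<in> polys n UNIV" "a \<in> carrier_vec n"
  shows "coeff (line u (z \<cdot>\<^sub>v a) f) k = z ^ k * coeff (line u a f) k"
proof -
  have hom: "comm_ring_hom (\<lambda>q::complex poly. pcompose q [:0, z:])"
    by unfold_locales (simp_all add: pcompose_add pcompose_mult pcompose_1)
  have "line u (z \<cdot>\<^sub>v a) f = pcompose (line u a f) [:0, z:]"
    unfolding line_def hom_subst_hom[OF hom]
    using assms by (simp add: pcompose_pCons, intro subst_hom_cong[OF assms(1)]) (auto simp: pcompose_pCons)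
  then show ?thesis
    by (simp add: coeff_pcompose_linear)
qed

section \<open>Determinants\<close>

text \<open>Each term of the Leibniz formula contains one entry of every row.\<close>

lemma prod_dvd_det:
  fixes A :: "'a::idom mat"
  assumes A: "A \<in> carrier_mat l l" and d: "\<And>i j. i < l \<Longrightarrow> j < l \<Longrightarrow> p i dvd A $$ (i, j)"
  shows "(\<Prod>i<l. p i) dvd det A"
proof -
  have "(\<Prod>i<l. p i) dvd (\<Prod>i = 0..<l. A $$ (i, \<pi> i))" if "\<pi> permutes {0..<l}" for \<pi>
  proof -
    have "\<pi> i < l" if "i < l" for i
      using permutes_in_image[OF \<open>\<pi> permutes {0..<l}\<close>, of i] that by simp
    then show ?thesis
      unfolding atLeast0LessThan by (intro prod_dvd_prod d) auto
  qed
  then show ?thesis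
    unfolding det_def'[OF A] by (intro dvd_sum dvd_mult) auto
qed

text \<open>Multiplication by the unitriangular matrix of coefficients of the Newton polynomials
\<open>N_j = (t - x_0) ... (t - x_{j-1})\<close> makes the Vandermonde matrix lower triangular, because \<open>N_j\<close>
vanishes at \<open>x_i\<close> for \<open>i < j\<close>.\<close>

lemma det_vandermonde:
  fixes x :: "nat \<Rightarrow> 'a::idom"
  shows "det (mat l l (\<lambda>(i, j). x i ^ j)) = (\<Prod>j<l. \<Prod>i<j. x j - x i)"
proof -
  define N where "N j = (\<Prod>i<j. [:- x i, 1:])" for j
  have monic: "lead_coeff (N j) = 1" for j
    unfolding N_def by (simp add: lead_coeff_prod)
  have deg: "degree (N j) = j" for j
    unfolding N_def by (subst degree_prod_eq_sum_degree) auto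
  have evalN: "poly (N j) (x i) = (\<Prod>k<j. x i - x k)" for i j
    by (simp add: N_def poly_prod)
  define V where "V = mat l l (\<lambda>(i, j). x i ^ j)"
  define U where "U = mat l l (\<lambda>(k, j). coeff (N j) k)"
  have V: "V \<in> carrier_mat l l" and U: "U \<in> carrier_mat l l"
    by (simp_all add: V_def U_def)
  have VU: "(V * U) $$ (i, j) = (\<Prod>k<j. x i - x k)" if ij: "i < l" "j < l" for i j
  proof -
    have "(V * U) $$ (i, j) = (\<Sum>k<l. coeff (N j) k * x i ^ k)"
      using ij by (simp add: V_def U_def scalar_prod_def atLeast0LessThan mult.commute)
    also have "\<dots> = (\<Sum>k\<le>degree (N j). coeff (N j) k * x i ^ k)"
      by (rule sum.mono_neutral_right) (use ij in \<open>auto simp: deg coeff_eq_0\<close>)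
    also have "\<dots> = (\<Prod>k<j. x i - x k)"
      by (simp add: poly_altdef flip: evalN)
    finally show ?thesis .
  qed
  have "det V * det U = det (V * U)"
    using V U by (simp add: det_mult)
  moreover have "det U = 1"
  proof -
    have "upper_triangular U"
      by (auto simp: U_def upper_triangular_def deg intro!: coeff_eq_0)
    then have "det U = prod_list (diag_mat U)"
      using U by (rule det_upper_triangular)
    also have "\<dots> = 1"
      using monic by (simp add: prod_list_diag_prod U_def deg)
    finally show ?thesis .
  qed
  moreover have "det (V * U) = (\<Prod>j<l. \<Prod>i<j. x j - x i)"
  proof -
    have "(V * U) $$ (i, j) = 0" if "i < j" "j < l" for i j
      using that VU[of i j] by auto
    then have "det (V * U) = prod_list (diag_mat (V * U))"
      using V U by (intro det_lower_triangular[where n = l]) auto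
    also have "\<dots> = (\<Prod>j<l. \<Prod>i<j. x j - x i)"
      using V U VU by (simp add: prod_list_diag_prod atLeast0LessThan)
    finally show ?thesis .
  qed
  ultimately show ?thesis
    by (simp add: V_def)
qed

section \<open>Cyclic permutations\<close>

lemma sum_roots_of_unity:
  fixes q :: complex
  assumes "q ^ m = 1" "q \<noteq> 1"
  shows "(\<Sum>r<m. q ^ r) = 0"
  using assms by (simp add: sum_gp_strict)

text \<open>In the application \<open>Xs\<close> is the set of cosets, \<open>T\<close> is left multiplication by a reflection, and \<open>e\<close>
is the order of that reflection.\<close>

locale periodic_map =
  fixes T :: "'x \<Rightarrow> 'x" and Xs :: "'x set" and e :: nat
  assumes finite_Xs: "finite Xs"
    and T_closed: "C \<in> Xs \<Longrightarrow> T C \<in> Xs"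
    and e_pos: "0 < e"
    and T_periodic: "C \<in> Xs \<Longrightarrow> (T ^^ e) C = C"
begin

definition period :: "'x \<Rightarrow> nat"
  where "period C = card (orbit T C)"

text \<open>The choice depends on the orbit only, so that \<open>pos\<close> numbers each cycle consecutively from its base
element; these numbers index the Fourier transform on the cycle.\<close>

definition base :: "'x \<Rightarrow> 'x"
  where "base C = (SOME D. D \<in> orbit T C)"

definition pos :: "'x \<Rightarrow> nat"
  where "pos C = funpow_dist T (base C) C"

lemma self_in_orbit: "C \<in> Xs \<Longrightarrow> C \<in> orbit T C"
  using T_periodic e_pos unfolding orbit_altdef by (metis (mono_tags, lifting) mem_Collect_eq)

lemma funpow_closed: "C \<in> Xs \<Longrightarrow> (T ^^ k) C \<in> Xs"
  by (induction k) (auto simp: T_closed)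

lemma orbit_subset_Xs: "C \<in> Xs \<Longrightarrow> orbit T C \<subseteq> Xs"
  by (auto simp: orbit_altdef funpow_closed)

lemma orbit_eq_iff:
  assumes C: "C \<in> Xs"
  shows "D \<in> orbit T C \<longleftrightarrow> D \<in> Xs \<and> orbit T D = orbit T C"
proof
  assume D: "D \<in> orbit T C"
  have "C \<in> orbit T D"
    using self_in_orbit[OF C] D by (rule orbit_swap)
  then show "D \<in> Xs \<and> orbit T D = orbit T C"
    using D orbit_subset_Xs[OF C] by (auto intro: orbit_trans)
next
  assume "D \<in> Xs \<and> orbit T D = orbit T C"
  then show "D \<in> orbit T C"
    using self_in_orbit by blast
qed

lemma period_conv: "C \<in> Xs \<Longrightarrow> period C = funpow_dist1 T C C"
  unfolding period_def
  by (subst orbit_conv_funpow_dist1[OF self_in_orbit])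
     (simp_all add: card_image inj_on_funpow_dist1 self_in_orbit)

lemma period_pos: "C \<in> Xs \<Longrightarrow> 0 < period C"
  by (simp add: period_conv)

lemma funpow_period: "C \<in> Xs \<Longrightarrow> (T ^^ period C) C = C"
  using period_conv funpow_dist1_prop self_in_orbit by metis

lemma inj_on_funpow_period: "C \<in> Xs \<Longrightarrow> inj_on (\<lambda>k. (T ^^ k) C) {..<period C}"
  using inj_on_funpow_dist1[OF self_in_orbit] by (simp add: period_conv atLeast0LessThan)

lemma orbit_conv: "C \<in> Xs \<Longrightarrow> orbit T C = (\<lambda>k. (T ^^ k) C) ` {..<period C}"
  using orbit_conv_funpow_dist1[OF self_in_orbit] by (simp add: period_conv atLeast0LessThan)

lemma funpow_eq_self_iff:
  assumes C: "C \<in> Xs"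
  shows "(T ^^ k) C = C \<longleftrightarrow> period C dvd k"
proof -
  have "(T ^^ (k mod period C)) C = (T ^^ k) C"
    by (rule funpow_mod_eq[OF funpow_period[OF C]])
  moreover have "(T ^^ (k mod period C)) C = C \<longleftrightarrow> k mod period C = 0"
    using inj_onD[OF inj_on_funpow_period[OF C], of "k mod period C" 0] period_pos[OF C] by auto
  ultimately show ?thesis
    by (auto simp: dvd_eq_mod_eq_0)
qed

lemma period_dvd_e: "C \<in> Xs \<Longrightarrow> period C dvd e"
  using funpow_eq_self_iff T_periodic by blast

lemma period_cong: "orbit T C = orbit T D \<Longrightarrow> period C = period D"
  by (simp add: period_def)

lemma base_cong: "orbit T C = orbit T D \<Longrightarrow> base C = base D"
  by (simp add: base_def)

lemma base:
  assumes "C \<in> Xs"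
  shows "base C \<in> Xs" "orbit T (base C) = orbit T C" "period (base C) = period C"
proof -
  have "base C \<in> orbit T C"
    unfolding base_def using self_in_orbit[OF assms] by (rule someI)
  then show "base C \<in> Xs" "orbit T (base C) = orbit T C"
    using orbit_eq_iff assms by blast+
  then show "period (base C) = period C"
    by (simp add: period_def)
qed

lemma funpow_pos: "C \<in> Xs \<Longrightarrow> (T ^^ pos C) (base C) = C"
  unfolding pos_def using base self_in_orbit by (metis funpow_dist_prop)

lemma pos_funpow_base:
  assumes C: "C \<in> Xs" and k: "k < period C"
  shows "pos ((T ^^ k) (base C)) = k"
    and "(T ^^ k) (base C) \<in> orbit T C"
    and "base ((T ^^ k) (base C)) = base C"
    and "pos C < period C"
proof -
  have pos_less: "pos D < period D" if D: "D \<in> Xs" for D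
  proof -
    have "D \<in> (\<lambda>k. (T ^^ k) (base D)) ` {..<period D}"
      using self_in_orbit[OF D] orbit_conv[of "base D"] base[OF D] by simp
    then obtain i where "i < period D" "(T ^^ i) (base D) = D"
      by auto
    then show ?thesis
      unfolding pos_def using funpow_dist_least[of i T "base D" D] by (meson leI le_less_trans not_le)
  qed
  show orb: "(T ^^ k) (base C) \<in> orbit T C"
    using orbit_conv[of "base C"] base[OF C] k by auto
  then have D: "(T ^^ k) (base C) \<in> Xs" and orb': "orbit T ((T ^^ k) (base C)) = orbit T C"
    using orbit_eq_iff[OF C] by auto
  show b: "base ((T ^^ k) (base C)) = base C"
    by (rule base_cong) (rule orb')
  have "(T ^^ pos ((T ^^ k) (base C))) (base C) = (T ^^ k) (base C)"
    using funpow_pos[OF D] b by simp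
  then show "pos ((T ^^ k) (base C)) = k"
    using inj_onD[OF inj_on_funpow_period[OF base(1)[OF C]]] pos_less[OF D] k period_cong[OF orb']
    by (simp add: base(3)[OF C])
  show "pos C < period C"
    using pos_less C .
qed

lemma bij_betw_orbit:
  assumes C: "C \<in> Xs"
  shows "bij_betw (\<lambda>k. (T ^^ k) (base C)) {..<period C} (orbit T C)"
  using inj_on_funpow_period[OF base(1)[OF C]] orbit_conv[OF base(1)[OF C]] base[OF C]
  by (simp add: bij_betw_def)

lemma sum_same_orbit:
  assumes C: "C \<in> Xs"
  shows "(\<Sum>D\<in>Xs. if orbit T D = orbit T C then F D else 0) = (\<Sum>k<period C. F ((T ^^ k) (base C)))"
proof -
  have "(\<Sum>D\<in>Xs. if orbit T D = orbit T C then F D else 0) = (\<Sum>D\<in>orbit T C. F D)"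
    using orbit_subset_Xs[OF C] orbit_eq_iff[OF C] finite_Xs
    by (intro sum.mono_neutral_cong_right) auto
  also have "\<dots> = (\<Sum>k<period C. F ((T ^^ k) (base C)))"
    by (rule sum.reindex_bij_betw[OF bij_betw_orbit[OF C], symmetric])
  finally show ?thesis .
qed

text \<open>The order of vanishing to be established. It arises in two ways: here as the sum of the exponents
by which the Fourier-transformed rows are divisible, and in \<open>sum_contact\<close> as the sum of the orders
of the factors of a Vandermonde determinant. Both agree with the exponent in the discriminant
because they count \<open>e (m - 1) / 2\<close> for each cycle of length \<open>m\<close> (\<open>twice_expo\<close>).\<close>

definition expo :: nat
  where "expo = (\<Sum>C\<in>Xs. e div period C * pos C)"

lemma sum_over_orbits:
  "(\<Sum>C\<in>Xs. F C) = (\<Sum>Q\<in>orbit T ` Xs. \<Sum>C\<in>Q. F C)"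
proof -
  have "{x \<in> Xs. orbit T x = Q} = Q" if "Q \<in> orbit T ` Xs" for Q
    using that orbit_eq_iff orbit_subset_Xs by fastforce
  then show ?thesis
    by (subst sum.image_gen[OF finite_Xs, of _ "orbit T"]) (simp cong: sum.cong)
qed

lemma twice_sum_lessThan: "2 * (\<Sum>k<(m::nat). k) = m * (m - 1)"
  by (induction m) (auto simp: algebra_simps)

lemma twice_expo: "2 * expo = (\<Sum>Q\<in>orbit T ` Xs. e * (card Q - 1))"
proof -
  have "2 * (\<Sum>C\<in>orbit T D. e div period C * pos C) = e * (card (orbit T D) - 1)" if D: "D \<in> Xs" for D
  proof -
    have "(\<Sum>C\<in>orbit T D. e div period C * pos C) =
        (\<Sum>k<period D. e div period ((T ^^ k) (base D)) * pos ((T ^^ k) (base D)))"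
      by (rule sum.reindex_bij_betw[OF bij_betw_orbit[OF D], symmetric])
    also have "\<dots> = (\<Sum>k<period D. e div period D * k)"
      using pos_funpow_base[OF D] orbit_eq_iff[OF D] by (intro sum.cong) (auto cong: period_cong)
    also have "\<dots> = e div period D * (\<Sum>k<period D. k)"
      by (simp add: sum_distrib_left)
    finally have "2 * (\<Sum>C\<in>orbit T D. e div period C * pos C) = e div period D * (period D * (period D - 1))"
      using twice_sum_lessThan[of "period D"] by (metis mult.left_commute)
    also have "\<dots> = e * (period D - 1)"
      using period_dvd_e[OF D] by (metis dvd_div_mult_self mult.assoc)
    finally show ?thesis by (simp add: period_def)
  qed
  then show ?thesis
    unfolding expo_def sum_over_orbits sum_distrib_left by (intro sum.cong) auto
qed

text \<open>The order to which a generic invariant takes equal values on the rows \<open>C\<close> and \<open>D\<close>, for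
\<open>C \<noteq> D\<close>; see \<open>vandermonde_order\<close>. The diagonal value is chosen so that the sum over one
orbit is \<open>e\<close>.\<close>

definition contact :: "'x \<Rightarrow> 'x \<Rightarrow> nat"
  where "contact C D = (if orbit T D = orbit T C then e div period C else 0)"

lemma contact_sym: "contact C D = contact D C"
  by (auto simp: contact_def period_def)

lemma sum_symmetric_pairs:
  fixes h :: "nat \<Rightarrow> nat \<Rightarrow> nat"
  assumes "\<And>i j. h i j = h j i"
  shows "(\<Sum>i<l. \<Sum>j<l. h i j) = 2 * (\<Sum>j<l. \<Sum>i<j. h j i) + (\<Sum>i<l. h i i)"
proof (induction l)
  case (Suc l)
  have "(\<Sum>i<l. h i l) = (\<Sum>i<l. h l i)"
    using assms by simp
  with Suc show ?case
    by (simp add: sum.distrib)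
qed simp

lemma sum_contact:
  assumes c: "bij_betw c {..<l::nat} Xs"
  shows "(\<Sum>j<l. \<Sum>i<j. contact (c j) (c i)) = expo"
proof -
  have 1: "(\<Sum>D\<in>Xs. contact C D) = e" if C: "C \<in> Xs" for C
    using sum_same_orbit[OF C, of "\<lambda>_. e div period C"] period_dvd_e[OF C]
    by (simp add: contact_def)
  have "(\<Sum>i<l. \<Sum>j<l. contact (c i) (c j)) = (\<Sum>i<l. \<Sum>D\<in>Xs. contact (c i) D)"
    by (intro sum.cong sum.reindex_bij_betw[OF c] refl)
  also have "\<dots> = (\<Sum>C\<in>Xs. \<Sum>D\<in>Xs. contact C D)"
    by (rule sum.reindex_bij_betw[OF c])
  also have "\<dots> = (\<Sum>C\<in>Xs. e)"
    using 1 by simp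
  also have "\<dots> = (\<Sum>Q\<in>orbit T ` Xs. e * card Q)"
    by (subst sum_over_orbits) (simp add: mult.commute)
  finally have A: "(\<Sum>i<l. \<Sum>j<l. contact (c i) (c j)) = (\<Sum>Q\<in>orbit T ` Xs. e * card Q)" .
  have "(\<Sum>i<l. contact (c i) (c i)) = (\<Sum>C\<in>Xs. contact C C)"
    by (rule sum.reindex_bij_betw[OF c])
  also have "\<dots> = (\<Sum>Q\<in>orbit T ` Xs. \<Sum>C\<in>Q. contact C C)"
    by (rule sum_over_orbits)
  also have "\<dots> = (\<Sum>Q\<in>orbit T ` Xs. e)"
  proof (rule sum.cong[OF refl])
    fix Q assume "Q \<in> orbit T ` Xs"
    then obtain D where D: "D \<in> Xs" "Q = orbit T D" by auto
    have "(\<Sum>C\<in>Q. contact C C) = (\<Sum>C\<in>Q. e div period D)"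
      using D orbit_eq_iff[OF D(1)] by (intro sum.cong) (auto simp: contact_def cong: period_cong)
    also have "\<dots> = e"
      using D period_dvd_e[OF D(1)] by (simp add: period_def[symmetric])
    finally show "(\<Sum>C\<in>Q. contact C C) = e" .
  qed
  finally have B: "(\<Sum>i<l. contact (c i) (c i)) = (\<Sum>Q\<in>orbit T ` Xs. e)" .
  have "e * card Q = e * (card Q - 1) + e" if "Q \<in> orbit T ` Xs" for Q
  proof -
    have "0 < card Q"
      using that period_pos by (auto simp: period_def)
    then show ?thesis
      by (cases "card Q") simp_all
  qed
  then have "(\<Sum>Q\<in>orbit T ` Xs. e * card Q) = 2 * expo + (\<Sum>Q\<in>orbit T ` Xs. e)"
    unfolding twice_expo sum.distrib[symmetric] by (intro sum.cong) auto
  with A B sum_symmetric_pairs[of "\<lambda>i j. contact (c i) (c j)" l] contact_sym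
  show ?thesis by simp
qed

end


section \<open>Orders of vanishing of determinants permuted by a rotation\<close>

text \<open>Vanishing of the low coefficients in \<open>y\<close> gives divisibility by a power of the parameter on the
diagonal \<open>x = y\<close>, with a cofactor whose value at the origin is known.\<close>

lemma power_dvd_poly_shift:
  fixes B :: "complex poly poly"
  assumes "\<And>k. k < n \<Longrightarrow> coeff B k = 0"
  obtains Q where "poly B [:0, 1:] = [:0, 1:] ^ n * poly Q [:0, 1:]"
    and "poly (poly Q [:0, 1:]) 0 = poly (coeff B n) 0"
proof -
  have "monom 1 n dvd B"
    using assms by (simp add: monom_1_dvd_iff')
  then obtain Q where Q: "B = monom 1 n * Q" ..
  have "coeff B n = coeff Q 0"
    using coeff_monom_mult[of 1 n Q n] by (simp add: Q)
  moreover have "poly (poly Q [:0, 1:]) 0 = poly (coeff Q 0) 0"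
    by (cases Q) simp
  ultimately show thesis
    by (intro that[of Q]) (simp_all add: Q poly_monom)
qed

lemma sum_const_poly: "(\<Sum>r\<in>A. [:F r:]) = [:\<Sum>r\<in>A. F r:]"
  by (induction A rule: infinite_finite_induct) simp_all

lemma prod_const_poly: "(\<Prod>r\<in>A. [:F r :: complex:]) = [:\<Prod>r\<in>A. F r:]"
  by (induction A rule: infinite_finite_induct) simp_all

text \<open>\<open>\<omega>\<close> is a primitive \<open>e\<close>-th root of unity: moving along the cycles of \<open>T\<close> will correspond to
rotating the variable \<open>y\<close> by \<open>\<omega>\<close>.\<close>

locale rotation = periodic_map +
  fixes \<omega> :: complex
  assumes root: "\<And>k. \<omega> ^ k = 1 \<longleftrightarrow> e dvd k"
begin

definition rotates :: "('a \<Rightarrow> complex poly poly) \<Rightarrow> bool"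
  where "rotates a \<longleftrightarrow> (\<forall>C\<in>Xs. \<forall>k. coeff (a (T C)) k = [:\<omega> ^ k:] * coeff (a C) k)"

lemma omega_nonzero: "\<omega> \<noteq> 0"
  using root[of e] e_pos by (auto simp: power_0_left)

lemma omega_eq_iff: "i < e \<Longrightarrow> j < e \<Longrightarrow> \<omega> ^ i = \<omega> ^ j \<longleftrightarrow> i = j"
proof (induction i j rule: linorder_wlog)
  case (le i j)
  have "\<omega> ^ j = \<omega> ^ i * \<omega> ^ (j - i)"
    using le by (simp flip: power_add)
  then have "\<omega> ^ i = \<omega> ^ j \<longleftrightarrow> e dvd j - i"
    using omega_nonzero root[of "j - i"] by auto
  then show ?case
    using le by (auto dest: dvd_imp_le)
qed auto

lemma rotates_funpow:
  assumes a: "rotates a" and C: "C \<in> Xs"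
  shows "coeff (a ((T ^^ r) C)) k = [:\<omega> ^ (k * r):] * coeff (a C) k"
proof (induction r)
  case (Suc r)
  have "coeff (a ((T ^^ Suc r) C)) k = [:\<omega> ^ k:] * coeff (a ((T ^^ r) C)) k"
    using a funpow_closed[OF C] by (simp add: rotates_def)
  then show ?case
    using Suc by (simp add: power_add mult.assoc mult.commute[of "\<omega> ^ k"])
qed simp

text \<open>After a full cycle the row returns to itself, so a nonzero coefficient of \<open>y\<^sup>k\<close> must be fixed by the
accumulated rotation. Equivalently, \<open>k\<close> is a multiple of \<open>e div period C\<close>.\<close>

lemma rotates_coeff_period:
  assumes "rotates a" "C \<in> Xs" "coeff (a C) k \<noteq> 0"
  shows "\<omega> ^ (k * period C) = 1"
  using rotates_funpow[OF assms(1,2), of "period C" k] funpow_period[OF assms(2)] assms(3)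
  by (auto simp: poly_eq_iff)

lemma sum_over_cosets:
  assumes "bij_betw c {..<l::nat} Xs" "C \<in> Xs"
  shows "(\<Sum>k<l. if orbit T (c k) = orbit T C then F (c k) else 0) =
    (\<Sum>r<period C. F ((T ^^ r) (base C)))"
  using sum.reindex_bij_betw[OF assms(1), of "\<lambda>D. if orbit T D = orbit T C then F D else 0"]
    sum_same_orbit[OF assms(2), of F] by simp

text \<open>The lower bound for the order. \<open>W \<eta>\<close> below is the discrete Fourier transform on each cycle. Row
\<open>i\<close> of \<open>W \<eta> * M\<close> only contains powers \<open>y\<^sup>k\<close> with \<open>\<omega>\<^sup>k = \<omega>\<^sup>n\<close> for \<open>n = e div period C * pos C\<close>,
all others being killed by a vanishing sum of roots of unity; as \<open>n < e\<close>, the smallest such \<open>k\<close>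
is \<open>n\<close>. Since \<open>W \<eta>\<close> is invertible over the constants, the determinant of \<open>M\<close> inherits the
product of these powers.\<close>

lemma det_divisible:
  assumes c: "bij_betw c {..<l::nat} Xs" and a: "\<And>j. j < l \<Longrightarrow> rotates (a j)"
  shows "[:0, 1:] ^ expo dvd det (mat l l (\<lambda>(i, j). poly (a j (c i)) [:0, 1:]))"
proof -
  let ?x = "[:0, 1:] :: complex poly"
  define W :: "complex \<Rightarrow> complex poly mat" where
    "W z = mat l l (\<lambda>(i, k). if orbit T (c k) = orbit T (c i)
       then [:z ^ (e div period (c i) * pos (c i) * pos (c k)):] else 0)" for z
  define M where "M = mat l l (\<lambda>(i, j). poly (a j (c i)) ?x)"
  have cX: "c i \<in> Xs" if "i < l" for i
    using c that by (auto simp: bij_betw_def)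
  have W: "W z \<in> carrier_mat l l" for z by (simp add: W_def)
  have M: "M \<in> carrier_mat l l" by (simp add: M_def)
  define \<eta> where "\<eta> = inverse \<omega>"
  have dp: "e div period C * pos C < e" "e = e div period C * period C" "pos C < period C"
    if C: "C \<in> Xs" for C
  proof -
    show e: "e = e div period C * period C"
      using period_dvd_e[OF C] by simp
    show p: "pos C < period C"
      using pos_funpow_base(4)[OF C period_pos[OF C]] .
    have "e div period C > 0"
      using e e_pos by (metis gr0I mult_0)
    then have "e div period C * pos C < e div period C * period C"
      using p by simp
    then show "e div period C * pos C < e"
      using e by simp
  qed
  have rows: "?x ^ (e div period (c i) * pos (c i)) dvd (W \<eta> * M) $$ (i, j)"
    if ij: "i < l" "j < l" for i j
  proof -
    let ?C = "c i"
    let ?n = "e div period ?C * pos ?C"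
    note C = cX[OF ij(1)]
    define B where "B = (\<Sum>r<period ?C. [:[:\<eta> ^ (?n * r):]:] * a j ((T ^^ r) (base ?C)))"
    have "(W \<eta> * M) $$ (i, j) = (\<Sum>k<l. if orbit T (c k) = orbit T ?C
        then [:\<eta> ^ (?n * pos (c k)):] * poly (a j (c k)) ?x else 0)"
      using ij unfolding W_def M_def
      by (simp add: scalar_prod_def atLeast0LessThan if_distrib[of "\<lambda>x. x * _"] cong: if_cong)
    also have "\<dots> = (\<Sum>r<period ?C. [:\<eta> ^ (?n * pos ((T ^^ r) (base ?C))):] *
        poly (a j ((T ^^ r) (base ?C))) ?x)"
      by (rule sum_over_cosets[OF c C])
    also have "\<dots> = poly B ?x"
      using pos_funpow_base(1)[OF C] by (simp add: B_def poly_sum)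
    finally have eq: "(W \<eta> * M) $$ (i, j) = poly B ?x" .
    have "coeff B k = 0" if k: "k < ?n" for k
    proof (cases "coeff (a j (base ?C)) k = 0")
      case True
      then show ?thesis
        using rotates_funpow[OF a[OF ij(2)] base(1)[OF C]] by (simp add: B_def coeff_sum)
    next
      case False
      define q where "q = \<eta> ^ ?n * \<omega> ^ k"
      have "coeff B k = (\<Sum>r<period ?C. [:q ^ r:]) * coeff (a j (base ?C)) k"
        using rotates_funpow[OF a[OF ij(2)] base(1)[OF C]]
        by (simp add: B_def coeff_sum q_def power_mult_distrib power_mult sum_distrib_right
            mult.commute[of "(\<omega> ^ k) ^ _"])
      also have "(\<Sum>r<period ?C. [:q ^ r:]) = [:\<Sum>r<period ?C. q ^ r:]"
        by (rule sum_const_poly)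
      also have "(\<Sum>r<period ?C. q ^ r) = 0"
      proof (rule sum_roots_of_unity)
        have "\<omega> ^ (?n * period ?C) = 1"
          using root[of "?n * period ?C"] dp(2)[OF C]
          by (metis dvd_triv_left mult.assoc mult.commute)
        moreover have "\<omega> ^ (k * period ?C) = 1"
          using rotates_coeff_period[OF a[OF ij(2)] base(1)[OF C] False] base(3)[OF C] by simp
        ultimately show "q ^ period ?C = 1"
          by (simp add: q_def \<eta>_def power_mult_distrib power_inverse flip: power_mult)
        have "\<omega> ^ k \<noteq> \<omega> ^ ?n"
          using omega_eq_iff[of k ?n] k dp(1)[OF C] by auto
        then show "q \<noteq> 1"
          using omega_nonzero by (simp add: q_def \<eta>_def power_inverse field_simps)
      qed
      finally show ?thesis by simp
    qed
    then obtain Q where "poly B ?x = ?x ^ ?n * poly Q ?x"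
      using power_dvd_poly_shift by metis
    then show ?thesis
      unfolding eq by simp
  qed
  have "(\<Prod>i<l. ?x ^ (e div period (c i) * pos (c i))) dvd det (W \<eta> * M)"
    by (rule prod_dvd_det[OF mult_carrier_mat[OF W M]]) (rule rows)
  moreover have "(\<Prod>i<l. ?x ^ (e div period (c i) * pos (c i))) = ?x ^ expo"
    unfolding expo_def
    using sum.reindex_bij_betw[OF c, of "\<lambda>C. e div period C * pos C"] by (simp flip: power_sum)
  ultimately have div: "?x ^ expo dvd det (W \<eta>) * det M"
    using det_mult[OF W M] by simp
  \<comment> \<open>orthogonality of the characters of a cyclic group, on each cycle separately\<close>
  have inv: "(W \<eta> * W \<omega>) $$ (i, k) = (if i = k then [:of_nat (period (c i)):] else 0)"
    if ik: "i < l" "k < l" for i k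
  proof -
    let ?C = "c i" and ?D = "c k"
    note C = cX[OF ik(1)] and D = cX[OF ik(2)]
    have "(W \<eta> * W \<omega>) $$ (i, k) = (\<Sum>h<l. if orbit T (c h) = orbit T ?C
        then [:\<eta> ^ (e div period ?C * pos ?C * pos (c h)):] *
          (if orbit T ?D = orbit T (c h) then
            [:\<omega> ^ (e div period (c h) * pos (c h) * pos ?D):] else 0) else 0)"
      using ik unfolding W_def
      by (simp add: scalar_prod_def atLeast0LessThan if_distrib[of "\<lambda>x. x * _"] cong: if_cong)
    also have "\<dots> = (\<Sum>r<period ?C. [:\<eta> ^ (e div period ?C * pos ?C * r):] *
          (if orbit T ?D = orbit T ?C then [:\<omega> ^ (e div period ?C * r * pos ?D):] else 0))"
    proof (subst sum_over_cosets[OF c C], rule sum.cong[OF refl])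
      fix r assume "r \<in> {..<period ?C}"
      then have r: "r < period ?C" by simp
      have "orbit T ((T ^^ r) (base ?C)) = orbit T ?C"
        using pos_funpow_base(2)[OF C r] orbit_eq_iff[OF C] by blast
      then show "[:\<eta> ^ (e div period ?C * pos ?C * pos ((T ^^ r) (base ?C))):] *
          (if orbit T ?D = orbit T ((T ^^ r) (base ?C)) then
            [:\<omega> ^ (e div period ((T ^^ r) (base ?C)) * pos ((T ^^ r) (base ?C)) * pos ?D):] else 0) =
          [:\<eta> ^ (e div period ?C * pos ?C * r):] *
          (if orbit T ?D = orbit T ?C then [:\<omega> ^ (e div period ?C * r * pos ?D):] else 0)"
        using pos_funpow_base(1)[OF C r] period_cong[of "(T ^^ r) (base ?C)" ?C] by simp
    qed
    also have "\<dots> = (if i = k then [:of_nat (period (c i)):] else 0)"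
    proof (cases "orbit T ?D = orbit T ?C")
      case False
      then show ?thesis by auto
    next
      case True
      define q where "q = \<eta> ^ (e div period ?C * pos ?C) * \<omega> ^ (e div period ?C * pos ?D)"
      have "(\<Sum>r<period ?C. [:\<eta> ^ (e div period ?C * pos ?C * r):] *
          (if orbit T ?D = orbit T ?C then [:\<omega> ^ (e div period ?C * r * pos ?D):] else 0)) =
          (\<Sum>r<period ?C. [:q ^ r:])"
        using True by (simp add: q_def power_mult_distrib power_mult mult.commute mult.left_commute
            flip: power_mult)
      also have "\<dots> = [:\<Sum>r<period ?C. q ^ r:]"
        by (rule sum_const_poly)
      also have "\<dots> = (if i = k then [:of_nat (period (c i)):] else 0)"
      proof (cases "i = k")
        case True
        then have "q = 1"
          using omega_nonzero by (simp add: q_def \<eta>_def flip: power_mult_distrib)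
        then show ?thesis using True by simp
      next
        case False
        have "?C \<noteq> ?D"
          using False c ik by (auto simp: bij_betw_def inj_on_def)
        then have "pos ?C \<noteq> pos ?D"
          using funpow_pos[OF C] funpow_pos[OF D] base_cong[OF True] by metis
        moreover have "e div period ?C > 0"
          using dp(2)[OF C] e_pos by (metis gr0I mult_0)
        ultimately have "\<omega> ^ (e div period ?C * pos ?C) \<noteq> \<omega> ^ (e div period ?C * pos ?D)"
          using omega_eq_iff[OF dp(1)[OF C], of "e div period ?C * pos ?D"] dp(1)[OF D]
            period_cong[OF True] by simp
        then have "q \<noteq> 1"
          using omega_nonzero by (simp add: q_def \<eta>_def power_inverse field_simps)
        moreover have "q ^ period ?C = 1"
        proof -
          have "\<omega> ^ (e div period ?C * s * period ?C) = 1" for s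
            using root[of "e div period ?C * s * period ?C"] dp(2)[OF C]
            by (metis dvd_triv_left mult.assoc mult.commute)
          then show ?thesis
            by (simp add: q_def \<eta>_def power_mult_distrib power_inverse flip: power_mult)
        qed
        ultimately show ?thesis
          using False sum_roots_of_unity by simp
      qed
      finally show ?thesis .
    qed
    finally show ?thesis .
  qed
  have "det (W \<eta>) * det (W \<omega>) = det (W \<eta> * W \<omega>)"
    using det_mult[OF W W] by simp
  also have "\<dots> = prod_list (diag_mat (W \<eta> * W \<omega>))"
    using W[of \<eta>] W[of \<omega>] inv by (intro det_upper_triangular[where n = l]) auto
  also have "\<dots> = (\<Prod>i<l. [:of_nat (period (c i)):])"
    using W[of \<eta>] W[of \<omega>] inv by (simp add: prod_list_diag_prod atLeast0LessThan)
  finally have detW: "det (W \<eta>) * det (W \<omega>) = (\<Prod>i<l. [:of_nat (period (c i)):])" .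
  have unit: "is_unit (\<Prod>i<l. [:of_nat (period (c i)) :: complex:])"
    unfolding prod_const_poly using period_pos[OF cX]
    by (auto simp: is_unit_const_poly_iff dvd_field_iff)
  have "?x ^ expo dvd (\<Prod>i<l. [:of_nat (period (c i)):]) * det M"
    using dvd_mult[OF div, of "det (W \<omega>)"] by (simp add: ac_simps flip: detW)
  then show ?thesis
    using unit unfolding M_def by (simp add: dvd_mult_unit_iff')
qed

text \<open>The model for the upper bound. If \<open>D\<close> is \<open>r\<close> steps after \<open>C\<close> in the same cycle, the coefficient of
\<open>y\<^sup>k\<close> in the difference of the two rows is \<open>1 - \<omega> ^ (k * r)\<close> times that of row \<open>C\<close>. It vanishes for
\<open>k = 0\<close> and, as row \<open>C\<close> only contains multiples of \<open>d = e div period C\<close>, for \<open>0 < k < d\<close>; for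
\<open>k = d\<close> the factor \<open>1 - \<omega> ^ (d * r)\<close> is nonzero because \<open>0 < d r < e\<close>.\<close>

lemma vandermonde_order:
  assumes c: "bij_betw c {..<l::nat} Xs" and a: "rotates a"
    and sep: "\<And>C D. C \<in> Xs \<Longrightarrow> D \<in> Xs \<Longrightarrow> orbit T C \<noteq> orbit T D \<Longrightarrow>
      poly (coeff (a C) 0) 0 \<noteq> poly (coeff (a D) 0) 0"
    and ram: "\<And>C. C \<in> Xs \<Longrightarrow> 1 < period C \<Longrightarrow> poly (coeff (a C) (e div period C)) 0 \<noteq> 0"
  obtains q where "det (mat l l (\<lambda>(i, j). poly (a (c i)) [:0, 1:] ^ j)) = [:0, 1:] ^ expo * q"
    and "poly q 0 \<noteq> 0"
proof -
  let ?x = "[:0, 1:] :: complex poly"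
  have cX: "c i \<in> Xs" if "i < l" for i
    using c that by (auto simp: bij_betw_def)
  have pair: "\<exists>q. poly (a C) ?x - poly (a D) ?x = ?x ^ contact C D * q \<and> poly q 0 \<noteq> 0"
    if C: "C \<in> Xs" and D: "D \<in> Xs" and neq: "C \<noteq> D" for C D
  proof (cases "orbit T D = orbit T C")
    case False
    have "poly (poly B ?x) 0 = poly (coeff B 0) 0" for B :: "complex poly poly"
      by (cases B) simp
    then have "poly (poly (a C) ?x - poly (a D) ?x) 0 \<noteq> 0"
      using sep[OF C D] False by auto
    then show ?thesis
      using False by (intro exI[of _ "poly (a C) ?x - poly (a D) ?x"]) (simp add: contact_def)
  next
    case True
    let ?d = "e div period C"
    have e: "e = ?d * period C"
      using period_dvd_e[OF C] by simp
    have "D \<in> orbit T C"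
      using True D orbit_eq_iff[OF C] by blast
    then obtain r where r: "r < period C" "D = (T ^^ r) C"
      using orbit_conv[OF C] by auto
    have r0: "0 < r"
      using r neq by (cases r) auto
    have co: "coeff (a C - a D) k = [:1 - \<omega> ^ (k * r):] * coeff (a C) k" for k
      using rotates_funpow[OF a C, of r k] r by (simp add: smult_diff_left)
    have "coeff (a C - a D) k = 0" if k: "k < ?d" for k
    proof (cases "k = 0")
      case False
      have "k * period C < e"
        using k e period_pos[OF C] by (metis mult_less_mono1)
      then have "\<not> e dvd k * period C"
        using False period_pos[OF C] by (auto dest: dvd_imp_le)
      then have "coeff (a C) k = 0"
        using rotates_coeff_period[OF a C] root by blast
      then show ?thesis by (simp only: co) simp
    qed (simp only: co, simp)
    then obtain Q where Q: "poly (a C - a D) ?x = ?x ^ ?d * poly Q ?x"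
      "poly (poly Q ?x) 0 = poly (coeff (a C - a D) ?d) 0"
      by (rule power_dvd_poly_shift)
    have "?d > 0"
      using e e_pos by (metis gr0I mult_0)
    then have "?d * r < e"
      using r(1) e by (metis mult_less_mono2)
    then have "\<not> e dvd ?d * r"
      using r0 \<open>?d > 0\<close> by (auto dest: dvd_imp_le)
    then have "\<omega> ^ (?d * r) \<noteq> 1"
      by (simp add: root)
    moreover have "poly (coeff (a C) ?d) 0 \<noteq> 0"
      by (rule ram[OF C]) (use r(1) r0 in linarith)
    ultimately have "poly (coeff (a C - a D) ?d) 0 \<noteq> 0"
      unfolding co by simp
    then show ?thesis
      using True Q by (intro exI[of _ "poly Q ?x"]) (simp add: contact_def)
  qed
  have "\<forall>i j. \<exists>q. j < l \<longrightarrow> i < j \<longrightarrow>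
      poly (a (c j)) ?x - poly (a (c i)) ?x = ?x ^ contact (c j) (c i) * q \<and> poly q 0 \<noteq> 0"
  proof (intro allI)
    fix i j
    show "\<exists>q. j < l \<longrightarrow> i < j \<longrightarrow>
        poly (a (c j)) ?x - poly (a (c i)) ?x = ?x ^ contact (c j) (c i) * q \<and> poly q 0 \<noteq> 0"
    proof (cases "j < l \<and> i < j")
      case True
      then show ?thesis
        using pair[of "c j" "c i"] cX inj_onD[OF bij_betw_imp_inj_on[OF c], of j i] by auto
    qed auto
  qed
  then obtain q where q: "\<And>i j. j < l \<Longrightarrow> i < j \<Longrightarrow>
      poly (a (c j)) ?x - poly (a (c i)) ?x = ?x ^ contact (c j) (c i) * q i j \<and> poly (q i j) 0 \<noteq> 0"
    unfolding choice_iff by auto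
  have "det (mat l l (\<lambda>(i, j). poly (a (c i)) ?x ^ j)) =
      (\<Prod>j<l. \<Prod>i<j. ?x ^ contact (c j) (c i) * q i j)"
    unfolding det_vandermonde using q by (intro prod.cong) auto
  also have "\<dots> = ?x ^ expo * (\<Prod>j<l. \<Prod>i<j. q i j)"
    by (simp add: prod.distrib sum_contact[OF c, symmetric] flip: power_sum)
  finally show thesis
    using q by (intro that[of "\<Prod>j<l. \<Prod>i<j. q i j"]) (auto simp: poly_prod)
qed

end

section \<open>A polynomial vanishing everywhere is zero\<close>

lemma digits_unique:
  fixes a b :: "nat \<Rightarrow> nat"
  assumes "\<And>i. i < n \<Longrightarrow> a i < N" "\<And>i. i < n \<Longrightarrow> b i < N"
    and "(\<Sum>i<n. a i * N ^ i) = (\<Sum>i<n. b i * N ^ i)" and "i < n"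
  shows "a i = b i"
  using assms
proof (induction n arbitrary: a b i)
  case (Suc n)
  have split: "(\<Sum>i<Suc n. c i * N ^ i) = c 0 + N * (\<Sum>i<n. c (Suc i) * N ^ i)" for c :: "nat \<Rightarrow> nat"
    unfolding sum.lessThan_Suc_shift by (simp add: sum_distrib_left algebra_simps)
  have N: "a 0 < N" "b 0 < N"
    using Suc.prems by auto
  have eq: "a 0 + N * (\<Sum>i<n. a (Suc i) * N ^ i) = b 0 + N * (\<Sum>i<n. b (Suc i) * N ^ i)"
    using Suc.prems(3) unfolding split .
  have "a 0 = (a 0 + N * (\<Sum>i<n. a (Suc i) * N ^ i)) mod N"
    using N by simp
  also have "\<dots> = b 0"
    unfolding eq using N by simp
  finally have 0: "a 0 = b 0" .
  then have "(\<Sum>i<n. a (Suc i) * N ^ i) = (\<Sum>i<n. b (Suc i) * N ^ i)"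
    using eq N(1) 0 by (metis add_left_cancel gr_implies_not0 mult_left_cancel)
  then have "a (Suc j) = b (Suc j)" if "j < n" for j
    by (rule Suc.IH[of "\<lambda>i. a (Suc i)" "\<lambda>i. b (Suc i)", rotated 2])
       (use Suc.prems(1,2) that in auto)
  then show ?case
    using 0 Suc.prems(4) by (cases i) auto
qed simp

text \<open>Kronecker substitution: on the curve with coordinates \<open>t ^ (N ^ i)\<close> the monomials of bounded
exponents become distinct powers of \<open>t\<close>, their exponent vectors being the base \<open>N\<close> digits.\<close>

lemma polys_eqI:
  assumes f: "f \<in> polys n UNIV" and g: "g \<in> polys n UNIV"
    and eq: "\<And>v. v \<in> carrier_vec n \<Longrightarrow> poly_eval v f = poly_eval v g"
  shows "f = g"
proof -
  define K where "K = keys f \<union> keys g"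
  have K: "keys m \<subseteq> {..<n}" if "m \<in> K" for m
    using that f g by (auto simp: K_def polys_def)
  obtain N where N: "\<And>m i. m \<in> K \<Longrightarrow> i < n \<Longrightarrow> lookup m i < N"
  proof
    show "lookup m i < Suc (Max ((\<lambda>(m, i). lookup m i) ` (K \<times> {..<n})))"
      if "m \<in> K" "i < n" for m i
      unfolding less_Suc_eq_le by (rule Max_ge) (use that in \<open>auto simp: K_def\<close>)
  qed
  define w where "w m = (\<Sum>i<n. lookup m i * N ^ i)" for m :: "nat \<Rightarrow>\<^sub>0 nat"
  have inj: "inj_on w K"
  proof (rule inj_onI, rule poly_mapping_eqI)
    fix m m' i assume m: "m \<in> K" "m' \<in> K" and eq: "w m = w m'"
    have "lookup m i = lookup m' i" if "i < n"
      by (rule digits_unique[OF N[OF m(1)] N[OF m(2)] eq[unfolded w_def] that])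
    moreover have "lookup m i = lookup m' i" if "\<not> i < n"
      using K[OF m(1)] K[OF m(2)] that by (metis in_keys_iff lessThan_iff subsetD)
    ultimately show "lookup m i = lookup m' i" by blast
  qed
  define k where "k h = (\<Sum>m\<in>K. monom (lookup h m) (w m))" for h :: mpoly
  have eval: "poly (k h) t = poly_eval (vec n (\<lambda>i. t ^ (N ^ i))) h"
    if h: "keys h \<subseteq> K" for h t
  proof -
    have "finite K" by (simp add: K_def)
    have "coeff_hom (\<lambda>c::complex. c)"
      by unfold_locales (rule refl)+
    then have "poly_eval (vec n (\<lambda>i. t ^ (N ^ i))) h =
        (\<Sum>m\<in>K. lookup h m * monom_val (($) (vec n (\<lambda>i. t ^ (N ^ i)))) m)"
      unfolding poly_eval_conv by (rule coeff_hom.subst_hom_superset[OF _ \<open>finite K\<close> h])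
    also have "\<dots> = (\<Sum>m\<in>K. lookup h m * t ^ w m)"
    proof (rule sum.cong[OF refl])
      fix m assume "m \<in> K"
      have "monom_val (($) (vec n (\<lambda>i. t ^ (N ^ i)))) m =
          (\<Prod>i<n. vec n (\<lambda>i. t ^ (N ^ i)) $ i ^ lookup m i)"
        using K[OF \<open>m \<in> K\<close>] by (intro monom_val_superset) auto
      also have "\<dots> = t ^ w m"
        unfolding w_def power_sum by (intro prod.cong) (simp_all add: mult.commute flip: power_mult)
      finally show "lookup h m * monom_val (($) (vec n (\<lambda>i. t ^ (N ^ i)))) m =
        lookup h m * t ^ w m" by simp
    qed
    finally show ?thesis
      by (simp add: k_def poly_sum poly_monom)
  qed
  have "poly (k f) t = poly (k g) t" for t
    using eval[of f t] eval[of g t] eq[of "vec n (\<lambda>i. t ^ (N ^ i))"] by (simp add: K_def)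
  then have "k f = k g"
    using poly_eq_poly_eq_iff by blast
  have co: "coeff (k h) (w m) = lookup h m" if "m \<in> K" for h m
  proof -
    have "coeff (k h) (w m) = (\<Sum>m'\<in>K. if m' = m then lookup h m' else 0)"
      unfolding k_def coeff_sum coeff_monom using inj that
      by (intro sum.cong) (auto simp: inj_on_def)
    then show ?thesis
      using that by (simp add: K_def)
  qed
  show ?thesis
  proof (rule poly_mapping_eqI)
    fix m
    show "lookup f m = lookup g m"
    proof (cases "m \<in> K")
      case True
      then show ?thesis using co[of m f] co[of m g] \<open>k f = k g\<close> by simp
    next
      case False
      then show ?thesis by (auto simp: K_def in_keys_iff)
    qed
  qed
qed

section \<open>Matrix groups acting on polynomials\<close>

locale matrix_group =
  fixes n :: nat and \<Gamma> :: "complex mat monoid" (structure)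
  assumes group: "group \<Gamma>"
    and carr: "carrier \<Gamma> \<subseteq> carrier_mat n n"
    and mult: "mult \<Gamma> = (*)"
    and one: "one \<Gamma> = 1\<^sub>m n"
begin

sublocale group \<Gamma> by (rule group)

lemma mat_carrier: "\<sigma> \<in> carrier \<Gamma> \<Longrightarrow> \<sigma> \<in> carrier_mat n n"
  using carr by blast

lemma mult_vec_carrier:
  "\<sigma> \<in> carrier \<Gamma> \<Longrightarrow> v \<in> carrier_vec n \<Longrightarrow> \<sigma> *\<^sub>v v \<in> carrier_vec n"
  by (rule mult_mat_vec_carrier[OF mat_carrier])

lemma mult_vec_mult:
  "\<sigma> \<in> carrier \<Gamma> \<Longrightarrow> \<tau> \<in> carrier \<Gamma> \<Longrightarrow> v \<in> carrier_vec n \<Longrightarrow>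
   (\<sigma> \<otimes> \<tau>) *\<^sub>v v = \<sigma> *\<^sub>v (\<tau> *\<^sub>v v)"
  using assoc_mult_mat_vec[OF mat_carrier mat_carrier] by (simp add: mult)

lemma one_mult_vec: "v \<in> carrier_vec n \<Longrightarrow> \<one> *\<^sub>v v = v"
  by (simp add: one)

lemma inv_mult_vec:
  "\<sigma> \<in> carrier \<Gamma> \<Longrightarrow> v \<in> carrier_vec n \<Longrightarrow> inv \<sigma> *\<^sub>v (\<sigma> *\<^sub>v v) = v"
  "\<sigma> \<in> carrier \<Gamma> \<Longrightarrow> v \<in> carrier_vec n \<Longrightarrow> \<sigma> *\<^sub>v (inv \<sigma> *\<^sub>v v) = v"
  using mult_vec_mult[of "inv \<sigma>" \<sigma> v] mult_vec_mult[of \<sigma> "inv \<sigma>" v]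
  by (simp_all add: one_mult_vec)

abbreviation linear_subst :: "complex mat \<Rightarrow> nat \<Rightarrow> mpoly"
  where "linear_subst h i \<equiv> \<Sum>j<dim_col h. mconst (h $$ (i, j)) * mvar j"

lemma poly_act_conv: "poly_act \<Gamma> \<sigma> = poly_subst (linear_subst (inv \<sigma>))"
  by (simp add: fun_eq_iff poly_act_def Let_def)

lemma poly_act_hom: "comm_ring_hom (poly_act \<Gamma> \<sigma>)"
  unfolding poly_act_conv poly_subst_conv by (rule coeff_hom_mconst.subst.comm_ring_hom_axioms)

lemma poly_act_mconst: "poly_act \<Gamma> \<sigma> (mconst c) = mconst c"
  unfolding poly_act_conv poly_subst_conv by (rule coeff_hom_mconst.subst_hom_mconst)

lemma mult_mat_vec_index:
  "h \<in> carrier_mat n n \<Longrightarrow> v \<in> carrier_vec n \<Longrightarrow> i < n \<Longrightarrow>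
   (h *\<^sub>v v) $ i = (\<Sum>j<n. h $$ (i, j) * v $ j)"
  by (simp add: scalar_prod_def atLeast0LessThan)

lemma line_poly_act:
  assumes \<sigma>: "\<sigma> \<in> carrier \<Gamma>" and f: "f \<in> polys n UNIV"
    and u: "u \<in> carrier_vec n" and w: "w \<in> carrier_vec n"
  shows "line u w (poly_act \<Gamma> \<sigma> f) = line (inv \<sigma> *\<^sub>v u) (inv \<sigma> *\<^sub>v w) f"
proof -
  let ?h = "inv \<sigma>"
  have h: "?h \<in> carrier_mat n n"
    using \<sigma> mat_carrier by auto
  have "line u w (linear_subst ?h i) = [:(?h *\<^sub>v u) $ i, (?h *\<^sub>v w) $ i:]" if "i < n" for i
  proof -
    have "line u w (linear_subst ?h i) = (\<Sum>j<n. [:?h $$ (i, j) * u $ j, ?h $$ (i, j) * w $ j:])"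
      using h by (simp add: line.hom_sum line.hom_mult)
        (simp add: line_def coeff_hom_poly.subst_hom_mconst coeff_hom_poly.subst_hom_mvar
            mult.commute)
    also have "\<dots> = [:(?h *\<^sub>v u) $ i, (?h *\<^sub>v w) $ i:]"
      by (simp only: mult_mat_vec_index[OF h u that] mult_mat_vec_index[OF h w that])
         (simp add: poly_eq_iff coeff_sum coeff_pCons split: nat.splits)
    finally show ?thesis .
  qed
  then show ?thesis
    unfolding poly_act_conv line_def coeff_hom_poly.subst_hom_poly_subst
    by (intro subst_hom_cong[OF f]) simp
qed

lemma plane_poly_act:
  assumes \<sigma>: "\<sigma> \<in> carrier \<Gamma>" and f: "f \<in> polys n UNIV"
    and u: "u \<in> carrier_vec n" and p: "p \<in> carrier_vec n" and a: "a \<in> carrier_vec n"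
  shows "plane u p a (poly_act \<Gamma> \<sigma> f) =
    plane (inv \<sigma> *\<^sub>v u) (inv \<sigma> *\<^sub>v p) (inv \<sigma> *\<^sub>v a) f"
proof -
  let ?h = "inv \<sigma>"
  have h: "?h \<in> carrier_mat n n"
    using \<sigma> mat_carrier by auto
  have "plane u p a (linear_subst ?h i) =
      [:[:(?h *\<^sub>v u) $ i, (?h *\<^sub>v p) $ i:], [:(?h *\<^sub>v a) $ i:]:]" if "i < n" for i
  proof -
    have "plane u p a (linear_subst ?h i) =
        (\<Sum>j<n. [:[:?h $$ (i, j) * u $ j, ?h $$ (i, j) * p $ j:], [:?h $$ (i, j) * a $ j:]:])"
      using h by (simp add: plane.hom_sum plane.hom_mult)
        (simp add: plane_def coeff_hom_poly_poly.subst_hom_mconst coeff_hom_poly_poly.subst_hom_mvar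
            mult.commute)
    also have "\<dots> = [:[:(?h *\<^sub>v u) $ i, (?h *\<^sub>v p) $ i:], [:(?h *\<^sub>v a) $ i:]:]"
      by (simp only: mult_mat_vec_index[OF h u that] mult_mat_vec_index[OF h p that]
            mult_mat_vec_index[OF h a that])
         (simp add: poly_eq_iff coeff_sum coeff_pCons split: nat.splits)
    finally show ?thesis .
  qed
  then show ?thesis
    unfolding poly_act_conv plane_def coeff_hom_poly_poly.subst_hom_poly_subst
    by (intro subst_hom_cong[OF f]) simp
qed

lemma poly_eval_conv_line:
  assumes "f \<in> polys n UNIV" "v \<in> carrier_vec n"
  shows "poly_eval v f = poly (line v v f) 0"
proof -
  have "v + 0 \<cdot>\<^sub>v v = v" using assms by auto
  then show ?thesis using poly_line[OF assms(1,2,2), of 0] by simp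
qed

lemma poly_act_polys:
  assumes \<sigma>: "\<sigma> \<in> carrier \<Gamma>" and A: "subring_set A" and e: "elements_mat (inv \<sigma>) \<subseteq> A"
    and f: "f \<in> polys n A"
  shows "poly_act \<Gamma> \<sigma> f \<in> polys n A"
proof -
  have h: "inv \<sigma> \<in> carrier_mat n n"
    using \<sigma> mat_carrier by auto
  have "(inv \<sigma>) $$ (i, j) \<in> A" if "i < n" "j < n" for i j
    by (rule subsetD[OF e elements_matI[OF h that refl]])
  then show ?thesis
    unfolding poly_act_conv using A h f
    by (intro polys_poly_subst[OF A f] polys_sum polys_mult polys_mconst polys_mvar) auto
qed

lemma poly_act_polys_UNIV:
  "\<sigma> \<in> carrier \<Gamma> \<Longrightarrow> f \<in> polys n UNIV \<Longrightarrow> poly_act \<Gamma> \<sigma> f \<in> polys n UNIV"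
  using poly_act_polys[of \<sigma> UNIV f] by (simp add: subring_set_UNIV)

lemma poly_eval_poly_act:
  assumes "\<sigma> \<in> carrier \<Gamma>" "f \<in> polys n UNIV" "v \<in> carrier_vec n"
  shows "poly_eval v (poly_act \<Gamma> \<sigma> f) = poly_eval (inv \<sigma> *\<^sub>v v) f"
  using assms by (simp add: poly_eval_conv_line poly_act_polys_UNIV line_poly_act mult_vec_carrier)

lemma poly_act_mult:
  assumes "\<sigma> \<in> carrier \<Gamma>" "\<tau> \<in> carrier \<Gamma>" "f \<in> polys n UNIV"
  shows "poly_act \<Gamma> (\<sigma> \<otimes> \<tau>) f = poly_act \<Gamma> \<sigma> (poly_act \<Gamma> \<tau> f)"
  using assms
  by (intro polys_eqI[of _ n])
     (auto simp: poly_act_polys_UNIV poly_eval_poly_act inv_mult_group mult_vec_mult mult_vec_carrier)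

end

section \<open>Cosets and averaging\<close>

locale coset_action = matrix_group +
  fixes S G :: "complex mat set"
  assumes S: "subgroup S \<Gamma>" and finite_S: "finite S"
    and G: "subgroup G (\<Gamma>\<lparr>carrier := S\<rparr>)"
begin

abbreviation cosets :: "complex mat set set"
  where "cosets \<equiv> left_cosets \<Gamma> S G"

lemma S_carrier: "\<sigma> \<in> S \<Longrightarrow> \<sigma> \<in> carrier \<Gamma>"
  by (rule subgroup.mem_carrier[OF S])

lemma G_subset: "G \<subseteq> S"
  using subgroup.subset[OF G] by simp

lemma subgroup_G: "subgroup G \<Gamma>"
  by (rule incl_subgroup[OF S G])

lemma finite_G: "finite G"
  using finite_subset[OF G_subset finite_S] .

lemmas S_mult = subgroup.m_closed[OF S] and S_inv = subgroup.m_inv_closed[OF S]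
  and S_one = subgroup.one_closed[OF S]
  and G_mult = subgroup.m_closed[OF subgroup_G] and G_inv = subgroup.m_inv_closed[OF subgroup_G]
  and G_one = subgroup.one_closed[OF subgroup_G]

lemma G_S: "\<tau> \<in> G \<Longrightarrow> \<tau> \<in> S"
  using G_subset by blast

lemma cosets_conv: "cosets = (\<lambda>\<sigma>. \<sigma> <# G) ` S"
  by (auto simp: left_cosets_def LCOSETS_def l_coset_def)

lemma finite_cosets: "finite cosets"
  by (simp add: cosets_conv finite_S)

lemma l_coset_conv: "\<sigma> <# H = (\<lambda>\<tau>. \<sigma> \<otimes> \<tau>) ` H"
  by (auto simp: l_coset_def)

lemma coset_memI: "\<sigma> \<in> S \<Longrightarrow> \<tau> \<in> G \<Longrightarrow> \<sigma> \<otimes> \<tau> \<in> \<sigma> <# G"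
  by (auto simp: l_coset_conv)

lemma coset_self: "\<sigma> \<in> S \<Longrightarrow> \<sigma> \<in> \<sigma> <# G"
  using coset_memI[of \<sigma> "\<one>"] G_one S_carrier by simp

lemma coset_eq:
  assumes C: "C \<in> cosets" and \<sigma>: "\<sigma> \<in> C"
  shows "\<sigma> \<in> S" "C = \<sigma> <# G"
proof -
  obtain \<tau> where \<tau>: "\<tau> \<in> S" "C = \<tau> <# G"
    using C by (auto simp: cosets_conv)
  then obtain h where h: "h \<in> G" "\<sigma> = \<tau> \<otimes> h"
    using \<sigma> by (auto simp: l_coset_conv)
  show "\<sigma> \<in> S"
    using \<tau> h S_mult G_S by blast
  show "C = \<sigma> <# G"
    using lcos_m_assoc[of G \<tau> h] \<tau> h subgroup.lcos_module_imp
    by (metis (no_types, lifting) G_S S_carrier coset_join3 subgroup.subset subgroup_G)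
qed

lemma coset_nonempty: "C \<in> cosets \<Longrightarrow> \<exists>\<sigma>. \<sigma> \<in> C"
  using coset_self by (auto simp: cosets_conv)

text \<open>The sum over \<open>G\<close> is not normalized: it is only used as a surjection onto the invariants.\<close>

definition trace :: "mpoly \<Rightarrow> mpoly"
  where "trace h = (\<Sum>\<tau>\<in>G. poly_act \<Gamma> \<tau> h)"

text \<open>On \<open>G\<close>-invariant polynomials the choice of a representative does not matter (\<open>coset_act_eq\<close>), so
that the rows of the secondary matrix may be indexed by the cosets themselves.\<close>

definition coset_act :: "complex mat set \<Rightarrow> mpoly \<Rightarrow> mpoly"
  where "coset_act C = poly_act \<Gamma> (SOME \<sigma>. \<sigma> \<in> C)"

definition invariant :: "complex mat set \<Rightarrow> mpoly \<Rightarrow> bool"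
  where "invariant H f \<longleftrightarrow> f \<in> polys n UNIV \<and> (\<forall>\<tau>\<in>H. poly_act \<Gamma> \<tau> f = f)"

lemma coset_act_eq:
  assumes C: "C \<in> cosets" and \<sigma>: "\<sigma> \<in> C" and f: "invariant G f"
  shows "coset_act C f = poly_act \<Gamma> \<sigma> f"
proof -
  define \<tau> where "\<tau> = (SOME \<sigma>. \<sigma> \<in> C)"
  have \<tau>: "\<tau> \<in> C"
    unfolding \<tau>_def using \<sigma> by (rule someI)
  then obtain h where h: "h \<in> G" "\<tau> = \<sigma> \<otimes> h"
    using coset_eq(2)[OF C \<sigma>] by (auto simp: l_coset_conv)
  then have "poly_act \<Gamma> \<tau> f = poly_act \<Gamma> \<sigma> f"
    using poly_act_mult[of \<sigma> h f] coset_eq[OF C \<sigma>] f G_S S_carrier by (simp add: invariant_def)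
  then show ?thesis
    by (simp add: coset_act_def \<tau>_def)
qed

lemma trace_polys: "h \<in> polys n UNIV \<Longrightarrow> trace h \<in> polys n UNIV"
  unfolding trace_def
  by (intro polys_sum) (auto simp: subring_set_UNIV poly_act_polys_UNIV G_S S_carrier)

lemma poly_act_sum: "poly_act \<Gamma> \<sigma> (sum F I) = (\<Sum>i\<in>I. poly_act \<Gamma> \<sigma> (F i))"
proof -
  interpret comm_ring_hom "poly_act \<Gamma> \<sigma>" by (rule poly_act_hom)
  show ?thesis by (rule hom_sum)
qed

lemma poly_act_times: "poly_act \<Gamma> \<sigma> (f * g) = poly_act \<Gamma> \<sigma> f * poly_act \<Gamma> \<sigma> g"
proof -
  interpret comm_ring_hom "poly_act \<Gamma> \<sigma>" by (rule poly_act_hom)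
  show ?thesis by (rule hom_mult)
qed

lemma poly_act_power: "poly_act \<Gamma> \<sigma> (f ^ k) = poly_act \<Gamma> \<sigma> f ^ k"
proof -
  interpret comm_ring_hom "poly_act \<Gamma> \<sigma>" by (rule poly_act_hom)
  show ?thesis by (rule hom_power)
qed

text \<open>A translate of a trace is the sum of the translates by the elements of one coset. This makes its
local behaviour at a point visible: it is governed by the images of the point under the coset.\<close>

lemma poly_act_trace:
  assumes \<sigma>: "\<sigma> \<in> S" and h: "h \<in> polys n UNIV"
  shows "poly_act \<Gamma> \<sigma> (trace h) = (\<Sum>\<rho>\<in>\<sigma> <# G. poly_act \<Gamma> \<rho> h)"
proof -
  have inj: "inj_on (\<lambda>\<tau>. \<sigma> \<otimes> \<tau>) G"
    by (rule inj_onI) (use \<sigma> G_S S_carrier in \<open>auto simp: l_cancel\<close>)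
  have "poly_act \<Gamma> \<sigma> (trace h) = (\<Sum>\<tau>\<in>G. poly_act \<Gamma> (\<sigma> \<otimes> \<tau>) h)"
    unfolding trace_def poly_act_sum
    using \<sigma> h G_S S_carrier by (intro sum.cong) (auto simp: poly_act_mult)
  then show ?thesis
    by (simp add: l_coset_conv sum.reindex[OF inj])
qed

lemma invariant_trace:
  assumes h: "h \<in> polys n UNIV"
  shows "invariant G (trace h)"
  unfolding invariant_def
proof (intro conjI ballI trace_polys h)
  fix \<tau> assume \<tau>: "\<tau> \<in> G"
  have "\<tau> <# G = G"
    using \<tau> subgroup_G S_carrier G_S by (intro coset_join3) auto
  then show "poly_act \<Gamma> \<tau> (trace h) = trace h"
    using poly_act_trace[OF G_S[OF \<tau>] h] by (simp add: trace_def)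
qed

lemma coset_act_trace:
  assumes C: "C \<in> cosets" and h: "h \<in> polys n UNIV"
  shows "coset_act C (trace h) = (\<Sum>\<rho>\<in>C. poly_act \<Gamma> \<rho> h)"
proof -
  obtain \<sigma> where \<sigma>: "\<sigma> \<in> C" using coset_nonempty[OF C] by blast
  show ?thesis
    using coset_act_eq[OF C \<sigma> invariant_trace[OF h]] poly_act_trace[OF coset_eq(1)[OF C \<sigma>] h]
      coset_eq(2)[OF C \<sigma>] by simp
qed

lemma invariant_power:
  assumes "invariant H f"
  shows "invariant H (f ^ k)"
  using assms by (simp add: invariant_def poly_act_power polys_power subring_set_UNIV)

lemma trace_invariant:
  assumes f: "invariant G f"
  obtains h where "h \<in> polys n UNIV" "trace h = f"
proof
  let ?c = "mconst (1 / of_nat (card G))"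
  show "?c * f \<in> polys n UNIV"
    using f by (intro polys_mult polys_mconst) (auto simp: invariant_def subring_set_UNIV)
  have "card G \<noteq> 0"
    using finite_G G_one by auto
  have "trace (?c * f) = (\<Sum>\<tau>\<in>G. ?c * f)"
    unfolding trace_def poly_act_times poly_act_mconst using f by (simp add: invariant_def)
  also have "\<dots> = (mconst (of_nat (card G)) * ?c) * f"
    by (simp add: mconst_def)
  also have "mconst (of_nat (card G)) * ?c = 1"
    using \<open>card G \<noteq> 0\<close> by (simp add: mconst_def mult_single del: single_of_nat)
  finally show "trace (?c * f) = f" by simp
qed

end

section \<open>Avoiding finitely many linear conditions\<close>

text \<open>A vector space over an infinite field is not a finite union of proper subspaces.\<close>

lemma ex_avoiding_functionals:
  fixes F :: "'i \<Rightarrow> mpoly \<Rightarrow> complex"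
  assumes "finite I"
    and "\<And>i h h' t. i \<in> I \<Longrightarrow> h \<in> polys n UNIV \<Longrightarrow> h' \<in> polys n UNIV \<Longrightarrow>
      F i (h + mconst t * h') = F i h + t * F i h'"
    and "\<And>i. i \<in> I \<Longrightarrow> \<exists>h\<in>polys n UNIV. F i h \<noteq> 0"
  shows "\<exists>h\<in>polys n UNIV. \<forall>i\<in>I. F i h \<noteq> 0"
  using assms
proof (induction I rule: finite_induct)
  case empty
  show ?case using polys_zero[OF subring_set_UNIV] by auto
next
  case (insert j I)
  obtain h where h: "h \<in> polys n UNIV" "\<And>i. i \<in> I \<Longrightarrow> F i h \<noteq> 0"
    using insert.IH insert.prems by auto
  obtain h' where h': "h' \<in> polys n UNIV" "F j h' \<noteq> 0"
    using insert.prems(2)[of j] by auto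
  obtain t where t: "t \<notin> (\<lambda>i. - F i h / F i h') ` insert j I" "t \<noteq> 0"
    using ex_new_if_finite[OF infinite_UNIV_char_0, of "insert 0 ((\<lambda>i. - F i h / F i h') ` insert j I)"]
      insert.hyps by auto
  have "F i (h + mconst t * h') \<noteq> 0" if i: "i \<in> insert j I" for i
  proof (cases "F i h' = 0")
    case True
    then have "F i h \<noteq> 0" using i h h' by auto
    then show ?thesis
      using insert.prems(1)[OF i h(1) h'(1)] True by simp
  next
    case False
    have "t \<noteq> - F i h / F i h'" using t i by blast
    then have "F i h + t * F i h' \<noteq> 0"
      using False by (simp add: field_simps add_eq_0_iff)
    then show ?thesis
      using insert.prems(1)[OF i h(1) h'(1)] by simp
  qed
  moreover have "h + mconst t * h' \<in> polys n UNIV"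
    using h h' by (intro polys_add polys_mult polys_mconst subring_set_UNIV) auto
  ultimately show ?case by blast
qed

section \<open>The order of vanishing along a line\<close>

text \<open>The local situation: the stabilizer of \<open>u\<close> in \<open>S\<close> is cyclic, and its generator fixes the direction
\<open>p\<close> and multiplies the direction \<open>a\<close> by a primitive \<open>e\<close>-th root of unity. The line under
consideration runs through \<open>u\<close> in direction \<open>p + a\<close>. Points with trivial stabilizer are included
with \<open>e = 1\<close>.\<close>

locale local_point = coset_action +
  fixes g :: "complex mat" and e :: nat and \<zeta> :: complex and u p a :: "complex vec"
  assumes g: "g \<in> S" and e: "0 < e"
    and u: "u \<in> carrier_vec n" and p: "p \<in> carrier_vec n" and a: "a \<in> carrier_vec n"
    and g_power: "\<And>k. g [^] (k :: nat) = \<one> \<longleftrightarrow> e dvd k"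
    and zeta_power: "\<And>k. \<zeta> ^ k = 1 \<longleftrightarrow> e dvd k"
    and gu: "g *\<^sub>v u = u" and gp: "g *\<^sub>v p = p" and ga: "g *\<^sub>v a = \<zeta> \<cdot>\<^sub>v a"
    and stab: "\<And>\<sigma>. \<sigma> \<in> S \<Longrightarrow> \<sigma> *\<^sub>v u = u \<Longrightarrow> \<exists>k :: nat. \<sigma> = g [^] k"
    and a_nonzero: "1 < e \<Longrightarrow> a \<noteq> 0\<^sub>v n"
begin

lemma g_carrier: "g \<in> carrier \<Gamma>" using g S_carrier by blast

lemma zeta_nonzero: "\<zeta> \<noteq> 0"
  using zeta_power[of e] e by (auto simp: power_0_left)

abbreviation shift :: "complex mat set \<Rightarrow> complex mat set"
  where "shift C \<equiv> g <# C"

lemma g_pow_S: "g [^] (k :: nat) \<in> S"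
  by (induction k) (auto simp: S_one S_mult g)

lemma shift_coset: "\<sigma> \<in> S \<Longrightarrow> shift (\<sigma> <# G) = (g \<otimes> \<sigma>) <# G"
  using subgroup.subset[OF subgroup_G] g_carrier S_carrier by (intro lcos_m_assoc) auto

lemma funpow_shift:
  assumes "\<sigma> \<in> S"
  shows "(shift ^^ k) (\<sigma> <# G) = (g [^] k \<otimes> \<sigma>) <# G"
proof (induction k)
  case (Suc k)
  have "g \<otimes> (g [^] k \<otimes> \<sigma>) = g [^] Suc k \<otimes> \<sigma>"
    using assms g_carrier S_carrier nat_pow_Suc2[OF g_carrier, of k] by (simp add: m_assoc)
  then show ?case
    using Suc shift_coset[OF S_mult[OF g_pow_S assms]] by simp
qed (use assms S_carrier in simp)

sublocale rotation shift cosets e "inverse \<zeta>"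
proof
  show "finite cosets" by (rule finite_cosets)
  show "shift C \<in> cosets" if "C \<in> cosets" for C
    using that shift_coset S_mult[OF g] by (auto simp: cosets_conv)
  show "0 < e" by (rule e)
  show "(shift ^^ e) C = C" if "C \<in> cosets" for C
    using that funpow_shift[of _ e] g_power[of e] S_carrier by (auto simp: cosets_conv)
  show "inverse \<zeta> ^ k = 1 \<longleftrightarrow> e dvd k" for k
    using zeta_power[of k] by (simp add: power_inverse)
qed

lemma inv_g_vec: "inv g *\<^sub>v u = u" "inv g *\<^sub>v p = p" "inv g *\<^sub>v a = inverse \<zeta> \<cdot>\<^sub>v a"
proof -
  have gm: "g \<in> carrier_mat n n" by (rule mat_carrier[OF g_carrier])
  show "inv g *\<^sub>v u = u" "inv g *\<^sub>v p = p"
    using inv_mult_vec(1)[OF g_carrier u] inv_mult_vec(1)[OF g_carrier p] gu gp by simp_all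
  have "g *\<^sub>v (inverse \<zeta> \<cdot>\<^sub>v a) = a"
    using mult_mat_vec[OF gm a, of "inverse \<zeta>"] ga zeta_nonzero a by (simp add: smult_smult_assoc)
  then show "inv g *\<^sub>v a = inverse \<zeta> \<cdot>\<^sub>v a"
    using inv_mult_vec(1)[OF g_carrier, of "inverse \<zeta> \<cdot>\<^sub>v a"] a by simp
qed

lemma inv_g_pow_vec:
  "inv (g [^] (k :: nat)) *\<^sub>v u = u"
  "inv (g [^] k) *\<^sub>v a = inverse \<zeta> ^ k \<cdot>\<^sub>v a"
proof (induction k)
  case 0
  { case 1 show ?case using u by (simp add: one_mult_vec) }
  { case 2 show ?case using a by (simp add: one_mult_vec) }
next
  case (Suc k)
  have gk: "inv (g [^] Suc k) = inv g \<otimes> inv (g [^] k)"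
    using g_carrier by (simp add: inv_mult_group)
  have c: "inv g \<in> carrier \<Gamma>" "inv (g [^] k) \<in> carrier \<Gamma>"
    using g_carrier by auto
  { case 1 show ?case
      unfolding gk mult_vec_mult[OF c u] using Suc.IH inv_g_vec by simp }
  { case 2 show ?case
      unfolding gk mult_vec_mult[OF c a] Suc.IH(2) mult_mat_vec[OF mat_carrier[OF c(1)] a] inv_g_vec
      by (simp add: smult_smult_assoc mult.commute) }
qed

text \<open>Multiplying a coset by \<open>g\<close> amounts to substituting the action of the inverse of \<open>g\<close>, which fixes
\<open>u\<close> and \<open>p\<close> and scales \<open>a\<close>.\<close>

lemma rotates_coset_act:
  assumes f: "invariant G f"
  shows "rotates (\<lambda>C. plane u p a (coset_act C f))"
  unfolding rotates_def
proof (intro ballI allI)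
  fix C k assume C: "C \<in> cosets"
  obtain \<sigma> where \<sigma>: "\<sigma> \<in> C" using coset_nonempty[OF C] by blast
  note \<sigma>S = coset_eq(1)[OF C \<sigma>]
  have f': "f \<in> polys n UNIV" using f by (simp add: invariant_def)
  have "g \<otimes> \<sigma> \<in> shift C"
    using \<sigma> by (auto simp: l_coset_conv)
  then have "coset_act (shift C) f = poly_act \<Gamma> (g \<otimes> \<sigma>) f"
    by (rule coset_act_eq[OF T_closed[OF C] _ f])
  also have "\<dots> = poly_act \<Gamma> g (coset_act C f)"
    using poly_act_mult[OF g_carrier S_carrier[OF \<sigma>S] f'] coset_act_eq[OF C \<sigma> f] by simp
  finally have eq: "coset_act (shift C) f = poly_act \<Gamma> g (coset_act C f)" .
  have pol: "coset_act C f \<in> polys n UNIV"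
    using coset_act_eq[OF C \<sigma> f] poly_act_polys_UNIV[OF S_carrier[OF \<sigma>S] f'] by simp
  show "coeff (plane u p a (coset_act (shift C) f)) k =
      [:inverse \<zeta> ^ k:] * coeff (plane u p a (coset_act C f)) k"
    unfolding eq plane_poly_act[OF g_carrier pol u p a] inv_g_vec
    by (rule coeff_plane_scale[OF pol a])
qed

text \<open>For a single cycle the \<open>d\<close>-th derivative along \<open>a\<close> can be made nonzero while the values on the other
cycles are zero. Let \<open>q\<close> be the preimage of \<open>u\<close> under an element \<open>\<sigma>\<close> of \<open>C\<close>. The polynomial \<open>h\<close>
vanishes to order \<open>d\<close> at \<open>q\<close> and to a higher order at the rest of the \<open>S\<close>-orbit. In the sum over
\<open>C\<close> only the elements \<open>g\<^sup>k \<sigma>\<close> whose inverse also moves \<open>u\<close> to \<open>q\<close> contribute. For these \<open>g\<^sup>k\<close> maps \<open>C\<close> to itself,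
so \<open>k\<close> is a multiple of the period, and the assumption on \<open>d\<close> makes all these contributions equal,
so that they cannot cancel.\<close>

lemma orbit_witness:
  assumes C: "C \<in> cosets" and d: "d = 0 \<or> 1 < e"
    and dper: "\<And>k. period C dvd k \<Longrightarrow> e dvd k * d"
  shows "\<exists>h\<in>polys n UNIV. coeff (line u a (coset_act C (trace h))) d \<noteq> 0 \<and>
    (\<forall>D\<in>cosets. orbit shift D \<noteq> orbit shift C \<longrightarrow> coeff (line u a (coset_act D (trace h))) 0 = 0)"
proof -
  obtain \<sigma> where \<sigma>: "\<sigma> \<in> C" using coset_nonempty[OF C] by blast
  note \<sigma>S = coset_eq(1)[OF C \<sigma>] and C_eq = coset_eq(2)[OF C \<sigma>]
  note \<sigma>c = S_carrier[OF \<sigma>S]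
  define pt where "pt \<rho> = inv \<rho> *\<^sub>v u" for \<rho>
  define dir where "dir \<rho> = inv \<rho> *\<^sub>v a" for \<rho>
  define q where "q = pt \<sigma>"
  define b where "b = dir \<sigma>"
  have pt_c: "pt \<rho> \<in> carrier_vec n" and dir_c: "dir \<rho> \<in> carrier_vec n" if "\<rho> \<in> S" for \<rho>
    using that S_carrier u a by (auto simp: pt_def dir_def intro!: mult_vec_carrier)
  note q_c = pt_c[OF \<sigma>S, folded q_def] and b_c = dir_c[OF \<sigma>S, folded b_def]
  obtain i where i: "d = 0 \<or> (i < n \<and> b $ i \<noteq> 0)"
  proof (cases "d = 0")
    case False
    have "\<sigma> *\<^sub>v b = a"
      unfolding b_def dir_def by (rule inv_mult_vec(2)[OF \<sigma>c a])
    then have "b \<noteq> 0\<^sub>v n"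
      using a_nonzero d False mat_carrier[OF \<sigma>c] by auto
    then show thesis
      using b_c that by (metis carrier_vecD eq_vecI index_zero_vec(1,2))
  qed (use that in auto)
  define Q where "Q = pt ` S - {q}"
  have Q: "finite Q" "q \<notin> Q"
    by (simp_all add: Q_def finite_S)
  have "\<exists>k<n. q $ k \<noteq> q' $ k" if "q' \<in> Q" for q'
  proof (rule ccontr)
    assume "\<not> (\<exists>k<n. q $ k \<noteq> q' $ k)"
    moreover have "q' \<in> carrier_vec n" using that pt_c by (auto simp: Q_def)
    ultimately have "q = q'" using q_c by (intro eq_vecI) auto
    then show False using that Q by blast
  qed
  then obtain \<kappa> where \<kappa>: "\<And>q'. q' \<in> Q \<Longrightarrow> \<kappa> q' < n \<and> q $ (\<kappa> q') \<noteq> q' $ (\<kappa> q')"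
    by metis
  define fac where "fac q' = mvar (\<kappa> q') + mconst (- (q' $ \<kappa> q'))" for q'
  define h1 where "h1 = (if d = 0 then 1 else (mvar i + mconst (- (q $ i))) ^ d)"
  define h2 where "h2 = (\<Prod>q'\<in>Q. fac q' ^ Suc d)"
  define h where "h = h1 * h2"
  have h1: "h1 \<in> polys n UNIV"
    using i unfolding h1_def
    by (auto intro!: polys_power polys_add polys_mvar polys_mconst polys_one subring_set_UNIV)
  have fac: "fac q' \<in> polys n UNIV" if "q' \<in> Q" for q'
    using \<kappa>[OF that] unfolding fac_def by (intro polys_add polys_mvar polys_mconst subring_set_UNIV) auto
  have h2: "h2 \<in> polys n UNIV"
    unfolding h2_def by (intro polys_prod polys_power subring_set_UNIV fac)
  have h: "h \<in> polys n UNIV"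
    unfolding h_def by (intro polys_mult h1 h2 subring_set_UNIV)
  have line_lin: "line x y (mvar j + mconst (- c)) = [:x $ j - c, y $ j:]" for x y j c
    by (simp add: line.hom_add)
       (simp add: line_def coeff_hom_poly.subst_hom_mconst coeff_hom_poly.subst_hom_mvar)
  \<comment> \<open>the factor of \<open>h2\<close> that belongs to such a point contributes the power \<open>d + 1\<close> of the parameter\<close>
  have other: "coeff (line (pt \<rho>) (dir \<rho>) h) k = 0" if "pt \<rho> \<in> Q" "k \<le> d" for \<rho> k
  proof -
    have "fac (pt \<rho>) ^ Suc d dvd h2"
      unfolding h2_def by (rule dvd_prodI[OF Q(1) that(1)])
    then obtain r where r: "h = fac (pt \<rho>) ^ Suc d * r"
      unfolding h_def by (metis dvdE dvd_mult)
    have "line (pt \<rho>) (dir \<rho>) (fac (pt \<rho>)) = monom 1 1 * [:dir \<rho> $ \<kappa> (pt \<rho>):]"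
      by (simp add: fac_def line_lin monom_altdef)
    moreover have "monom (1::complex) 1 ^ Suc d = monom 1 (Suc d)"
      by (subst monom_power) simp
    ultimately have "line (pt \<rho>) (dir \<rho>) h =
        monom 1 (Suc d) * ([:dir \<rho> $ \<kappa> (pt \<rho>):] ^ Suc d * line (pt \<rho>) (dir \<rho>) r)"
      by (simp only: r line.hom_mult line.hom_power power_mult_distrib mult.assoc)
    then show ?thesis
      using that(2) by (simp add: coeff_monom_mult del: power_Suc)
  qed
  \<comment> \<open>\<open>h1\<close> contributes exactly the power \<open>d\<close>, and \<open>h2\<close> does not vanish at \<open>q\<close>\<close>
  have main: "coeff (line q b h) d \<noteq> 0"
  proof -
    have "line q b h1 = monom (if d = 0 then 1 else b $ i ^ d) d"
      by (auto simp: h1_def line.hom_power line_lin monom_altdef)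
         (simp add: monom_altdef power_mult_distrib flip: smult_power)
    then have "coeff (line q b h) d = (if d = 0 then 1 else b $ i ^ d) * coeff (line q b h2) 0"
      unfolding h_def line.hom_mult by (simp add: coeff_monom_mult)
    moreover have "coeff (line q b h2) 0 = (\<Prod>q'\<in>Q. (q $ \<kappa> q' - q' $ \<kappa> q') ^ Suc d)"
      unfolding h2_def line.hom_prod line.hom_power fac_def line_lin poly_0_coeff_0[symmetric]
      by (simp add: poly_prod)
    ultimately show ?thesis
      using i \<kappa> Q(1) by auto
  qed
  have cos: "coset_act D (trace h) = (\<Sum>\<rho>\<in>D. poly_act \<Gamma> \<rho> h)" if "D \<in> cosets" for D
    by (rule coset_act_trace[OF that h])
  have expand: "coeff (line u a (coset_act D (trace h))) k = (\<Sum>\<rho>\<in>D. coeff (line (pt \<rho>) (dir \<rho>) h) k)"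
    if D: "D \<in> cosets" for D k
    unfolding cos[OF D] line.hom_sum coeff_sum
    using line_poly_act[OF S_carrier[OF coset_eq(1)[OF D]] h u a]
    by (intro sum.cong) (auto simp: pt_def dir_def)
  have same: "\<exists>k. \<rho> = g [^] (k :: nat) \<otimes> \<sigma>" if \<rho>: "\<rho> \<in> S" and eq: "pt \<rho> = q" for \<rho>
  proof -
    note \<rho>c = S_carrier[OF \<rho>]
    have "(\<rho> \<otimes> inv \<sigma>) *\<^sub>v u = \<rho> *\<^sub>v pt \<rho>"
      using mult_vec_mult[OF \<rho>c _ u, of "inv \<sigma>"] \<sigma>c eq by (simp add: q_def pt_def)
    also have "\<dots> = u"
      unfolding pt_def by (rule inv_mult_vec(2)[OF \<rho>c u])
    finally obtain k :: nat where "\<rho> \<otimes> inv \<sigma> = g [^] k"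
      using stab[of "\<rho> \<otimes> inv \<sigma>"] S_mult[OF \<rho> S_inv[OF \<sigma>S]] by auto
    then have "\<rho> = g [^] k \<otimes> \<sigma>"
      using \<rho>c \<sigma>c by (metis inv_solve_right inv_closed inv_inv m_closed nat_pow_closed g_carrier)
    then show ?thesis ..
  qed
  have shifted: "(shift ^^ k) C = D"
    if D: "D \<in> cosets" and \<rho>: "\<rho> \<in> D" "\<rho> = g [^] k \<otimes> \<sigma>" for D \<rho> and k :: nat
    using funpow_shift[OF \<sigma>S, of k] coset_eq(2)[OF D \<rho>(1)] \<rho>(2) C_eq by simp
  have far: "coeff (line u a (coset_act D (trace h))) 0 = 0"
    if D: "D \<in> cosets" and neq: "orbit shift D \<noteq> orbit shift C" for D
  proof -
    have "pt \<rho> \<in> Q" if \<rho>: "\<rho> \<in> D" for \<rho>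
    proof -
      have "pt \<rho> \<noteq> q"
      proof
        assume "pt \<rho> = q"
        then obtain k :: nat where k: "\<rho> = g [^] k \<otimes> \<sigma>"
          using same coset_eq(1)[OF D \<rho>] by blast
        have "D \<in> orbit shift C"
          using shifted[OF D \<rho> k] self_in_orbit[OF C] funpow_in_orbit by metis
        then show False
          using neq orbit_eq_iff[OF C] by blast
      qed
      then show ?thesis
        using coset_eq(1)[OF D \<rho>] by (auto simp: Q_def)
    qed
    then show ?thesis
      unfolding expand[OF D] using other by (intro sum.neutral) auto
  qed
  have near: "coeff (line u a (coset_act C (trace h))) d \<noteq> 0"
  proof -
    have fin: "finite C"
      unfolding C_eq l_coset_conv using finite_G by simp
    have "coeff (line (pt \<rho>) (dir \<rho>) h) d = (if pt \<rho> = q then coeff (line q b h) d else 0)"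
      if \<rho>: "\<rho> \<in> C" for \<rho>
    proof (cases "pt \<rho> = q")
      case False
      then show ?thesis
        using other[of \<rho> d] coset_eq(1)[OF C \<rho>] by (auto simp: Q_def)
    next
      case True
      then obtain k :: nat where k: "\<rho> = g [^] k \<otimes> \<sigma>"
        using same coset_eq(1)[OF C \<rho>] by blast
      have "period C dvd k"
        using shifted[OF C \<rho> k] funpow_eq_self_iff[OF C] by blast
      then have z: "(inverse \<zeta> ^ k) ^ d = 1"
        using dper root by (simp flip: power_mult)
      have gk: "g [^] k \<in> carrier \<Gamma>" using g_carrier by simp
      have "dir \<rho> = inv \<sigma> *\<^sub>v (inv (g [^] k) *\<^sub>v a)"
        unfolding dir_def k inv_mult_group[OF gk \<sigma>c] using gk \<sigma>c a by (simp add: mult_vec_mult)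
      also have "\<dots> = inverse \<zeta> ^ k \<cdot>\<^sub>v b"
        unfolding inv_g_pow_vec b_def dir_def
        using mult_mat_vec[OF mat_carrier a, of "inv \<sigma>"] \<sigma>c by simp
      finally have "dir \<rho> = inverse \<zeta> ^ k \<cdot>\<^sub>v b" .
      then show ?thesis
        using True coeff_line_scale[OF h b_c, of q "inverse \<zeta> ^ k" d] z by simp
    qed
    then have "coeff (line u a (coset_act C (trace h))) d =
        (\<Sum>\<rho>\<in>C. if pt \<rho> = q then coeff (line q b h) d else 0)"
      unfolding expand[OF C] by (intro sum.cong) auto
    also have "\<dots> = of_nat (card {\<rho>\<in>C. pt \<rho> = q}) * coeff (line q b h) d"
      using fin by (simp add: sum.If_cases Int_def)
    finally show ?thesis
      using main \<sigma> fin by (auto simp: q_def)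
  qed
  show ?thesis
    using h near far by blast
qed

end

section \<open>Extension of scalars\<close>

context coset_action
begin

definition spans :: "(nat \<Rightarrow> mpoly) \<Rightarrow> nat \<Rightarrow> bool"
  where "spans \<theta> l \<longleftrightarrow> (\<forall>f. invariant G f \<longrightarrow>
    (\<exists>c. (\<forall>j<l. invariant S (c j)) \<and> f = (\<Sum>j<l. c j * \<theta> j)))"

lemma coset_act_hom: "comm_ring_hom (coset_act C)"
  unfolding coset_act_def by (rule poly_act_hom)

lemma coset_act_mconst: "coset_act C (mconst t) = mconst t"
  unfolding coset_act_def by (rule poly_act_mconst)

lemma poly_act_add: "poly_act \<Gamma> \<sigma> (f + h) = poly_act \<Gamma> \<sigma> f + poly_act \<Gamma> \<sigma> h"
proof -
  interpret comm_ring_hom "poly_act \<Gamma> \<sigma>" by (rule poly_act_hom)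
  show ?thesis by (rule hom_add)
qed

lemma trace_linear: "trace (h + mconst t * h') = trace h + mconst t * trace h'"
  unfolding trace_def poly_act_add poly_act_times poly_act_mconst
  by (simp add: sum.distrib sum_distrib_left)

lemma invariant_add: "invariant H f \<Longrightarrow> invariant H h \<Longrightarrow> invariant H (f + h)"
  by (auto simp: invariant_def poly_act_add intro!: polys_add subring_set_UNIV)

lemma poly_act_zero: "poly_act \<Gamma> \<sigma> 0 = 0"
  using poly_act_sum[of \<sigma> "\<lambda>_. 0" "{}"] by simp

lemma invariant_zero: "invariant H 0"
  by (simp add: invariant_def polys_zero subring_set_UNIV poly_act_zero)

lemma invariant_scale: "invariant H f \<Longrightarrow> invariant H (mconst t * f)"
  by (auto simp: invariant_def poly_act_times poly_act_mconst
      intro!: polys_mult polys_mconst subring_set_UNIV)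

lemma invariant_sum: "(\<And>i. i \<in> I \<Longrightarrow> invariant H (F i)) \<Longrightarrow> invariant H (sum F I)"
  by (induction I rule: infinite_finite_induct) (auto simp: invariant_zero invariant_add)

lemma invariant_spec: "invariant H f \<Longrightarrow> \<sigma> \<in> H \<Longrightarrow> poly_act \<Gamma> \<sigma> f = f"
  by (simp add: invariant_def)

lemma invariants_imp_invariant: "f \<in> invariants \<Gamma> n A H \<Longrightarrow> invariant H f"
  using polys_mono[of A UNIV n] by (auto simp: invariants_def invariant_def)

text \<open>A \<open>G\<close>-invariant is a trace, hence a complex combination of traces of monomials. These have
coefficients in \<open>K\<close>, so they are combinations of the generators over the invariants of \<open>S\<close>.\<close>

lemma spans_if_generates:
  assumes K: "subring_set K" and entries: "\<And>\<sigma>. \<sigma> \<in> S \<Longrightarrow> elements_mat \<sigma> \<subseteq> K"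
    and gen: "module_generates (invariants \<Gamma> n K S) (invariants \<Gamma> n K G) \<theta> {..<l}"
  shows "spans \<theta> l"
  unfolding spans_def
proof (intro allI impI)
  fix f assume "invariant G f"
  then obtain h where h: "h \<in> polys n UNIV" and f: "trace h = f"
    by (rule trace_invariant)
  let ?M = "keys h"
  have "trace (Poly_Mapping.single m 1) \<in> invariants \<Gamma> n K G" if "m \<in> ?M" for m
  proof -
    have m: "Poly_Mapping.single m (1::complex) \<in> polys n K"
      using that h K by (intro polys_single) (auto simp: polys_def subring_set_def)
    then have "trace (Poly_Mapping.single m 1) \<in> polys n K"
      unfolding trace_def using G_S S_carrier S_inv entries
      by (intro polys_sum poly_act_polys K) auto
    moreover have "Poly_Mapping.single m (1::complex) \<in> polys n UNIV"
      using m polys_mono[of K UNIV n] by auto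
    ultimately show ?thesis
      using invariant_trace by (auto simp: invariants_def invariant_def)
  qed
  then have "\<forall>m\<in>?M. \<exists>c. (\<forall>j<l. c j \<in> invariants \<Gamma> n K S) \<and>
      trace (Poly_Mapping.single m 1) = (\<Sum>j<l. c j * \<theta> j)"
    using gen unfolding module_generates_def by blast
  from bchoice[OF this] obtain c where c: "\<And>m j. m \<in> ?M \<Longrightarrow> j < l \<Longrightarrow> c m j \<in> invariants \<Gamma> n K S"
    "\<And>m. m \<in> ?M \<Longrightarrow> trace (Poly_Mapping.single m 1) = (\<Sum>j<l. c m j * \<theta> j)"
    by blast
  have tr_sum: "trace (\<Sum>m\<in>M. mconst (a m) * F m) = (\<Sum>m\<in>M. mconst (a m) * trace (F m))"
    if "finite M" for M a and F :: "_ \<Rightarrow> mpoly"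
    using that
  proof (induction M rule: finite_induct)
    case empty
    show ?case by (simp add: trace_def poly_act_zero)
  next
    case (insert m M)
    then show ?case
      using trace_linear[of "\<Sum>m\<in>M. mconst (a m) * F m" "a m" "F m"] by (simp add: add.commute)
  qed
  have "mconst (lookup h m) * Poly_Mapping.single m 1 =
      Poly_Mapping.single m (lookup h m)" for m
    by (simp add: mconst_def mult_single)
  then have "(\<Sum>m\<in>?M. mconst (lookup h m) * Poly_Mapping.single m 1) = h"
    by (simp only: sum_of_terms[OF finite_keys order_refl, of h, symmetric])
  then have "f = (\<Sum>m\<in>?M. mconst (lookup h m) * trace (Poly_Mapping.single m 1))"
    using tr_sum[of ?M "lookup h" "\<lambda>m. Poly_Mapping.single m 1"] f by simp
  also have "\<dots> = (\<Sum>m\<in>?M. \<Sum>j<l. mconst (lookup h m) * c m j * \<theta> j)"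
    using c(2) by (intro sum.cong) (auto simp: sum_distrib_left mult.assoc)
  also have "\<dots> = (\<Sum>j<l. \<Sum>m\<in>?M. mconst (lookup h m) * c m j * \<theta> j)"
    by (rule sum.swap)
  also have "\<dots> = (\<Sum>j<l. (\<Sum>m\<in>?M. mconst (lookup h m) * c m j) * \<theta> j)"
    by (simp add: sum_distrib_right)
  finally have "f = (\<Sum>j<l. (\<Sum>m\<in>?M. mconst (lookup h m) * c m j) * \<theta> j)" .
  moreover have "invariant S (\<Sum>m\<in>?M. mconst (lookup h m) * c m j)" if "j < l" for j
    using c(1) that by (intro invariant_sum invariant_scale invariants_imp_invariant) auto
  ultimately show "\<exists>c. (\<forall>j<l. invariant S (c j)) \<and> f = (\<Sum>j<l. c j * \<theta> j)"
    by (intro exI[of _ "\<lambda>j. \<Sum>m\<in>?M. mconst (lookup h m) * c m j"]) auto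
qed

end

section \<open>The exact order at a point\<close>

context local_point
begin

text \<open>The invariant meets the two hypotheses of \<open>vandermonde_order\<close>. Each of the finitely many conditions
excludes the kernel of a linear functional, which is a proper subspace by \<open>orbit_witness\<close>.\<close>

lemma ex_generic_invariant:
  obtains f where "invariant G f"
    and "\<And>C D. C \<in> cosets \<Longrightarrow> D \<in> cosets \<Longrightarrow> orbit shift C \<noteq> orbit shift D \<Longrightarrow>
      coeff (line u a (coset_act C f)) 0 \<noteq> coeff (line u a (coset_act D f)) 0"
    and "\<And>C. C \<in> cosets \<Longrightarrow> 1 < period C \<Longrightarrow>
      coeff (line u a (coset_act C f)) (e div period C) \<noteq> 0"
proof -
  define co where "co C d h = coeff (line u a (coset_act C (trace h))) d" for C d h
  have lin: "co C d (h + mconst t * h') = co C d h + t * co C d h'" for C d h t h'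
  proof -
    interpret comm_ring_hom "coset_act C" by (rule coset_act_hom)
    have "line u a (mconst t) = [:t:]"
      by (simp add: line_def coeff_hom_poly.subst_hom_mconst)
    then show ?thesis
      unfolding co_def trace_linear hom_add hom_mult coset_act_mconst line.hom_add line.hom_mult
      by simp
  qed
  define F where "F i h = (case i of Inl (C, D) \<Rightarrow> co C 0 h - co D 0 h
    | Inr C \<Rightarrow> co C (e div period C) h)" for i h
  define I where "I = Inl ` {(C, D) \<in> cosets \<times> cosets. orbit shift C \<noteq> orbit shift D} \<union>
    Inr ` {C \<in> cosets. 1 < period C}"
  have "finite {(C, D) \<in> cosets \<times> cosets. orbit shift C \<noteq> orbit shift D}"
    by (rule finite_subset[of _ "cosets \<times> cosets"]) (use finite_cosets in auto)
  then have "finite I"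
    unfolding I_def using finite_cosets by simp
  moreover have "F i (h + mconst t * h') = F i h + t * F i h'" for i h h' t
    unfolding F_def lin by (auto simp: algebra_simps split: sum.split)
  moreover have "\<exists>h\<in>polys n UNIV. F i h \<noteq> 0" if i: "i \<in> I" for i
  proof -
    consider C D where "i = Inl (C, D)" "C \<in> cosets" "D \<in> cosets" "orbit shift C \<noteq> orbit shift D"
      | C where "i = Inr C" "C \<in> cosets" "1 < period C"
      using i unfolding I_def by auto
    then show ?thesis
    proof cases
      case 1
      then show ?thesis
        using orbit_witness[OF 1(2), of 0] 1 unfolding F_def co_def by fastforce
    next
      case 2
      have "1 < e"
        using period_dvd_e[OF 2(2)] 2(3) e by (meson dvd_imp_le less_le_trans)
      moreover have "e dvd k * (e div period C)" if "period C dvd k" for k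
        using period_dvd_e[OF 2(2)] that by (metis dvd_mult_div_cancel mult_dvd_mono dvd_refl)
      ultimately show ?thesis
        using orbit_witness[OF 2(2), of "e div period C"] unfolding F_def co_def 2(1) by auto
    qed
  qed
  ultimately obtain h where h: "h \<in> polys n UNIV" and nz: "\<And>i. i \<in> I \<Longrightarrow> F i h \<noteq> 0"
    using ex_avoiding_functionals[of I n F] by blast
  show thesis
  proof (rule that[OF invariant_trace[OF h]])
    show "coeff (line u a (coset_act C (trace h))) 0 \<noteq> coeff (line u a (coset_act D (trace h))) 0"
      if "C \<in> cosets" "D \<in> cosets" "orbit shift C \<noteq> orbit shift D" for C D
      using nz[of "Inl (C, D)"] that by (auto simp: I_def F_def co_def)
    show "coeff (line u a (coset_act C (trace h))) (e div period C) \<noteq> 0"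
      if "C \<in> cosets" "1 < period C" for C
      using nz[of "Inr C"] that by (auto simp: I_def F_def co_def)
  qed
qed

text \<open>\<open>det_divisible\<close> shows that the order is at least \<open>expo\<close>. On the other hand, expressing the powers of
a generic invariant by the generators factors its Vandermonde matrix through the secondary matrix,
so the order is at most that of the Vandermonde determinant, which is \<open>expo\<close>.\<close>

lemma line_det_order:
  assumes \<theta>: "\<And>j. j < l \<Longrightarrow> invariant G (\<theta> j)" and spans: "spans \<theta> l"
    and \<gamma>: "\<And>i. i < l \<Longrightarrow> \<gamma> i \<in> S"
    and bij: "bij_betw (\<lambda>i. \<gamma> i <# G) {..<l} cosets"
  obtains q where "line u (p + a) (det (secondary_matrix \<Gamma> l \<gamma> \<theta>)) = [:0, 1:] ^ expo * q"
    and "poly q 0 \<noteq> 0"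
proof -
  let ?x = "[:0, 1:] :: complex poly"
  let ?L = "line u (p + a)"
  let ?c = "\<lambda>i. \<gamma> i <# G"
  define M where "M = secondary_matrix \<Gamma> l \<gamma> \<theta>"
  have M: "M \<in> carrier_mat l l"
    by (simp add: M_def secondary_matrix_def)
  have ci: "?c i \<in> cosets" "\<gamma> i \<in> ?c i" if "i < l" for i
    using that \<gamma> coset_self by (auto simp: cosets_conv)
  have entry: "?L (poly_act \<Gamma> (\<gamma> i) f) = poly (plane u p a (coset_act (?c i) f)) ?x"
    if "i < l" "invariant G f" for i f
  proof -
    have "f \<in> polys n UNIV" using that by (simp add: invariant_def)
    then have "poly_act \<Gamma> (\<gamma> i) f \<in> polys n UNIV"
      using poly_act_polys_UNIV S_carrier[OF \<gamma>[OF that(1)]] by blast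
    then show ?thesis
      using coset_act_eq[OF ci[OF that(1)] that(2)] poly_plane_diag[OF _ u p a] by simp
  qed
  have "?L (det M) = det (mat l l (\<lambda>(i, j). poly (plane u p a (coset_act (?c i) (\<theta> j))) ?x))"
  proof -
    have "map_mat ?L M = mat l l (\<lambda>(i, j). poly (plane u p a (coset_act (?c i) (\<theta> j))) ?x)"
      by (rule eq_matI) (use entry \<theta> in \<open>auto simp: M_def secondary_matrix_def\<close>)
    then show ?thesis
      using line.hom_det[of u "p + a" M] by simp
  qed
  moreover have "?x ^ expo dvd det (mat l l (\<lambda>(i, j). poly (plane u p a (coset_act (?c i) (\<theta> j))) ?x))"
    by (rule det_divisible[OF bij]) (rule rotates_coset_act[OF \<theta>])
  ultimately obtain q where q: "?L (det M) = ?x ^ expo * q"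
    by (auto elim: dvdE)
  obtain f where f: "invariant G f"
    and sep: "\<And>C D. C \<in> cosets \<Longrightarrow> D \<in> cosets \<Longrightarrow> orbit shift C \<noteq> orbit shift D \<Longrightarrow>
      coeff (line u a (coset_act C f)) 0 \<noteq> coeff (line u a (coset_act D f)) 0"
    and ram: "\<And>C. C \<in> cosets \<Longrightarrow> 1 < period C \<Longrightarrow>
      coeff (line u a (coset_act C f)) (e div period C) \<noteq> 0"
    using ex_generic_invariant by metis
  define V where "V = mat l l (\<lambda>(i, k). poly_act \<Gamma> (\<gamma> i) f ^ k)"
  obtain q' where q': "det (mat l l (\<lambda>(i, k). poly (plane u p a (coset_act (?c i) f)) ?x ^ k)) = ?x ^ expo * q'"
    "poly q' 0 \<noteq> 0"
    by (rule vandermonde_order[OF bij rotates_coset_act[OF f]])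
       (use sep ram in \<open>auto simp: coeff_plane_0\<close>)
  have LV: "?L (det V) = ?x ^ expo * q'"
  proof -
    have "map_mat ?L V = mat l l (\<lambda>(i, k). poly (plane u p a (coset_act (?c i) f)) ?x ^ k)"
      by (rule eq_matI) (use entry[OF _ f] in \<open>auto simp: V_def line.hom_power\<close>)
    then show ?thesis
      using line.hom_det[of u "p + a" V] q'(1) by simp
  qed
  have "\<exists>c. (\<forall>j<l. invariant S (c j)) \<and> f ^ k = (\<Sum>j<l. c j * \<theta> j)" for k
    using spans invariant_power[OF f, of k] unfolding spans_def by blast
  then obtain c where c: "\<And>k j. j < l \<Longrightarrow> invariant S (c k j)" "\<And>k. f ^ k = (\<Sum>j<l. c k j * \<theta> j)"
    by metis
  define N where "N = mat l l (\<lambda>(j, k). c k j)"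
  have N: "N \<in> carrier_mat l l" by (simp add: N_def)
  have "V = M * N"
  proof (rule eq_matI)
    fix i k assume ik: "i < dim_row (M * N)" "k < dim_col (M * N)"
    then have ik': "i < l" "k < l" using M N by auto
    have "poly_act \<Gamma> (\<gamma> i) f ^ k = (\<Sum>j<l. poly_act \<Gamma> (\<gamma> i) (c k j) * poly_act \<Gamma> (\<gamma> i) (\<theta> j))"
      unfolding poly_act_power[symmetric] c(2) poly_act_sum poly_act_times ..
    also have "\<dots> = (\<Sum>j<l. poly_act \<Gamma> (\<gamma> i) (\<theta> j) * c k j)"
      using invariant_spec[OF c(1) \<gamma>[OF ik'(1)]] by (intro sum.cong) (auto simp: mult.commute)
    finally show "V $$ (i, k) = (M * N) $$ (i, k)"
      using ik' by (simp add: V_def M_def N_def secondary_matrix_def scalar_prod_def atLeast0LessThan)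
  qed (use M N in \<open>auto simp: V_def\<close>)
  then have "?L (det V) = ?x ^ expo * (q * ?L (det N))"
    using det_mult[OF M N] q by (simp add: line.hom_mult mult.assoc)
  then have "q' = q * ?L (det N)"
    unfolding LV by simp
  then have "poly q 0 \<noteq> 0"
    using q'(2) by auto
  with q show thesis
    unfolding M_def by (rule that)
qed

end

section \<open>Covectors\<close>

definition proportional :: "complex vec \<Rightarrow> complex vec \<Rightarrow> bool"
  where "proportional r s \<longleftrightarrow> (\<forall>i<dim_vec r. \<forall>j<dim_vec r. r $ i * s $ j = r $ j * s $ i)"

lemma dot_conv: "v \<in> carrier_vec n \<Longrightarrow> r \<bullet> v = (\<Sum>i<n. r $ i * v $ i)"
  by (simp add: scalar_prod_def atLeast0LessThan)

lemma nonzero_vec_entry: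
  assumes "r \<in> carrier_vec n" "r \<noteq> 0\<^sub>v n"
  obtains i where "i < n" "r $ i \<noteq> 0"
  using assms by (metis carrier_vecD eq_vecI index_zero_vec(1,2))

lemma proportional_sym:
  "r \<in> carrier_vec n \<Longrightarrow> s \<in> carrier_vec n \<Longrightarrow> proportional r s \<Longrightarrow> proportional s r"
  by (auto simp: proportional_def mult.commute)

lemma proportional_kernel:
  assumes r: "r \<in> carrier_vec n" "r \<noteq> 0\<^sub>v n" and s: "proportional r s"
    and v: "v \<in> carrier_vec n" "r \<bullet> v = 0"
  shows "s \<bullet> v = 0"
proof -
  obtain i where i: "i < n" "r $ i \<noteq> 0"
    using nonzero_vec_entry[OF r] .
  have "r $ i * (s \<bullet> v) = (\<Sum>j<n. (r $ i * s $ j) * v $ j)"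
    by (simp add: dot_conv[OF v(1)] sum_distrib_left mult.assoc)
  also have "\<dots> = (\<Sum>j<n. (r $ j * s $ i) * v $ j)"
    using s r(1) i(1) unfolding proportional_def by (intro sum.cong) auto
  also have "\<dots> = s $ i * (r \<bullet> v)"
    by (simp add: dot_conv[OF v(1)] sum_distrib_left ac_simps)
  finally show ?thesis
    using i v by simp
qed

text \<open>It suffices to know the kernels on \<open>K\<close>-rational vectors: the kernel of \<open>r\<close> contains the vectors with
\<open>r\<^sub>i\<close> in position \<open>j\<close> and \<open>-r\<^sub>j\<close> in position \<open>i\<close>, and evaluating \<open>s\<close> on them is the claim. This is
how statements about hyperplanes in \<open>K\<^sup>n\<close> are carried over to complex points.\<close>

lemma proportional_if_kernel:
  assumes K: "subring_set K" "\<And>x. x \<in> K \<Longrightarrow> - x \<in> K"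
    and r: "r \<in> vecs n K" and s: "s \<in> carrier_vec n"
    and ker: "\<And>v. v \<in> vecs n K \<Longrightarrow> r \<bullet> v = 0 \<Longrightarrow> s \<bullet> v = 0"
  shows "proportional r s"
  unfolding proportional_def
proof (intro allI impI)
  fix i j assume "i < dim_vec r" "j < dim_vec r"
  then have ij: "i < n" "j < n" and rK: "\<And>k. k < n \<Longrightarrow> r $ k \<in> K"
    using r by (auto simp: vecs_def vec_set_def)
  define v where "v = r $ i \<cdot>\<^sub>v unit_vec n j + (- (r $ j)) \<cdot>\<^sub>v unit_vec n i"
  have v: "v \<in> carrier_vec n" by (simp add: v_def)
  have dot: "t \<bullet> v = r $ i * t $ j - r $ j * t $ i" if "t \<in> carrier_vec n" for t
    using that ij unfolding v_def
    by (subst scalar_prod_add_distrib[of _ n]) auto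
  have "v $ k \<in> K" if "k < n" for k
    using that ij rK K by (auto simp: v_def subring_set_def unit_vec_def)
  then have "v \<in> vecs n K"
    using v by (auto simp: vecs_def vec_set_def)
  moreover have "r \<bullet> v = 0"
    using dot[of r] r by (simp add: vecs_def)
  ultimately show "r $ i * s $ j = r $ j * s $ i"
    using ker[of v] dot[OF s] by simp
qed

definition covector :: "nat \<Rightarrow> mpoly \<Rightarrow> complex vec"
  where "covector n f = vec n (\<lambda>i. lookup f (Poly_Mapping.single i 1))"

lemma covector_carrier [simp]: "covector n f \<in> carrier_vec n"
  by (simp add: covector_def)

lemma linear_form_monomial:
  assumes "(\<Sum>i\<in>keys m. lookup m i) = (1::nat)"
  obtains i where "m = Poly_Mapping.single i 1"
proof -
  obtain i where i: "i \<in> keys m" "lookup m i = 1"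
    "\<forall>j\<in>keys m. i \<noteq> j \<longrightarrow> lookup m j = 0"
    using assms sum_eq_1_iff[of "keys m" "lookup m"] by auto
  have "m = Poly_Mapping.single i 1"
    by (rule poly_mapping_eqI) (use i in \<open>auto simp: lookup_single when_def in_keys_iff\<close>)
  then show thesis by (rule that)
qed

lemma line_linear_form:
  assumes f: "f \<in> polys n A" "homogeneous 1 f"
    and u: "u \<in> carrier_vec n" and w: "w \<in> carrier_vec n"
  shows "line u w f = [:covector n f \<bullet> u, covector n f \<bullet> w:]"
proof -
  have keys: "keys f \<subseteq> (\<lambda>i. Poly_Mapping.single i 1) ` {..<n}"
  proof
    fix m assume m: "m \<in> keys f"
    then obtain i where i: "m = Poly_Mapping.single i 1"
      using f(2) linear_form_monomial unfolding homogeneous_def by metis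
    then show "m \<in> (\<lambda>i. Poly_Mapping.single i 1) ` {..<n}"
      using f(1) m by (auto simp: polys_def)
  qed
  have "inj_on (\<lambda>i. Poly_Mapping.single i (1::nat)) {..<n}"
    by (rule inj_onI) (metis lookup_single_eq lookup_single_not_eq zero_neq_one)
  then have "line u w f = (\<Sum>i<n. [:covector n f $ i * u $ i, covector n f $ i * w $ i:])"
    unfolding line_def coeff_hom_poly.subst_hom_superset[OF finite_imageI[OF finite_lessThan] keys]
    by (simp add: sum.reindex covector_def mult.commute)
  also have "\<dots> = [:covector n f \<bullet> u, covector n f \<bullet> w:]"
    unfolding dot_conv[OF u] dot_conv[OF w]
    by (simp add: poly_eq_iff coeff_sum coeff_pCons split: nat.splits)
  finally show ?thesis .
qed

lemma poly_eval_linear_form: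
  assumes f: "f \<in> polys n A" "homogeneous 1 f" and v: "v \<in> carrier_vec n"
  shows "poly_eval v f = covector n f \<bullet> v"
proof -
  have "v + 0 \<cdot>\<^sub>v v = v" using v by auto
  moreover have "f \<in> polys n UNIV" using f(1) polys_mono by blast
  ultimately show ?thesis
    using poly_line[of f n v v 0] line_linear_form[OF f v v] v by simp
qed

lemma ex_avoiding_covectors:
  fixes A :: "complex vec set"
  assumes "finite A" "\<And>r. r \<in> A \<Longrightarrow> r \<in> carrier_vec n \<and> r \<noteq> 0\<^sub>v n"
  shows "\<exists>v\<in>carrier_vec n. \<forall>r\<in>A. r \<bullet> v \<noteq> 0"
  using assms
proof (induction A rule: finite_induct)
  case empty
  show ?case using zero_carrier_vec by blast
next
  case (insert s A)
  obtain v where v: "v \<in> carrier_vec n" "\<And>r. r \<in> A \<Longrightarrow> r \<bullet> v \<noteq> 0"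
    using insert.IH insert.prems by auto
  have s: "s \<in> carrier_vec n" "s \<noteq> 0\<^sub>v n" using insert.prems by auto
  obtain i where i: "i < n" "s $ i \<noteq> 0"
    using nonzero_vec_entry[OF s] .
  define v' :: "complex vec" where "v' = unit_vec n i"
  have v': "v' \<in> carrier_vec n" "s \<bullet> v' \<noteq> 0"
    using i s by (simp_all add: v'_def)
  obtain t where t: "t \<notin> (\<lambda>r. - (r \<bullet> v) / (r \<bullet> v')) ` insert s A" "t \<noteq> 0"
    using ex_new_if_finite[OF infinite_UNIV_char_0, of "insert 0 ((\<lambda>r. - (r \<bullet> v) / (r \<bullet> v')) ` insert s A)"]
      insert.hyps by auto
  have "r \<bullet> (v + t \<cdot>\<^sub>v v') \<noteq> 0" if r: "r \<in> insert s A" for r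
  proof -
    have eq: "r \<bullet> (v + t \<cdot>\<^sub>v v') = r \<bullet> v + t * (r \<bullet> v')"
      using v v' insert.prems r by (subst scalar_prod_add_distrib[of _ n]) auto
    show ?thesis
    proof (cases "r \<bullet> v' = 0")
      case True
      then have "r \<bullet> v \<noteq> 0" using r v v' by auto
      then show ?thesis using True eq by simp
    next
      case False
      have "t \<noteq> - (r \<bullet> v) / (r \<bullet> v')" using t r by blast
      then show ?thesis
        using False eq by (simp add: field_simps add_eq_0_iff)
    qed
  qed
  then show ?case
    using v v' by (intro bexI[of _ "v + t \<cdot>\<^sub>v v'"]) auto
qed

section \<open>Polynomials in one variable with the same zeros\<close>

lemma order_from_shift:
  fixes p :: "complex poly"
  assumes "pcompose p [:t, 1:] = [:0, 1:] ^ E * q" "poly q 0 \<noteq> 0"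
  shows "p \<noteq> 0" "Polynomial.order t p = E"
proof -
  have "pcompose [:t, 1:] [:-t, 1:] = [:0, 1:]"
    by (simp add: pcompose_pCons)
  then have "p = pcompose (pcompose p [:t, 1:]) [:-t, 1:]"
    by (simp only: pcompose_assoc[symmetric] pcompose_idR)
  also have "\<dots> = [:-t, 1:] ^ E * pcompose q [:-t, 1:]"
    unfolding assms(1) by (simp add: pcompose_mult pcompose_hom.hom_power pcompose_pCons)
  finally have p: "p = [:-t, 1:] ^ E * pcompose q [:-t, 1:]" .
  have q: "poly (pcompose q [:-t, 1:]) t \<noteq> 0"
    using assms(2) by (simp add: poly_pcompose)
  then have nz: "pcompose q [:-t, 1:] \<noteq> 0" by auto
  have nz': "[:-t, 1:] ^ E * pcompose q [:-t, 1:] \<noteq> 0"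
    using nz by simp
  then show "p \<noteq> 0" using p by simp
  show "Polynomial.order t p = E"
    unfolding p order_mult[OF nz'] order_power_n_n using q by (simp add: order_0I)
qed

text \<open>A complex polynomial is determined up to a factor by its roots with multiplicities. The orders are
stated after a shift of the variable because this is how they are computed at each point of a line.\<close>

lemma same_orders_imp_scale:
  fixes p q :: "complex poly"
  assumes "\<And>t. \<exists>E p' q'. pcompose p [:t, 1:] = [:0, 1:] ^ E * p' \<and> poly p' 0 \<noteq> 0 \<and>
    pcompose q [:t, 1:] = [:0, 1:] ^ E * q' \<and> poly q' 0 \<noteq> 0"
  obtains c where "c \<noteq> 0" "p = smult c q"
proof -
  have ord: "Polynomial.order t p = Polynomial.order t q \<and> p \<noteq> 0 \<and> q \<noteq> 0" for t
    using assms[of t] order_from_shift by metis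
  then have nz: "p \<noteq> 0" "q \<noteq> 0" by auto
  have "proots p = proots q"
    by (rule multiset_eqI) (use ord nz in simp)
  define A where "A = (\<Prod>x\<in>#proots p. [:-x, 1:])"
  have p: "smult (lead_coeff p) A = p"
    unfolding A_def by (rule complex_poly_decompose_multiset)
  have q: "smult (lead_coeff q) A = q"
    unfolding A_def \<open>proots p = proots q\<close> by (rule complex_poly_decompose_multiset)
  have "smult (lead_coeff p / lead_coeff q) (smult (lead_coeff q) A) = smult (lead_coeff p) A"
    using nz by simp
  then have "p = smult (lead_coeff p / lead_coeff q) q"
    unfolding p q by simp
  then show thesis
    using nz by (intro that[of "lead_coeff p / lead_coeff q"]) auto
qed

section \<open>Reflecting hyperplanes over the complex numbers\<close>

lemma (in periodic_map) expo_eq_0: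
  assumes "e = 1"
  shows "expo = 0"
proof -
  have "pos C = 0" if C: "C \<in> Xs" for C
    using pos_funpow_base(4)[OF C period_pos[OF C]] period_dvd_e[OF C] assms by simp
  then show ?thesis by (simp add: expo_def)
qed

locale reflection_setting = coset_action +
  fixes K :: "complex set" and L :: "complex vec set \<Rightarrow> mpoly" and g :: "complex vec set \<Rightarrow> complex mat"
  assumes K: "subring_set K" and K_uminus: "\<And>x. x \<in> K \<Longrightarrow> - x \<in> K"
    and entries: "\<And>\<sigma>. \<sigma> \<in> S \<Longrightarrow> elements_mat \<sigma> \<subseteq> K"
    and L: "\<And>P. P \<in> reflecting_hyperplanes n K S \<Longrightarrow> L P \<in> polys n K \<and> homogeneous 1 (L P) \<and>
      {v \<in> vecs n K. poly_eval v (L P) = 0} = P"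
    and gen: "\<And>P. P \<in> reflecting_hyperplanes n K S \<Longrightarrow>
      g P \<in> pointwise_stabilizer S P \<and> generate \<Gamma> {g P} = pointwise_stabilizer S P"
begin

abbreviation hyperplanes :: "complex vec set set"
  where "hyperplanes \<equiv> reflecting_hyperplanes n K S"

definition cov :: "complex vec set \<Rightarrow> complex vec"
  where "cov P = covector n (L P)"

text \<open>Row \<open>i\<close> of \<open>\<sigma> - 1\<close>: the fixed space of \<open>\<sigma>\<close> is the common kernel of these covectors.\<close>

definition disp :: "complex mat \<Rightarrow> nat \<Rightarrow> complex vec"
  where "disp \<sigma> i = row \<sigma> i - unit_vec n i"

definition covs :: "complex vec set"
  where "covs = (\<lambda>(\<sigma>, i). disp \<sigma> i) ` (S \<times> {..<n}) - {0\<^sub>v n} \<union> cov ` hyperplanes"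

text \<open>All fixed spaces of non-identity elements of \<open>S\<close> that contain \<open>u\<close> are then cut out by one covector. This
description by pairs of covectors turns genericity of a line into finitely many linear conditions.\<close>

definition generic_point :: "complex vec \<Rightarrow> bool"
  where "generic_point u \<longleftrightarrow> u \<in> carrier_vec n \<and>
    (\<forall>r\<in>covs. \<forall>s\<in>covs. r \<bullet> u = 0 \<longrightarrow> s \<bullet> u = 0 \<longrightarrow> proportional r s)"

lemma S_mat: "\<sigma> \<in> S \<Longrightarrow> \<sigma> \<in> carrier_mat n n"
  using S_carrier mat_carrier by blast

lemma disp_carrier: "\<sigma> \<in> S \<Longrightarrow> disp \<sigma> i \<in> carrier_vec n"
  by (simp add: disp_def carrier_vecI)

lemma vecs_carrier: "v \<in> vecs n A \<Longrightarrow> v \<in> carrier_vec n"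
  by (simp add: vecs_def)

lemma K_0: "0 \<in> K" and K_1: "1 \<in> K"
  using K by (auto simp: subring_set_def)

lemma disp_vecs:
  assumes \<sigma>: "\<sigma> \<in> S" and i: "i < n"
  shows "disp \<sigma> i \<in> vecs n K"
proof -
  have "\<sigma> $$ (i, j) \<in> K" if "j < n" for j
    by (rule subsetD[OF entries[OF \<sigma>] elements_matI[OF S_mat[OF \<sigma>] i that refl]])
  moreover have "x - 1 \<in> K" if "x \<in> K" for x
    using K K_uminus[OF K_1] that by (metis diff_conv_add_uminus subring_set_def)
  ultimately have "disp \<sigma> i $ j \<in> K" if "j < n" for j
    using that S_mat[OF \<sigma>] i by (auto simp: disp_def unit_vec_def)
  then show ?thesis
    using disp_carrier[OF \<sigma>, of i] by (auto simp: vecs_def vec_set_def)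
qed

lemma disp_dot:
  assumes "\<sigma> \<in> S" "u \<in> carrier_vec n" "i < n"
  shows "disp \<sigma> i \<bullet> u = (\<sigma> *\<^sub>v u) $ i - u $ i"
  using assms S_mat[OF assms(1)] unfolding disp_def
  by (subst minus_scalar_prod_distrib[of _ n]) auto

lemma fixes_iff:
  assumes "\<sigma> \<in> S" "u \<in> carrier_vec n"
  shows "\<sigma> *\<^sub>v u = u \<longleftrightarrow> (\<forall>i<n. disp \<sigma> i \<bullet> u = 0)"
proof
  assume "\<forall>i<n. disp \<sigma> i \<bullet> u = 0"
  then have "(\<sigma> *\<^sub>v u) $ i = u $ i" if "i < n" for i
    using disp_dot[OF assms that] that by simp
  then show "\<sigma> *\<^sub>v u = u"
    using assms S_mat[OF assms(1)] by (intro eq_vecI) auto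
qed (use disp_dot[OF assms] in simp)

lemma eq_one_if_disp_zero:
  assumes "\<sigma> \<in> S" "\<And>i. i < n \<Longrightarrow> disp \<sigma> i = 0\<^sub>v n"
  shows "\<sigma> = 1\<^sub>m n"
proof (rule eq_matI)
  fix i j assume ij: "i < dim_row (1\<^sub>m n)" "j < dim_col (1\<^sub>m n)"
  have "disp \<sigma> i $ j = 0"
    using assms(2)[of i] ij by simp
  then show "\<sigma> $$ (i, j) = 1\<^sub>m n $$ (i, j)"
    using ij S_mat[OF assms(1)] by (auto simp: disp_def unit_vec_def split: if_splits)
qed (use S_mat[OF assms(1)] in auto)

lemma eq_one_if_fixes_all:
  assumes \<sigma>: "\<sigma> \<in> S" and all: "\<And>v. v \<in> carrier_vec n \<Longrightarrow> \<sigma> *\<^sub>v v = v"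
  shows "\<sigma> = 1\<^sub>m n"
proof (rule eq_one_if_disp_zero[OF \<sigma>])
  fix i assume i: "i < n"
  show "disp \<sigma> i = 0\<^sub>v n"
  proof (rule eq_vecI)
    fix j assume "j < dim_vec (0\<^sub>v n :: complex vec)"
    then have j: "j < n" by simp
    have "disp \<sigma> i \<bullet> unit_vec n j = 0"
      using fixes_iff[OF \<sigma>, of "unit_vec n j"] all i by simp
    then show "disp \<sigma> i $ j = 0\<^sub>v n $ j"
      using j disp_carrier[OF \<sigma>, of i] by simp
  qed (use disp_carrier[OF \<sigma>, of i] in auto)
qed

lemma cov_carrier: "cov P \<in> carrier_vec n"
  by (simp add: cov_def)

lemma cov_vecs: "P \<in> hyperplanes \<Longrightarrow> cov P \<in> vecs n K"
  using L[of P] by (auto simp: cov_def covector_def vecs_def vec_set_def polys_def)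

lemma mem_hyperplane_iff:
  assumes P: "P \<in> hyperplanes"
  shows "v \<in> P \<longleftrightarrow> v \<in> vecs n K \<and> cov P \<bullet> v = 0"
proof -
  have "poly_eval v (L P) = cov P \<bullet> v" if "v \<in> vecs n K"
    using L[OF P] poly_eval_linear_form[of "L P" n K v] that by (simp add: cov_def vecs_carrier)
  moreover have "{v \<in> vecs n K. poly_eval v (L P) = 0} = P"
    using L[OF P] by blast
  from arg_cong[OF this, of "\<lambda>A. v \<in> A"] have "v \<in> P \<longleftrightarrow> v \<in> vecs n K \<and> poly_eval v (L P) = 0"
    by simp
  ultimately show ?thesis
    by auto
qed

lemma cov_nonzero:
  assumes P: "P \<in> hyperplanes"
  shows "cov P \<noteq> 0\<^sub>v n"
proof
  assume 0: "cov P = 0\<^sub>v n"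
  obtain b where b: "b \<in> vecs n K" "b \<noteq> 0\<^sub>v n" "P = {v \<in> vecs n K. b \<bullet> v = 0}"
    using P by (auto simp: reflecting_hyperplanes_def hyperplane_def)
  obtain i where i: "i < n" "b $ i \<noteq> 0"
    using nonzero_vec_entry[OF vecs_carrier[OF b(1)] b(2)] .
  have unit: "unit_vec n i \<in> vecs n K"
    using K_0 K_1 by (auto simp: vecs_def vec_set_def unit_vec_def)
  then have "unit_vec n i \<in> P"
    using mem_hyperplane_iff[OF P, of "unit_vec n i"] 0 i by simp
  then show False
    using b i vecs_carrier[OF b(1)] by simp
qed

lemma covs_carrier: "r \<in> covs \<Longrightarrow> r \<in> carrier_vec n"
  unfolding covs_def using disp_carrier cov_carrier by auto

lemma covs_nonzero: "r \<in> covs \<Longrightarrow> r \<noteq> 0\<^sub>v n"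
proof -
  assume "r \<in> covs"
  then consider "r \<noteq> 0\<^sub>v n" | P where "P \<in> hyperplanes" "r = cov P"
    unfolding covs_def by auto
  then show ?thesis
    by cases (simp_all only: cov_nonzero not_False_eq_True)
qed

lemma cov_covs: "P \<in> hyperplanes \<Longrightarrow> cov P \<in> covs"
  and disp_covs: "\<sigma> \<in> S \<Longrightarrow> i < n \<Longrightarrow> disp \<sigma> i \<noteq> 0\<^sub>v n \<Longrightarrow> disp \<sigma> i \<in> covs"
  unfolding covs_def by auto

lemma stabilizer_disp:
  assumes P: "P \<in> hyperplanes" and \<sigma>: "\<sigma> \<in> pointwise_stabilizer S P" and i: "i < n"
  shows "proportional (cov P) (disp \<sigma> i)"
proof (rule proportional_if_kernel[OF K K_uminus cov_vecs[OF P]])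
  have \<sigma>S: "\<sigma> \<in> S" using \<sigma> by (simp add: pointwise_stabilizer_def)
  show "disp \<sigma> i \<in> carrier_vec n" by (rule disp_carrier[OF \<sigma>S])
  fix v assume v: "v \<in> vecs n K" "cov P \<bullet> v = 0"
  then have "\<sigma> *\<^sub>v v = v"
    using \<sigma> mem_hyperplane_iff[OF P] by (auto simp: pointwise_stabilizer_def)
  then show "disp \<sigma> i \<bullet> v = 0"
    using fixes_iff[OF \<sigma>S vecs_carrier[OF v(1)]] i by blast
qed

text \<open>An element that fixes the \<open>K\<close>-rational points of \<open>P\<close> also fixes its complex points.\<close>

lemma stabilizer_fixes:
  assumes P: "P \<in> hyperplanes" and \<sigma>: "\<sigma> \<in> pointwise_stabilizer S P"
    and u: "u \<in> carrier_vec n" "cov P \<bullet> u = 0"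
  shows "\<sigma> *\<^sub>v u = u"
proof -
  have \<sigma>S: "\<sigma> \<in> S" using \<sigma> by (simp add: pointwise_stabilizer_def)
  show ?thesis
    using fixes_iff[OF \<sigma>S u(1)] proportional_kernel[OF cov_carrier cov_nonzero[OF P]
        stabilizer_disp[OF P \<sigma>] u] by blast
qed

text \<open>All nonzero rows of \<open>\<sigma> - 1\<close> vanish at \<open>u\<close>, so they are proportional; hence \<open>\<sigma>\<close> is a reflection, and
its hyperplane is defined over \<open>K\<close> because the rows are.\<close>

lemma generic_fixed_point:
  assumes u: "generic_point u" and \<sigma>: "\<sigma> \<in> S" "\<sigma> \<noteq> 1\<^sub>m n" "\<sigma> *\<^sub>v u = u"
  shows "\<exists>P\<in>hyperplanes. cov P \<bullet> u = 0"
proof -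
  have uc: "u \<in> carrier_vec n" using u by (simp add: generic_point_def)
  obtain i where i: "i < n" "disp \<sigma> i \<noteq> 0\<^sub>v n"
    using eq_one_if_disp_zero[OF \<sigma>(1)] \<sigma>(2) by blast
  let ?r = "disp \<sigma> i"
  have r: "?r \<in> covs" "?r \<bullet> u = 0"
    using disp_covs[OF \<sigma>(1) i] fixes_iff[OF \<sigma>(1) uc] \<sigma>(3) i by auto
  define P where "P = {v \<in> vecs n K. ?r \<bullet> v = 0}"
  have "\<sigma> *\<^sub>v v = v" if v: "v \<in> P" for v
  proof -
    have vc: "v \<in> carrier_vec n" "?r \<bullet> v = 0"
      using v vecs_carrier by (auto simp: P_def)
    have "disp \<sigma> j \<bullet> v = 0" if j: "j < n" for j
    proof (cases "disp \<sigma> j = 0\<^sub>v n")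
      case False
      then have "proportional ?r (disp \<sigma> j)"
        using u r disp_covs[OF \<sigma>(1) j] fixes_iff[OF \<sigma>(1) uc] \<sigma>(3) j
        unfolding generic_point_def by blast
      then show ?thesis
        by (rule proportional_kernel[OF covs_carrier[OF r(1)] covs_nonzero[OF r(1)] _ vc])
    qed (use vc in simp)
    then show ?thesis
      using fixes_iff[OF \<sigma>(1) vc(1)] by blast
  qed
  moreover have "hyperplane n K P"
    unfolding hyperplane_def P_def using disp_vecs[OF \<sigma>(1) i(1)] i(2) by blast
  ultimately have P: "P \<in> hyperplanes"
    using \<sigma> unfolding reflecting_hyperplanes_def pointwise_stabilizer_def by blast
  have "proportional ?r (cov P)"
  proof (rule proportional_if_kernel[OF K K_uminus disp_vecs[OF \<sigma>(1) i(1)] cov_carrier])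
    fix v assume "v \<in> vecs n K" "?r \<bullet> v = 0"
    then have "v \<in> P"
      unfolding P_def by simp
    then show "cov P \<bullet> v = 0"
      using mem_hyperplane_iff[OF P, of v] by blast
  qed
  then have "cov P \<bullet> u = 0"
    by (rule proportional_kernel[OF covs_carrier[OF r(1)] covs_nonzero[OF r(1)] _ uc r(2)])
  then show ?thesis
    using P by blast
qed

lemma generic_stabilizer:
  assumes u: "generic_point u" and P: "P \<in> hyperplanes" "cov P \<bullet> u = 0"
    and \<sigma>: "\<sigma> \<in> S" "\<sigma> *\<^sub>v u = u"
  shows "\<sigma> \<in> pointwise_stabilizer S P"
  unfolding pointwise_stabilizer_def
proof (intro CollectI conjI ballI \<sigma>(1))
  fix v assume "v \<in> P"
  then have v: "v \<in> carrier_vec n" "cov P \<bullet> v = 0"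
    using mem_hyperplane_iff[OF P(1)] vecs_carrier by auto
  have uc: "u \<in> carrier_vec n" using u by (simp add: generic_point_def)
  have "disp \<sigma> j \<bullet> v = 0" if j: "j < n" for j
  proof (cases "disp \<sigma> j = 0\<^sub>v n")
    case False
    then have "proportional (cov P) (disp \<sigma> j)"
      using u P cov_covs disp_covs[OF \<sigma>(1) j] fixes_iff[OF \<sigma>(1) uc] \<sigma>(2) j
      unfolding generic_point_def by blast
    then show ?thesis
      by (rule proportional_kernel[OF cov_carrier cov_nonzero[OF P(1)] _ v])
  qed (use v in simp)
  then show "\<sigma> *\<^sub>v v = v"
    using fixes_iff[OF \<sigma>(1) v(1)] by blast
qed

lemma generic_hyperplane_unique:
  assumes u: "generic_point u" and P: "P \<in> hyperplanes" "cov P \<bullet> u = 0"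
    and Q: "Q \<in> hyperplanes" "cov Q \<bullet> u = 0"
  shows "P = Q"
proof -
  have "proportional (cov P) (cov Q)" "proportional (cov Q) (cov P)"
    using u P Q cov_covs unfolding generic_point_def by blast+
  then have "cov P \<bullet> v = 0 \<longleftrightarrow> cov Q \<bullet> v = 0" if "v \<in> vecs n K" for v
    using proportional_kernel[OF cov_carrier cov_nonzero] P(1) Q(1) vecs_carrier[OF that] by blast
  then show ?thesis
    using mem_hyperplane_iff[OF P(1)] mem_hyperplane_iff[OF Q(1)] by blast
qed

text \<open>A reflecting hyperplane is recovered from any of its reflections as the set of fixed points.\<close>

lemma finite_hyperplanes: "finite hyperplanes"
proof (rule finite_surj[OF finite_S])
  show "hyperplanes \<subseteq> (\<lambda>\<sigma>. {v \<in> vecs n K. \<sigma> *\<^sub>v v = v}) ` S"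
  proof
    fix P assume P: "P \<in> hyperplanes"
    then obtain \<sigma> where \<sigma>: "\<sigma> \<in> pointwise_stabilizer S P" "\<sigma> \<noteq> 1\<^sub>m n"
      by (auto simp: reflecting_hyperplanes_def)
    then have \<sigma>S: "\<sigma> \<in> S" by (simp add: pointwise_stabilizer_def)
    obtain i where i: "i < n" "disp \<sigma> i \<noteq> 0\<^sub>v n"
      using eq_one_if_disp_zero[OF \<sigma>S] \<sigma>(2) by blast
    have "proportional (disp \<sigma> i) (cov P)"
      using proportional_sym[OF cov_carrier disp_carrier[OF \<sigma>S] stabilizer_disp[OF P \<sigma>(1) i(1)]] .
    then have "cov P \<bullet> v = 0" if "v \<in> carrier_vec n" "disp \<sigma> i \<bullet> v = 0" for v
      using proportional_kernel[OF disp_carrier[OF \<sigma>S] i(2)] that by blast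
    then have "P = {v \<in> vecs n K. \<sigma> *\<^sub>v v = v}"
      using mem_hyperplane_iff[OF P] \<sigma>(1) fixes_iff[OF \<sigma>S] i(1) vecs_carrier
      by (auto simp: pointwise_stabilizer_def)
    then show "P \<in> (\<lambda>\<sigma>. {v \<in> vecs n K. \<sigma> *\<^sub>v v = v}) ` S"
      using \<sigma>S by blast
  qed
qed

lemma finite_covs: "finite covs"
  unfolding covs_def using finite_S finite_hyperplanes by simp

text \<open>The rows of \<open>\<sigma> - 1\<close> are multiples of one covector, so \<open>\<sigma> - 1\<close> has rank at most one.\<close>

lemma mult_vec_cov:
  assumes P: "P \<in> hyperplanes" and \<sigma>: "\<sigma> \<in> pointwise_stabilizer S P"
  obtains c where "c \<in> carrier_vec n"
    and "\<And>v. v \<in> carrier_vec n \<Longrightarrow> \<sigma> *\<^sub>v v = v + (cov P \<bullet> v) \<cdot>\<^sub>v c"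
proof -
  have \<sigma>S: "\<sigma> \<in> S" using \<sigma> by (simp add: pointwise_stabilizer_def)
  obtain k where k: "k < n" "cov P $ k \<noteq> 0"
    using nonzero_vec_entry[OF cov_carrier cov_nonzero[OF P]] .
  define c where "c = vec n (\<lambda>i. disp \<sigma> i $ k / cov P $ k)"
  have "\<sigma> *\<^sub>v v = v + (cov P \<bullet> v) \<cdot>\<^sub>v c" if v: "v \<in> carrier_vec n" for v
  proof (rule eq_vecI)
    fix i assume "i < dim_vec (v + (cov P \<bullet> v) \<cdot>\<^sub>v c)"
    then have i: "i < n" by (simp add: c_def)
    have "cov P $ k * (disp \<sigma> i \<bullet> v) = (\<Sum>j<n. (cov P $ k * disp \<sigma> i $ j) * v $ j)"
      by (simp add: dot_conv[OF v] sum_distrib_left mult.assoc)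
    also have "\<dots> = (\<Sum>j<n. (cov P $ j * disp \<sigma> i $ k) * v $ j)"
      using stabilizer_disp[OF P \<sigma> i] k(1) cov_carrier[of P] unfolding proportional_def
      by (intro sum.cong) auto
    also have "\<dots> = disp \<sigma> i $ k * (cov P \<bullet> v)"
      by (simp add: dot_conv[OF v] sum_distrib_left ac_simps)
    finally have "disp \<sigma> i \<bullet> v = (cov P \<bullet> v) * c $ i"
      using k i by (simp add: c_def field_simps)
    then show "(\<sigma> *\<^sub>v v) $ i = (v + (cov P \<bullet> v) \<cdot>\<^sub>v c) $ i"
      using disp_dot[OF \<sigma>S v i] i v by (simp add: c_def algebra_simps)
  qed (use S_mat[OF \<sigma>S] in \<open>auto simp: c_def\<close>)
  then show thesis
    by (intro that[of c]) (simp_all add: c_def)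
qed

end

section \<open>Orders of the determinant and the discriminant along generic lines\<close>

context local_point
begin

text \<open>Counting cycles by their length turns the exponent of the discriminant into a sum over cycles. In
particular it is a natural number.\<close>

lemma disc_exponent_eq_expo:
  assumes "card (pointwise_stabilizer S P) = e"
  shows "disc_exponent \<Gamma> S G P g = of_nat expo"
proof -
  let ?O = "orbit shift ` cosets"
  let ?f = "\<lambda>k::nat. of_nat e / 2 * (of_nat k - 1) :: rat"
  have fin: "finite ?O" using finite_cosets by simp
  have card: "0 < card Q" "card Q \<le> card cosets" if "Q \<in> ?O" for Q
    using that period_pos orbit_subset_Xs card_mono[OF finite_cosets] by (auto simp: period_def)
  have "disc_exponent \<Gamma> S G P g = (\<Sum>i\<in>{2..card cosets}. \<Sum>Q\<in>{Q\<in>?O. card Q = i}. ?f (card Q))"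
    unfolding disc_exponent_def num_cycles_def assms by (intro sum.cong) auto
  also have "\<dots> = (\<Sum>i\<in>{1..card cosets}. \<Sum>Q\<in>{Q\<in>?O. card Q = i}. ?f (card Q))"
  proof (rule sum.mono_neutral_left)
    show "\<forall>i\<in>{1..card cosets} - {2..card cosets}. (\<Sum>Q\<in>{Q\<in>?O. card Q = i}. ?f (card Q)) = 0"
    proof
      fix i assume "i \<in> {1..card cosets} - {2..card cosets}"
      then have "i = 1" by auto
      then show "(\<Sum>Q\<in>{Q\<in>?O. card Q = i}. ?f (card Q)) = 0"
        by (intro sum.neutral) auto
    qed
  qed auto
  also have "\<dots> = (\<Sum>Q\<in>?O. ?f (card Q))"
    by (rule sum.group[OF fin]) (use card in \<open>auto simp: Suc_le_eq\<close>)
  also have "\<dots> = of_nat (\<Sum>Q\<in>?O. e * (card Q - 1)) / 2"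
    unfolding of_nat_sum sum_divide_distrib
    using card by (intro sum.cong) (auto simp: of_nat_diff Suc_le_eq)
  also have "\<dots> = of_nat expo"
    unfolding twice_expo[symmetric] by simp
  finally show ?thesis .
qed

end

locale secondary_setting = reflection_setting +
  fixes l :: nat and \<theta> :: "nat \<Rightarrow> mpoly" and \<gamma> :: "nat \<Rightarrow> complex mat"
  assumes theta_invariant: "\<And>j. j < l \<Longrightarrow> invariant G (\<theta> j)"
    and theta_spans: "spans \<theta> l"
    and gamma_S: "\<And>i. i < l \<Longrightarrow> \<gamma> i \<in> S"
    and gamma_bij: "bij_betw (\<lambda>i. \<gamma> i <# G) {..<l} (left_cosets \<Gamma> S G)"
begin

abbreviation sec_det :: mpoly
  where "sec_det \<equiv> det (secondary_matrix \<Gamma> l \<gamma> \<theta>)"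

abbreviation disc :: mpoly
  where "disc \<equiv> discriminant \<Gamma> n K S G g L"

lemma stabilizer_order:
  assumes P: "P \<in> hyperplanes"
  shows "0 < card (pointwise_stabilizer S P)"
    and "g P \<in> S" and "g P \<noteq> 1\<^sub>m n"
    and "g P [^] (k :: nat) = \<one> \<longleftrightarrow> card (pointwise_stabilizer S P) dvd k"
    and "\<sigma> \<in> pointwise_stabilizer S P \<Longrightarrow> \<exists>k :: nat. \<sigma> = g P [^] k"
proof -
  have gP: "g P \<in> pointwise_stabilizer S P" "generate \<Gamma> {g P} = pointwise_stabilizer S P"
    using gen[OF P] by auto
  then show gS: "g P \<in> S" by (simp add: pointwise_stabilizer_def)
  note gc = S_carrier[OF gS]
  have fin: "finite (pointwise_stabilizer S P)"
    using finite_S by (simp add: pointwise_stabilizer_def)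
  show pos: "0 < card (pointwise_stabilizer S P)"
    using fin gP(1) card_gt_0_iff by blast
  have ord: "ord (g P) = card (pointwise_stabilizer S P)"
    using generate_pow_card[OF gc] gP(2) by simp
  show "g P [^] (k :: nat) = \<one> \<longleftrightarrow> card (pointwise_stabilizer S P) dvd k"
    using pow_eq_id[OF gc, of k] ord by simp
  have pw: "pointwise_stabilizer S P = {g P [^] k | k. k \<in> (UNIV :: nat set)}"
    using generate_pow_nat[OF gc] ord pos gP(2) by simp
  then show "\<exists>k :: nat. \<sigma> = g P [^] k" if "\<sigma> \<in> pointwise_stabilizer S P"
    using that by auto
  show "g P \<noteq> 1\<^sub>m n"
  proof
    assume "g P = 1\<^sub>m n"
    then have "g P [^] k = 1\<^sub>m n" for k :: nat
      using nat_pow_one[of k] by (simp add: one)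
    then show False
      using P pw unfolding reflecting_hyperplanes_def by auto
  qed
qed

lemma pow_mult_vec:
  assumes "\<sigma> \<in> carrier \<Gamma>" "v \<in> carrier_vec n"
  shows "(\<sigma> [^] Suc k) *\<^sub>v v = (\<sigma> [^] k) *\<^sub>v (\<sigma> *\<^sub>v v)"
  using mult_vec_mult[of "\<sigma> [^] k" \<sigma> v] assms by simp

text \<open>The generator is \<open>v \<mapsto> v + (b \<bullet> v) c\<close>, where \<open>b\<close> is the covector of \<open>P\<close>. If \<open>b \<bullet> c\<close> were zero,
its powers would be \<open>v \<mapsto> v + k (b \<bullet> v) c\<close> and it would have infinite order. So \<open>c\<close> is an
eigenvector outside of the hyperplane, with eigenvalue \<open>\<zeta> = 1 + b \<bullet> c\<close>, and \<open>a\<close> is its multiple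
for which \<open>p = w - a\<close> lies in the hyperplane.\<close>

lemma reflection_local_point:
  assumes u: "generic_point u" and P: "P \<in> hyperplanes" "cov P \<bullet> u = 0"
    and w: "w \<in> carrier_vec n" "cov P \<bullet> w \<noteq> 0"
  obtains \<zeta> p a where "w = p + a"
    and "local_point n \<Gamma> S G (g P) (card (pointwise_stabilizer S P)) \<zeta> u p a"
proof -
  let ?g = "g P" and ?b = "cov P" and ?e = "card (pointwise_stabilizer S P)"
  note ord = stabilizer_order[OF P(1)]
  note gc = S_carrier[OF ord(2)]
  have uc: "u \<in> carrier_vec n" using u by (simp add: generic_point_def)
  have gP: "?g \<in> pointwise_stabilizer S P"
    using gen[OF P(1)] by auto
  obtain c where c: "c \<in> carrier_vec n"
    and gv: "\<And>v. v \<in> carrier_vec n \<Longrightarrow> ?g *\<^sub>v v = v + (?b \<bullet> v) \<cdot>\<^sub>v c"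
    using mult_vec_cov[OF P(1) gP] by blast
  have c_nz: "c \<noteq> 0\<^sub>v n"
  proof
    assume "c = 0\<^sub>v n"
    then have "?g = 1\<^sub>m n"
      using gv by (intro eq_one_if_fixes_all[OF ord(2)]) auto
    then show False using ord(3) by simp
  qed
  have dot: "?b \<bullet> (v + t \<cdot>\<^sub>v v') = ?b \<bullet> v + t * (?b \<bullet> v')"
    if "v \<in> carrier_vec n" "v' \<in> carrier_vec n" for v v' t
    using that cov_carrier[of P] by (subst scalar_prod_add_distrib[of _ n]) auto
  define \<beta> where "\<beta> = ?b \<bullet> c"
  have \<beta>: "\<beta> \<noteq> 0"
  proof
    assume \<beta>0: "\<beta> = 0"
    have "(?g [^] k) *\<^sub>v v = v + (of_nat k * (?b \<bullet> v)) \<cdot>\<^sub>v c" if "v \<in> carrier_vec n" for k :: nat and v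
      using that
    proof (induction k arbitrary: v)
      case 0
      have "v = v + 0 \<cdot>\<^sub>v c"
        using 0 c by (intro eq_vecI) auto
      then show ?case using 0 by (simp add: one_mult_vec)
    next
      case (Suc k)
      have "(?g [^] Suc k) *\<^sub>v v = (?g [^] k) *\<^sub>v (v + (?b \<bullet> v) \<cdot>\<^sub>v c)"
        using pow_mult_vec[OF gc Suc.prems] gv[OF Suc.prems] by simp
      also have "\<dots> = v + (?b \<bullet> v) \<cdot>\<^sub>v c + (of_nat k * (?b \<bullet> v)) \<cdot>\<^sub>v c"
        using Suc.IH[of "v + (?b \<bullet> v) \<cdot>\<^sub>v c"] dot[OF Suc.prems c] \<beta>0 Suc.prems c by (simp add: \<beta>_def)
      also have "\<dots> = v + (of_nat (Suc k) * (?b \<bullet> v)) \<cdot>\<^sub>v c"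
        using Suc.prems c by (intro eq_vecI) (auto simp: algebra_simps)
      finally show ?case .
    qed
    from this[of w ?e] have "w = w + (of_nat ?e * (?b \<bullet> w)) \<cdot>\<^sub>v c"
      using ord(4)[of ?e] w by (simp add: one_mult_vec)
    then have "(of_nat ?e * (?b \<bullet> w)) * c $ i = 0" if "i < n" for i
      using that c w by (metis add_cancel_left_right carrier_vecD index_add_vec(1) index_smult_vec)
    then have "c $ i = 0" if "i < n" for i
      using that ord(1) w by auto
    then have "c = 0\<^sub>v n"
      using c by (intro eq_vecI) auto
    then show False using c_nz by simp
  qed
  define \<zeta> where "\<zeta> = 1 + \<beta>"
  define \<kappa> where "\<kappa> = (?b \<bullet> w) / \<beta>"
  have bw: "?b \<bullet> w = \<kappa> * \<beta>"
    using \<beta> by (simp add: \<kappa>_def)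
  define a where "a = \<kappa> \<cdot>\<^sub>v c"
  define p where "p = w + (-1) \<cdot>\<^sub>v a"
  have a: "a \<in> carrier_vec n" and p: "p \<in> carrier_vec n"
    using c w by (simp_all add: a_def p_def)
  have ba: "?b \<bullet> a = ?b \<bullet> w"
    unfolding bw using c cov_carrier[of P] by (simp add: a_def \<beta>_def)
  have bp: "?b \<bullet> p = 0"
    using dot[OF w(1) a, of "-1"] ba by (simp add: p_def)
  have ga: "?g *\<^sub>v a = \<zeta> \<cdot>\<^sub>v a"
    unfolding gv[OF a] ba bw using c by (intro eq_vecI) (auto simp: a_def \<zeta>_def algebra_simps)
  have fixed: "?g *\<^sub>v v = v" if "v \<in> carrier_vec n" "?b \<bullet> v = 0" for v
    by (rule stabilizer_fixes[OF P(1) gP that])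
  have a_nz: "a \<noteq> 0\<^sub>v n"
    using ba w cov_carrier[of P] by auto
  have pow_a: "(?g [^] k) *\<^sub>v (t \<cdot>\<^sub>v a) = (\<zeta> ^ k * t) \<cdot>\<^sub>v a" for k :: nat and t
  proof (induction k arbitrary: t)
    case 0
    then show ?case using a by (simp add: one_mult_vec)
  next
    case (Suc k)
    have "?g *\<^sub>v (t \<cdot>\<^sub>v a) = (t * \<zeta>) \<cdot>\<^sub>v a"
      using mult_mat_vec[OF S_mat[OF ord(2)] a, of t] ga by (simp add: smult_smult_assoc)
    then show ?case
      using pow_mult_vec[OF gc, of "t \<cdot>\<^sub>v a" k] Suc.IH[of "t * \<zeta>"] a by (simp add: ac_simps)
  qed
  have pow_fixed: "(?g [^] k) *\<^sub>v v = v" if "v \<in> carrier_vec n" "?b \<bullet> v = 0" for k :: nat and v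
  proof (induction k)
    case 0
    then show ?case using that by (simp add: one_mult_vec)
  next
    case (Suc k)
    then show ?case
      using pow_mult_vec[OF gc that(1), of k] fixed[OF that] by simp
  qed
  have zeta: "\<zeta> ^ k = 1 \<longleftrightarrow> ?g [^] k = \<one>" for k :: nat
  proof
    assume one': "?g [^] k = \<one>"
    obtain i where i: "i < n" "a $ i \<noteq> 0"
      using nonzero_vec_entry[OF a a_nz] .
    have "a = \<zeta> ^ k \<cdot>\<^sub>v a"
      using pow_a[of k 1] one' a by (simp add: one_mult_vec)
    from arg_cong[OF this, of "\<lambda>v. v $ i"] show "\<zeta> ^ k = 1"
      using i a by simp
  next
    assume z: "\<zeta> ^ k = 1"
    have pS: "?g [^] k \<in> S"
      by (induction k) (auto simp: S_one S_mult ord(2))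
    have "?g [^] k = 1\<^sub>m n"
    proof (rule eq_one_if_fixes_all[OF pS])
      fix v :: "complex vec" assume v: "v \<in> carrier_vec n"
      define t where "t = (?b \<bullet> v) / (?b \<bullet> w)"
      define v' where "v' = v + (- t) \<cdot>\<^sub>v a"
      have v': "v' \<in> carrier_vec n" "?b \<bullet> v' = 0"
        using v a dot[OF v a, of "- t"] ba w by (simp_all add: v'_def t_def)
      have eq: "v = v' + t \<cdot>\<^sub>v a"
        using v a by (intro eq_vecI) (auto simp: v'_def)
      have "(?g [^] k) *\<^sub>v (v' + t \<cdot>\<^sub>v a) = v' + t \<cdot>\<^sub>v a"
        using mult_add_distrib_mat_vec[OF S_mat[OF pS] v'(1), of "t \<cdot>\<^sub>v a"] a pow_a[of k t] z
          pow_fixed[OF v'] by simp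
      then show "(?g [^] k) *\<^sub>v v = v"
        unfolding eq[symmetric] .
    qed
    then show "?g [^] k = \<one>" by (simp add: one)
  qed
  show thesis
  proof (rule that)
    show "w = p + a"
      using w a by (intro eq_vecI) (auto simp: p_def)
    show "local_point n \<Gamma> S G ?g ?e \<zeta> u p a"
    proof (intro local_point.intro coset_action_axioms local_point_axioms.intro)
      show "\<zeta> ^ k = 1 \<longleftrightarrow> ?e dvd k" for k
        unfolding zeta ord(4) ..
      show "\<exists>k :: nat. \<sigma> = ?g [^] k" if "\<sigma> \<in> S" "\<sigma> *\<^sub>v u = u" for \<sigma>
        using generic_stabilizer[OF u P that] by (rule ord(5))
    qed (use ord(1,2,4) uc p a a_nz ga fixed[OF uc P(2)] fixed[OF p bp] in auto)
  qed
qed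

lemma line_L:
  assumes "P \<in> hyperplanes" "u \<in> carrier_vec n" "w \<in> carrier_vec n"
  shows "line u w (L P) = [:cov P \<bullet> u, cov P \<bullet> w:]"
  using line_linear_form[of "L P" n K u w] L[OF assms(1)] assms by (simp add: cov_def)

lemma line_disc:
  assumes "u \<in> carrier_vec n" "w \<in> carrier_vec n"
  shows "line u w disc = (\<Prod>P\<in>hyperplanes. [:cov P \<bullet> u, cov P \<bullet> w:] ^ nat \<lfloor>disc_exponent \<Gamma> S G P (g P)\<rfloor>)"
  unfolding discriminant_def line.hom_prod line.hom_power using line_L assms by (intro prod.cong) auto

text \<open>On \<open>\<Delta>\<close> the order can be read off, since a transversal line meets the zero set of the linear form of
\<open>P\<close> to first order and no other linear form vanishes at \<open>u\<close>.\<close>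

lemma line_orders:
  assumes u: "generic_point u" and w: "w \<in> carrier_vec n"
    and transversal: "\<And>P. P \<in> hyperplanes \<Longrightarrow> cov P \<bullet> w \<noteq> 0"
  shows "\<exists>E q r. line u w sec_det = [:0, 1:] ^ E * q \<and> poly q 0 \<noteq> 0 \<and>
    line u w disc = [:0, 1:] ^ E * r \<and> poly r 0 \<noteq> 0"
proof -
  let ?x = "[:0, 1:] :: complex poly"
  have uc: "u \<in> carrier_vec n" using u by (simp add: generic_point_def)
  show ?thesis
  proof (cases "\<exists>P\<in>hyperplanes. cov P \<bullet> u = 0")
    case True
    then obtain P where P: "P \<in> hyperplanes" "cov P \<bullet> u = 0" by blast
    let ?e = "card (pointwise_stabilizer S P)"
    let ?E = "\<lambda>P. nat \<lfloor>disc_exponent \<Gamma> S G P (g P)\<rfloor>"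
    obtain \<zeta> p a where wpa: "w = p + a" and lp: "local_point n \<Gamma> S G (g P) ?e \<zeta> u p a"
      by (rule reflection_local_point[OF u P w transversal[OF P(1)]])
    interpret lp: local_point n \<Gamma> S G "g P" ?e \<zeta> u p a by (rule lp)
    have E: "?E P = lp.expo"
      using lp.disc_exponent_eq_expo[OF refl] by simp
    obtain q where q: "line u w sec_det = ?x ^ lp.expo * q" "poly q 0 \<noteq> 0"
      using lp.line_det_order[OF theta_invariant theta_spans gamma_S gamma_bij] unfolding wpa by metis
    let ?r = "[:cov P \<bullet> w:] ^ ?E P * (\<Prod>Q\<in>hyperplanes - {P}. [:cov Q \<bullet> u, cov Q \<bullet> w:] ^ ?E Q)"
    have "line u w disc = [:cov P \<bullet> u, cov P \<bullet> w:] ^ ?E P *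
        (\<Prod>Q\<in>hyperplanes - {P}. [:cov Q \<bullet> u, cov Q \<bullet> w:] ^ ?E Q)"
      unfolding line_disc[OF uc w] by (rule prod.remove[OF finite_hyperplanes P(1)])
    also have "[:cov P \<bullet> u, cov P \<bullet> w:] = ?x * [:cov P \<bullet> w:]"
      using P(2) by simp
    finally have "line u w disc = ?x ^ lp.expo * ?r"
      by (simp only: power_mult_distrib E mult.assoc)
    moreover have "cov Q \<bullet> u \<noteq> 0" if "Q \<in> hyperplanes - {P}" for Q
      using generic_hyperplane_unique[OF u P] that by blast
    then have "poly ?r 0 \<noteq> 0"
      using transversal[OF P(1)] finite_hyperplanes by (auto simp: poly_prod)
    ultimately show ?thesis
      using q by blast
  next
    case False
    have stab: "\<sigma> = \<one>" if "\<sigma> \<in> S" "\<sigma> *\<^sub>v u = u" for \<sigma>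
      using generic_fixed_point[OF u that(1) _ that(2)] False by (auto simp: one)
    have "local_point n \<Gamma> S G (\<one>) 1 1 u (0\<^sub>v n) w"
    proof (intro local_point.intro coset_action_axioms local_point_axioms.intro)
      show "\<exists>k :: nat. \<sigma> = \<one> [^] k" if "\<sigma> \<in> S" "\<sigma> *\<^sub>v u = u" for \<sigma>
        using stab[OF that] by simp
    qed (use S_one uc w one_mult_vec in auto)
    then interpret lp: local_point n \<Gamma> S G "\<one>" 1 1 u "0\<^sub>v n" w .
    have "w = 0\<^sub>v n + w" using w by simp
    then obtain q where q: "line u w sec_det = ?x ^ lp.expo * q" "poly q 0 \<noteq> 0"
      using lp.line_det_order[OF theta_invariant theta_spans gamma_S gamma_bij] by metis
    have "poly (line u w disc) 0 \<noteq> 0"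
      unfolding line_disc[OF uc w] using False finite_hyperplanes by (auto simp: poly_prod)
    then show ?thesis
      using q lp.expo_eq_0[OF refl] by (intro exI[of _ 0] exI[of _ q] exI[of _ "line u w disc"]) simp
  qed
qed

end

section \<open>Proportionality of the determinant and the discriminant\<close>

context matrix_group
begin

lemma polys_det:
  assumes A: "subring_set A" "- 1 \<in> A" and M: "M \<in> carrier_mat k k"
    and entry: "\<And>i j. i < k \<Longrightarrow> j < k \<Longrightarrow> M $$ (i, j) \<in> polys n A"
  shows "det M \<in> polys n A"
proof -
  have "- 1 \<in> polys n A"
    using polys_mconst[OF A, of n] by (simp add: mconst_def single_uminus)
  then have sign: "signof \<pi> \<in> polys n A" for \<pi> :: "nat \<Rightarrow> nat"
    using polys_one[OF A(1), of n] by (cases \<pi> rule: sign_cases) simp_all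
  have "\<pi> i < k" if "\<pi> permutes {0..<k}" "i < k" for \<pi> i
    using permutes_in_image[OF that(1), of i] that(2) by simp
  then show ?thesis
    unfolding det_def'[OF M]
    by (intro polys_sum polys_mult polys_prod A(1) sign entry) auto
qed

end

context secondary_setting
begin

lemma disc_polys: "disc \<in> polys n K"
  unfolding discriminant_def using L by (intro polys_prod polys_power K) auto

lemma sec_det_polys:
  assumes A: "subring_set A" "- 1 \<in> A" and entries: "\<And>\<sigma>. \<sigma> \<in> S \<Longrightarrow> elements_mat \<sigma> \<subseteq> A"
    and \<theta>: "\<And>j. j < l \<Longrightarrow> \<theta> j \<in> polys n A"
  shows "sec_det \<in> polys n A"
  by (rule polys_det[OF A, of _ l])
     (use poly_act_polys[OF S_carrier[OF gamma_S] A(1) entries[OF S_inv[OF gamma_S]] \<theta>]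
      in \<open>auto simp: secondary_matrix_def\<close>)

lemma sec_det_polys_UNIV: "sec_det \<in> polys n UNIV"
  by (rule sec_det_polys) (use theta_invariant in \<open>auto simp: subring_set_UNIV invariant_def\<close>)

lemma disc_polys_UNIV: "disc \<in> polys n UNIV"
  using disc_polys polys_mono by blast

text \<open>The base point \<open>v0\<close> is chosen once. For all \<open>v\<close> outside finitely many hyperplanes the line from \<open>v0\<close>
to \<open>v\<close> is generic, and equality of orders along it gives \<open>F v = c * \<Delta> v\<close> with \<open>c\<close> determined at
\<open>v0\<close>. An arbitrary \<open>v\<close> is reached along a line in a direction \<open>z\<close> that avoids these hyperplanes: on
it the identity holds for all but finitely many parameters, hence for all of them.\<close>

lemma sec_det_eq:
  obtains c where "c \<noteq> 0" "sec_det = mconst c * disc"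
proof -
  have covs': "finite covs" "\<And>r. r \<in> covs \<Longrightarrow> r \<in> carrier_vec n \<and> r \<noteq> 0\<^sub>v n"
    using finite_covs covs_carrier covs_nonzero by auto
  obtain v0 where v0: "v0 \<in> carrier_vec n" "\<And>r. r \<in> covs \<Longrightarrow> r \<bullet> v0 \<noteq> 0"
    using ex_avoiding_covectors[OF covs'] by blast
  have dot: "r \<bullet> (v + t \<cdot>\<^sub>v v') = r \<bullet> v + t * (r \<bullet> v')"
    if "r \<in> carrier_vec n" "v \<in> carrier_vec n" "v' \<in> carrier_vec n" for r v v' :: "complex vec" and t
    using that by (subst scalar_prod_add_distrib[of _ n]) auto
  \<comment> \<open>must vanish at \<open>v\<close> if the kernels of \<open>r\<close> and \<open>s\<close> meet on the line through \<open>v0\<close> and \<open>v\<close>\<close>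
  define minor where "minor r s = (r \<bullet> v0) \<cdot>\<^sub>v s + (- (s \<bullet> v0)) \<cdot>\<^sub>v r" for r s
  define minors where "minors = (\<lambda>(r, s). minor r s) ` {(r, s) \<in> covs \<times> covs. \<not> proportional r s}"
  have minor_dot: "minor r s \<bullet> v = (r \<bullet> v0) * (s \<bullet> v) - (s \<bullet> v0) * (r \<bullet> v)"
    if "r \<in> covs" "s \<in> covs" "v \<in> carrier_vec n" for r s v
    using that covs_carrier unfolding minor_def by (subst add_scalar_prod_distrib[of _ n]) auto
  have minors: "finite minors" "\<And>q. q \<in> minors \<Longrightarrow> q \<in> carrier_vec n \<and> q \<noteq> 0\<^sub>v n"
  proof -
    have "finite {(r, s) \<in> covs \<times> covs. \<not> proportional r s}"
      by (rule finite_subset[of _ "covs \<times> covs"]) (use finite_covs in auto)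
    then show "finite minors" unfolding minors_def by simp
    fix q assume "q \<in> minors"
    then obtain r s where rs: "r \<in> covs" "s \<in> covs" "\<not> proportional r s" "q = minor r s"
      by (auto simp: minors_def)
    have c: "r \<in> carrier_vec n" "s \<in> carrier_vec n"
      using rs covs_carrier by auto
    have "q \<noteq> 0\<^sub>v n"
    proof
      assume "q = 0\<^sub>v n"
      then have "minor r s $ i = 0" if "i < n" for i
        using that rs(4) by simp
      moreover have "minor r s $ i = (r \<bullet> v0) * s $ i - (s \<bullet> v0) * r $ i" if "i < n" for i
        using that c by (simp add: minor_def)
      ultimately have eq: "(r \<bullet> v0) * s $ i = (s \<bullet> v0) * r $ i" if "i < n" for i
        using that by simp
      have "(r \<bullet> v0) * (r $ i * s $ j) = (r \<bullet> v0) * (r $ j * s $ i)" if "i < n" "j < n" for i j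
      proof -
        have "(r \<bullet> v0) * (r $ i * s $ j) = r $ i * ((r \<bullet> v0) * s $ j)"
          by (rule mult.left_commute)
        also have "\<dots> = r $ j * ((r \<bullet> v0) * s $ i)"
          unfolding eq[OF that(1)] eq[OF that(2)] by (simp only: ac_simps)
        also have "\<dots> = (r \<bullet> v0) * (r $ j * s $ i)"
          by (rule mult.left_commute)
        finally show ?thesis .
      qed
      then have "proportional r s"
        using v0(2)[OF rs(1)] c unfolding proportional_def by auto
      then show False using rs(3) by simp
    qed
    then show "q \<in> carrier_vec n \<and> q \<noteq> 0\<^sub>v n"
      using c by (simp add: rs(4) minor_def)
  qed
  have on_line: "\<exists>c. c \<noteq> 0 \<and> poly_eval v0 sec_det = c * poly_eval v0 disc \<and>
      poly_eval v sec_det = c * poly_eval v disc"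
    if v: "v \<in> carrier_vec n" and off: "\<And>r. r \<in> covs \<Longrightarrow> r \<bullet> v \<noteq> r \<bullet> v0"
      and off': "\<And>q. q \<in> minors \<Longrightarrow> q \<bullet> v \<noteq> 0" for v
  proof -
    define w where "w = v + (- 1) \<cdot>\<^sub>v v0"
    have w: "w \<in> carrier_vec n" using v v0 by (simp add: w_def)
    have rw: "r \<bullet> w = r \<bullet> v - r \<bullet> v0" if "r \<in> covs" for r
      using dot[OF covs_carrier[OF that] v v0(1), of "- 1"] by (simp add: w_def)
    have gen: "generic_point (v0 + t \<cdot>\<^sub>v w)" for t
      unfolding generic_point_def
    proof (intro conjI ballI impI)
      show "v0 + t \<cdot>\<^sub>v w \<in> carrier_vec n" using v0 w by simp
      fix r s assume rs: "r \<in> covs" "s \<in> covs" "r \<bullet> (v0 + t \<cdot>\<^sub>v w) = 0" "s \<bullet> (v0 + t \<cdot>\<^sub>v w) = 0"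
      have e: "r \<bullet> v0 + t * (r \<bullet> v - r \<bullet> v0) = 0" "s \<bullet> v0 + t * (s \<bullet> v - s \<bullet> v0) = 0"
        using rs dot[OF covs_carrier v0(1) w] rw by auto
      have t: "t \<noteq> 0" using e(1) v0(2)[OF rs(1)] by auto
      have "t * (minor r s \<bullet> v) = (r \<bullet> v0) * (t * (s \<bullet> v)) - (s \<bullet> v0) * (t * (r \<bullet> v))"
        unfolding minor_dot[OF rs(1,2) v] by (simp add: algebra_simps)
      also have "t * (s \<bullet> v) = (t - 1) * (s \<bullet> v0)"
        using e(2) by (simp add: algebra_simps)
      also have "t * (r \<bullet> v) = (t - 1) * (r \<bullet> v0)"
        using e(1) by (simp add: algebra_simps)
      finally have "minor r s \<bullet> v = 0" using t by simp
      then show "proportional r s"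
        using off'[of "minor r s"] rs(1,2) unfolding minors_def by auto
    qed
    have "\<exists>E p' q'. pcompose (line v0 w sec_det) [:t, 1:] = [:0, 1:] ^ E * p' \<and> poly p' 0 \<noteq> 0 \<and>
        pcompose (line v0 w disc) [:t, 1:] = [:0, 1:] ^ E * q' \<and> poly q' 0 \<noteq> 0" for t
      unfolding pcompose_line[OF sec_det_polys_UNIV v0(1) w] pcompose_line[OF disc_polys_UNIV v0(1) w]
      by (rule line_orders[OF gen w]) (use rw off cov_covs in simp)
    then obtain c where c: "c \<noteq> 0" "line v0 w sec_det = smult c (line v0 w disc)"
      by (rule same_orders_imp_scale)
    have "v0 + 0 \<cdot>\<^sub>v w = v0" "v0 + 1 \<cdot>\<^sub>v w = v"
      using v v0 by (auto simp: w_def)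
    then have "poly (line v0 w f) 0 = poly_eval v0 f" "poly (line v0 w f) 1 = poly_eval v f"
      if "f \<in> polys n UNIV" for f
      using poly_line[OF that v0(1) w, of 0] poly_line[OF that v0(1) w, of 1] by simp_all
    from this[OF sec_det_polys_UNIV] this[OF disc_polys_UNIV] show ?thesis
      using c by (intro exI[of _ c]) (metis poly_smult)
  qed
  obtain z where z: "z \<in> carrier_vec n" "\<And>r. r \<in> covs \<union> minors \<Longrightarrow> r \<bullet> z \<noteq> 0"
    using ex_avoiding_covectors[of "covs \<union> minors" n] covs' minors by blast
  have near: "\<exists>bad. finite bad \<and> (\<forall>s. s \<notin> bad \<longrightarrow>
      (\<exists>c. c \<noteq> 0 \<and> poly_eval v0 sec_det = c * poly_eval v0 disc \<and>
        poly_eval (v + s \<cdot>\<^sub>v z) sec_det = c * poly_eval (v + s \<cdot>\<^sub>v z) disc))"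
    if v: "v \<in> carrier_vec n" for v
  proof -
    let ?bad = "(\<lambda>r. (r \<bullet> v0 - r \<bullet> v) / (r \<bullet> z)) ` covs \<union> (\<lambda>q. - (q \<bullet> v) / (q \<bullet> z)) ` minors"
    have "\<exists>c. c \<noteq> 0 \<and> poly_eval v0 sec_det = c * poly_eval v0 disc \<and>
        poly_eval (v + s \<cdot>\<^sub>v z) sec_det = c * poly_eval (v + s \<cdot>\<^sub>v z) disc"
      if s: "s \<notin> ?bad" for s
    proof (rule on_line)
      show "v + s \<cdot>\<^sub>v z \<in> carrier_vec n" using v z by simp
      show "r \<bullet> (v + s \<cdot>\<^sub>v z) \<noteq> r \<bullet> v0" if r: "r \<in> covs" for r
      proof -
        have "s \<noteq> (r \<bullet> v0 - r \<bullet> v) / (r \<bullet> z)" using s r by blast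
        then have "s * (r \<bullet> z) \<noteq> r \<bullet> v0 - r \<bullet> v"
          using z(2)[of r] r by (auto simp: field_simps)
        then show ?thesis
          unfolding dot[OF covs_carrier[OF r] v z(1)] by (auto simp: algebra_simps)
      qed
      show "q \<bullet> (v + s \<cdot>\<^sub>v z) \<noteq> 0" if q: "q \<in> minors" for q
      proof -
        have "s \<noteq> - (q \<bullet> v) / (q \<bullet> z)" using s q by blast
        then have "s * (q \<bullet> z) \<noteq> - (q \<bullet> v)"
          using z(2)[of q] q by (auto simp: field_simps)
        moreover have "q \<in> carrier_vec n" using minors(2)[OF q] by blast
        ultimately show ?thesis
          using dot[OF _ v z(1), of q s] by (auto simp: add_eq_0_iff2)
      qed
    qed
    moreover have "finite ?bad" using covs' minors by simp
    ultimately show ?thesis by blast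
  qed
  have disc_v0: "poly_eval v0 disc \<noteq> 0"
  proof -
    have "poly (line v0 v0 disc) 0 \<noteq> 0"
      unfolding line_disc[OF v0(1) v0(1)] using v0(2) cov_covs finite_hyperplanes
      by (auto simp: poly_prod)
    then show ?thesis
      using poly_eval_conv_line[OF disc_polys_UNIV v0(1)] by simp
  qed
  obtain bad where bad: "finite bad" "\<And>s. s \<notin> bad \<Longrightarrow>
      \<exists>c. c \<noteq> 0 \<and> poly_eval v0 sec_det = c * poly_eval v0 disc \<and>
        poly_eval (v0 + s \<cdot>\<^sub>v z) sec_det = c * poly_eval (v0 + s \<cdot>\<^sub>v z) disc"
    using near[OF v0(1)] by blast
  obtain s0 where "s0 \<notin> bad"
    using ex_new_if_finite[OF infinite_UNIV_char_0 bad(1)] by blast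
  then obtain c where c: "c \<noteq> 0" "poly_eval v0 sec_det = c * poly_eval v0 disc"
    using bad(2) by blast
  have "poly_eval v sec_det = c * poly_eval v disc" if v: "v \<in> carrier_vec n" for v
  proof -
    obtain bad where bad: "finite bad" "\<And>s. s \<notin> bad \<Longrightarrow>
        \<exists>c. c \<noteq> 0 \<and> poly_eval v0 sec_det = c * poly_eval v0 disc \<and>
          poly_eval (v + s \<cdot>\<^sub>v z) sec_det = c * poly_eval (v + s \<cdot>\<^sub>v z) disc"
      using near[OF v] by blast
    define h where "h = line v z sec_det - smult c (line v z disc)"
    have "poly h s = 0" if s: "s \<notin> bad" for s
    proof -
      obtain c' where "poly_eval v0 sec_det = c' * poly_eval v0 disc"
        "poly_eval (v + s \<cdot>\<^sub>v z) sec_det = c' * poly_eval (v + s \<cdot>\<^sub>v z) disc"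
        using bad(2)[OF s] by blast
      moreover from this have "c' = c" using c disc_v0 by simp
      ultimately show ?thesis
        unfolding h_def using poly_line[OF sec_det_polys_UNIV v z(1)] poly_line[OF disc_polys_UNIV v z(1)]
        by simp
    qed
    then have "UNIV \<subseteq> bad \<union> {s. poly h s = 0}" by blast
    then have "infinite {s. poly h s = 0}"
      using bad(1) infinite_UNIV_char_0[where 'a = complex] by (meson finite_Un finite_subset)
    then have "h = 0" using poly_roots_finite by blast
    then have "poly (line v z sec_det) 0 = c * poly (line v z disc) 0"
      by (simp add: h_def)
    moreover have "v + 0 \<cdot>\<^sub>v z = v" using v z by auto
    ultimately show ?thesis
      using poly_line[OF sec_det_polys_UNIV v z(1), of 0] poly_line[OF disc_polys_UNIV v z(1), of 0]
      by simp
  qed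
  then have "sec_det = mconst c * disc"
  proof (intro polys_eqI[of _ n] sec_det_polys_UNIV)
    show "mconst c * disc \<in> polys n UNIV"
      by (intro polys_mult polys_mconst disc_polys_UNIV subring_set_UNIV) auto
    fix v :: "complex vec" assume "v \<in> carrier_vec n"
    moreover have "poly_eval v (mconst c) = c"
      by (simp add: poly_eval_def mconst_def)
    ultimately show "poly_eval v sec_det = poly_eval v (mconst c * disc)"
      using \<open>\<And>v. v \<in> carrier_vec n \<Longrightarrow> poly_eval v sec_det = c * poly_eval v disc\<close>
      by (simp add: poly_eval.hom_mult)
  qed
  with c(1) show thesis by (rule that)
qed

end

section \<open>Primitivity\<close>

locale integer_ring =
  fixes K :: "complex set"
  assumes pid: "principal_domain (ring_of_integers K)" and minus_one: "- 1 \<in> K"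
begin

abbreviation R :: "complex ring"
  where "R \<equiv> ring_of_integers K"

lemma R_simps [simp]:
  "mult R = (*)" "one R = 1" "zero R = 0" "add R = (+)"
  by (simp_all add: ring_of_integers_def ring_of_type_algebra_def fun_eq_iff)

sublocale principal_domain R by (rule pid)

lemma minus_one_R: "- 1 \<in> carrier R"
  using minus_one by (simp add: ring_of_integers_def)

lemma subring_R: "subring_set (carrier R)"
  using m_closed a_closed one_closed zero_closed by (simp add: subring_set_def)

lemma uminus_R: "x \<in> carrier R \<Longrightarrow> - x \<in> carrier R"
  using m_closed[OF minus_one_R] by simp

lemma a_inv_R: "x \<in> carrier R \<Longrightarrow> \<ominus>\<^bsub>R\<^esub> x = - x"
  using minus_equality[of "- x" x] uminus_R by simp

lemma divides_R: "a divides\<^bsub>R\<^esub> b \<longleftrightarrow> (\<exists>c\<in>carrier R. b = a * c)"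
  by (simp add: factor_def)

text \<open>With \<open>J\<close> ranging over the prime ideals, this says that the coefficients generate the unit ideal.\<close>

definition avoids :: "complex set \<Rightarrow> mpoly \<Rightarrow> bool"
  where "avoids J f \<longleftrightarrow> (\<exists>m. lookup f m \<notin> J)"

lemma proper_ideal_in_primeideal:
  assumes I: "ideal I R" and one: "1 \<notin> I"
  obtains J where "primeideal J R" "I \<subseteq> J"
proof -
  obtain a where a: "a \<in> carrier R" "I = PIdl\<^bsub>R\<^esub> a"
    using exists_gen[OF I] by blast
  show thesis
  proof (cases "a = 0")
    case True
    then have "I \<subseteq> {0}"
      unfolding a(2) cgenideal_def by auto
    then show thesis
      using zeroprimeideal by (intro that[of "{0}"]) auto
  next
    case False
    have "a \<notin> Units R"
    proof
      assume "a \<in> Units R"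
      then obtain b where "b \<in> carrier R" "1 = b * a"
        unfolding Units_def by auto
      then show False
        using one unfolding a(2) cgenideal_def by auto
    qed
    moreover have "a \<in> carrier R - {\<zero>\<^bsub>R\<^esub>}"
      using a(1) False by simp
    ultimately obtain b where b: "b \<in> carrier R" "ring_irreducible\<^bsub>R\<^esub> b" "b divides\<^bsub>R\<^esub> a"
      by (metis exists_irreducible_divisor)
    obtain k where k: "k \<in> carrier R" "a = b * k"
      using b(3) divides_R by blast
    have "maximalideal (PIdl\<^bsub>R\<^esub> b) R"
      by (rule irreducible_imp_maximalideal[OF b(1,2)])
    then have "primeideal (PIdl\<^bsub>R\<^esub> b) R"
      by (rule maximalideal_prime)
    moreover have "I \<subseteq> PIdl\<^bsub>R\<^esub> b"
    proof
      fix x assume "x \<in> I"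
      then obtain y where y: "y \<in> carrier R" "x = y * a"
        unfolding a(2) cgenideal_def by auto
      have "x = (y * k) * b"
        unfolding y(2) k(2) by (simp only: ac_simps)
      moreover have "y * k \<in> carrier R"
        using m_closed[OF y(1) k(1)] by simp
      ultimately show "x \<in> PIdl\<^bsub>R\<^esub> b"
        unfolding cgenideal_def by auto
    qed
    ultimately show thesis by (rule that)
  qed
qed

lemma primeideal_facts:
  assumes J: "primeideal J R"
  shows "J \<subseteq> carrier R" "0 \<in> J" "1 \<notin> J"
    and "x \<in> J \<Longrightarrow> y \<in> J \<Longrightarrow> x + y \<in> J"
    and "x \<in> carrier R \<Longrightarrow> y \<in> J \<Longrightarrow> x * y \<in> J"
    and "x \<in> carrier R \<Longrightarrow> y \<in> carrier R \<Longrightarrow> x * y \<in> J \<Longrightarrow> x \<in> J \<or> y \<in> J"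
proof -
  interpret J: primeideal J R by (rule J)
  show "J \<subseteq> carrier R" by (rule J.a_subset)
  show "0 \<in> J" using J.zero_closed by simp
  show "1 \<notin> J" using J.I_notcarr J.one_imp_carrier by auto
  show "x \<in> J \<Longrightarrow> y \<in> J \<Longrightarrow> x + y \<in> J" using J.a_closed[of x y] by simp
  show "x \<in> carrier R \<Longrightarrow> y \<in> J \<Longrightarrow> x * y \<in> J" using J.I_l_closed[of y x] by simp
  show "x \<in> carrier R \<Longrightarrow> y \<in> carrier R \<Longrightarrow> x * y \<in> J \<Longrightarrow> x \<in> J \<or> y \<in> J"
    using J.I_prime[of x y] by simp
qed

text \<open>A generator of \<open>J\<close> that divides all coefficients divides their greatest common divisor, a unit.\<close>

lemma primitive_avoids:
  assumes f: "is_primitive R f" and J: "primeideal J R"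
  shows "avoids J f"
proof (rule ccontr)
  assume "\<not> avoids J f"
  then have all: "lookup f m \<in> J" for m by (simp add: avoids_def)
  interpret J: primeideal J R by (rule J)
  obtain d where d: "d \<in> carrier R" "J = PIdl\<^bsub>R\<^esub> d"
    using exists_gen[OF J.is_ideal] by blast
  obtain u where u: "u \<in> Units R" "is_content R f u"
    using f by (auto simp: is_primitive_def)
  have "d divides\<^bsub>R\<^esub> lookup f m" for m
    using all[of m] unfolding d(2) cgenideal_def divides_R by (auto simp: mult.commute)
  then have "d divides\<^bsub>R\<^esub> u"
    using u(2) d(1) unfolding is_content_def by blast
  then obtain k where k: "k \<in> carrier R" "u = d * k"
    using divides_R by blast
  obtain v where v: "v \<in> carrier R" "v * u = 1"
    using u(1) unfolding Units_def by auto
  have "1 = (v * k) * d" using k v by (simp add: ac_simps)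
  moreover have "v * k \<in> carrier R" using m_closed[OF v(1) k(1)] by simp
  ultimately have "1 \<in> J"
    unfolding d(2) cgenideal_def by auto
  then show False
    using primeideal_facts(3)[OF J] by blast
qed

text \<open>Gauss's lemma. With respect to the order on exponent vectors let \<open>top f\<close> be the largest exponent of
\<open>f\<close> whose coefficient is outside \<open>J\<close>. In the coefficient of the product at \<open>top f + top h\<close> all
summands but one lie in \<open>J\<close>, since one of the two exponents exceeds the largest one.\<close>

lemma avoids_mult:
  assumes J: "primeideal J R" and f: "f \<in> polys n (carrier R)" and h: "h \<in> polys n (carrier R)"
    and "avoids J f" "avoids J h"
  shows "avoids J (f * h)"
proof -
  note J_facts = primeideal_facts[OF J]
  define top where "top f = Max {m \<in> keys f. lookup f m \<notin> J}" for f :: mpoly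
  have top: "lookup f (top f) \<notin> J" "\<And>m. top f < m \<Longrightarrow> lookup f m \<in> J"
    if av: "avoids J f" for f
  proof -
    let ?A = "{m \<in> keys f. lookup f m \<notin> J}"
    obtain m where "lookup f m \<notin> J"
      using av by (auto simp: avoids_def)
    then have "m \<in> ?A"
      using J_facts(2) by (auto simp: in_keys_iff)
    then have "?A \<noteq> {}" by blast
    then have "top f \<in> ?A"
      unfolding top_def by (intro Max_in) auto
    then show "lookup f (top f) \<notin> J" by simp
    show "lookup f m \<in> J" if "top f < m" for m
    proof (rule ccontr)
      assume n: "lookup f m \<notin> J"
      then have "m \<in> ?A"
        using J_facts(2) by (auto simp: in_keys_iff)
      then have "m \<le> top f"
        unfolding top_def by (intro Max_ge) auto
      then show False using that by simp
    qed
  qed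
  let ?M = "top f" and ?N = "top h"
  have co: "lookup f m \<in> carrier R" "lookup h m \<in> carrier R" for m
    using f h by (auto simp: polys_def)
  define t where "t = (\<lambda>(m, m'). lookup f m * lookup h m' when m + m' = ?M + ?N)"
  have "lookup (f * h) (?M + ?N) =
      (\<Sum>m\<in>keys f. \<Sum>m'\<in>keys h. t (m, m'))"
    unfolding mpoly_mult_terms[of f h] lookup_sum by (simp add: lookup_single t_def)
  also have "\<dots> = sum t (keys f \<times> keys h)"
    by (simp add: sum.cartesian_product)
  also have "\<dots> = t (?M, ?N) + sum t (keys f \<times> keys h - {(?M, ?N)})"
  proof (rule sum.remove)
    show "(?M, ?N) \<in> keys f \<times> keys h"
      using top(1)[OF assms(4)] top(1)[OF assms(5)] J_facts(2) by (auto simp: in_keys_iff)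
  qed simp
  finally have eq: "lookup (f * h) (?M + ?N) =
      t (?M, ?N) + sum t (keys f \<times> keys h - {(?M, ?N)})" .
  have sumJ: "sum F A \<in> J" if "\<And>x. x \<in> A \<Longrightarrow> F x \<in> J" for F :: "_ \<Rightarrow> complex" and A
    using that by (induction A rule: infinite_finite_induct) (auto simp: J_facts)
  have rest: "sum t (keys f \<times> keys h - {(?M, ?N)}) \<in> J"
  proof (rule sumJ)
    fix x assume "x \<in> keys f \<times> keys h - {(?M, ?N)}"
    then obtain m m' where x: "x = (m, m')" "(m, m') \<noteq> (?M, ?N)" by auto
    show "t x \<in> J"
    proof (cases "m + m' = ?M + ?N")
      case False
      then show ?thesis by (simp add: t_def x J_facts(2))
    next
      case True
      consider "?M < m" | "m < ?M" | "m = ?M" by (rule linorder_cases)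
      then have "?M < m \<or> ?N < m'"
      proof cases
        case 2
        have "?N < m'"
        proof (rule ccontr)
          assume "\<not> ?N < m'"
          then have "m' \<le> ?N" by simp
          then have "m + m' < ?M + ?N"
            using 2 by (rule add_less_le_mono[rotated])
          then show False using True by simp
        qed
        then show ?thesis ..
      next
        case 3
        then show ?thesis using True x by simp
      qed simp
      then have "lookup f m \<in> J \<or> lookup h m' \<in> J"
        using top(2)[OF assms(4)] top(2)[OF assms(5)] by blast
      then have "lookup f m * lookup h m' \<in> J"
        using J_facts(5) co by (metis mult.commute)
      then show ?thesis by (simp add: t_def x True)
    qed
  qed
  have "lookup (f * h) (?M + ?N) \<notin> J"
  proof
    assume "lookup (f * h) (?M + ?N) \<in> J"
    then have "lookup (f * h) (?M + ?N) + (- 1) *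
        sum t (keys f \<times> keys h - {(?M, ?N)}) \<in> J"
      using J_facts(4) J_facts(5)[OF minus_one_R rest] by blast
    then have "t (?M, ?N) \<in> J" unfolding eq by simp
    then have "lookup f ?M * lookup h ?N \<in> J" by (simp add: t_def)
    then show False
      using J_facts(6)[OF co] top(1)[OF assms(4)] top(1)[OF assms(5)] by blast
  qed
  then show ?thesis
    unfolding avoids_def by blast
qed

lemma avoids_prod:
  assumes J: "primeideal J R"
    and F: "\<And>i. i \<in> I \<Longrightarrow> F i \<in> polys n (carrier R) \<and> avoids J (F i)"
  shows "(\<Prod>i\<in>I. F i ^ E i) \<in> polys n (carrier R) \<and> avoids J (\<Prod>i\<in>I. F i ^ E i)"
proof -
  have one: "1 \<in> polys n (carrier R) \<and> avoids J 1"
    using polys_one[OF subring_R, of n] primeideal_facts(3)[OF J]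
    by (auto simp: avoids_def intro!: exI[of _ 0])
  have pow: "f ^ k \<in> polys n (carrier R) \<and> avoids J (f ^ k)"
    if "f \<in> polys n (carrier R) \<and> avoids J f" for f k
    using that by (induction k) (auto simp: one polys_mult[OF subring_R] avoids_mult[OF J])
  have mult: "f * h \<in> polys n (carrier R) \<and> avoids J (f * h)"
    if "f \<in> polys n (carrier R) \<and> avoids J f" "h \<in> polys n (carrier R) \<and> avoids J h" for f h
    using that polys_mult[OF subring_R] avoids_mult[OF J] by blast
  show ?thesis
    using F
  proof (induction I rule: infinite_finite_induct)
    case (insert i I)
    then show ?case
      using mult[OF pow[OF insert.prems[of i]]] by simp
  qed (simp_all add: one)
qed

text \<open>The elements \<open>x\<close> for which \<open>d\<close> divides \<open>c x\<close> form an ideal containing all coefficients of \<open>f\<close>. It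
is contained in no prime ideal, so it contains \<open>1\<close>. The number \<open>c\<close> is not assumed to be integral;
the case \<open>d = 1\<close> proves that it is.\<close>

lemma divides_from_coefficients:
  assumes f: "\<And>m. lookup f m \<in> carrier R"
    and avoid: "\<And>J. primeideal J R \<Longrightarrow> avoids J f"
    and d: "d \<in> carrier R"
    and div: "\<And>m. \<exists>y\<in>carrier R. c * lookup f m = d * y"
  shows "\<exists>y\<in>carrier R. c = d * y"
proof (rule ccontr)
  assume not_dvd: "\<not> ?thesis"
  define I where "I = {x \<in> carrier R. \<exists>y\<in>carrier R. c * x = d * y}"
  have "ideal I R"
  proof (rule idealI[OF ring_axioms])
    show "subgroup I (add_monoid R)"
    proof (rule subgroup.intro)
      show "I \<subseteq> carrier (add_monoid R)" by (auto simp: I_def)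
      show "x \<otimes>\<^bsub>add_monoid R\<^esub> y \<in> I" if xy: "x \<in> I" "y \<in> I" for x y
      proof -
        obtain x' y' where x': "x' \<in> carrier R" "c * x = d * x'" and y': "y' \<in> carrier R" "c * y = d * y'"
          using xy by (auto simp: I_def)
        have "c * (x + y) = d * (x' + y')"
          using x' y' by (simp add: distrib_left)
        then show ?thesis
          using xy x'(1) y'(1) subring_R unfolding I_def subring_set_def by auto
      qed
      show "\<one>\<^bsub>add_monoid R\<^esub> \<in> I"
        using subring_R by (auto simp: I_def subring_set_def intro!: bexI[of _ 0])
      show "inv\<^bsub>add_monoid R\<^esub> x \<in> I" if x: "x \<in> I" for x
      proof -
        obtain x' where x': "x \<in> carrier R" "x' \<in> carrier R" "c * x = d * x'"
          using x by (auto simp: I_def)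
        have "c * (- x) = d * (- x')" using x' by simp
        then have "- x \<in> I"
          using x' uminus_R unfolding I_def by blast
        then show ?thesis
          using a_inv_R[OF x'(1)] by (simp add: a_inv_def)
      qed
    qed
    show "x \<otimes>\<^bsub>R\<^esub> a \<in> I" if a: "a \<in> I" and x: "x \<in> carrier R" for a x
    proof -
      obtain a' where a': "a \<in> carrier R" "a' \<in> carrier R" "c * a = d * a'"
        using a by (auto simp: I_def)
      have "c * (x * a) = d * (x * a')"
        using a'(3) by (metis mult.left_commute)
      moreover have "x * a \<in> carrier R" "x * a' \<in> carrier R"
        using a' x subring_R unfolding subring_set_def by auto
      ultimately have "x * a \<in> I"
        unfolding I_def by blast
      then show ?thesis by simp
    qed
    then show "a \<otimes>\<^bsub>R\<^esub> x \<in> I" if "a \<in> I" "x \<in> carrier R" for a x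
      using that by (simp add: mult.commute)
  qed
  moreover have "1 \<notin> I"
    using not_dvd by (auto simp: I_def)
  ultimately obtain J where J: "primeideal J R" "I \<subseteq> J"
    by (rule proper_ideal_in_primeideal)
  have "lookup f m \<in> I" for m
    using f div by (auto simp: I_def)
  then show False
    using avoid[OF J(1)] J(2) unfolding avoids_def by blast
qed

end

section \<open>The general linear group over a ring\<close>

lemma GL_matrix_group:
  assumes A: "subring_set A"
  shows "matrix_group n (GL n A)" and "\<sigma> \<in> carrier (GL n A) \<Longrightarrow> elements_mat \<sigma> \<subseteq> A"
proof -
  let ?M = "\<lparr>carrier = {M \<in> carrier_mat n n. elements_mat M \<subseteq> A}, monoid.mult = (*), one = 1\<^sub>m n\<rparr>
    :: complex mat monoid"
  have entry: "M $$ (i, j) \<in> A" if "M \<in> carrier ?M" "i < n" "j < n" for M i j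
  proof -
    have "M \<in> carrier_mat n n" "elements_mat M \<subseteq> A" using that(1) by auto
    then show ?thesis
      using subsetD[OF _ elements_matI[OF _ that(2,3) refl]] by blast
  qed
  have memI: "M \<in> carrier ?M" if "M \<in> carrier_mat n n" "\<And>i j. i < n \<Longrightarrow> j < n \<Longrightarrow> M $$ (i, j) \<in> A" for M
    using that by (auto simp: elements_mat_def)
  interpret M: monoid ?M
  proof (rule monoidI)
    show "x \<otimes>\<^bsub>?M\<^esub> y \<in> carrier ?M" if xy: "x \<in> carrier ?M" "y \<in> carrier ?M" for x y
    proof (rule memI)
      have c: "x \<in> carrier_mat n n" "y \<in> carrier_mat n n" using xy by auto
      then show "x \<otimes>\<^bsub>?M\<^esub> y \<in> carrier_mat n n" by simp
      fix i j assume ij: "i < n" "j < n"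
      have "(x \<otimes>\<^bsub>?M\<^esub> y) $$ (i, j) = (\<Sum>k<n. x $$ (i, k) * y $$ (k, j))"
        using c ij by (simp add: scalar_prod_def atLeast0LessThan)
      also have "\<dots> \<in> A"
        using entry[OF xy(1) ij(1)] entry[OF xy(2) _ ij(2)] A
        by (intro subring_set_sum) (auto simp: subring_set_def)
      finally show "(x \<otimes>\<^bsub>?M\<^esub> y) $$ (i, j) \<in> A" .
    qed
    show "\<one>\<^bsub>?M\<^esub> \<in> carrier ?M"
      by (rule memI) (use A in \<open>auto simp: subring_set_def\<close>)
  qed auto
  have sub: "carrier (GL n A) \<subseteq> carrier ?M"
    by (auto simp: GL_def units_of_carrier Units_def)
  show "matrix_group n (GL n A)"
  proof (rule matrix_group.intro)
    show "group (GL n A)"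
      unfolding GL_def by (rule M.units_group)
    show "carrier (GL n A) \<subseteq> carrier_mat n n"
      using sub by auto
  qed (simp_all add: GL_def units_of_def)
  show "elements_mat \<sigma> \<subseteq> A" if "\<sigma> \<in> carrier (GL n A)"
    using sub that by auto
qed

section \<open>The content of the determinant\<close>

theorem mainTheorem5:
  fixes K :: "complex set"
    and n l :: nat
    and S G :: "complex mat set"
    and \<theta> :: "nat \<Rightarrow> mpoly"
    and \<gamma> :: "nat \<Rightarrow> complex mat"
    and L :: "complex vec set \<Rightarrow> mpoly"
    and g :: "complex vec set \<Rightarrow> complex mat"
  defines "R \<equiv> ring_of_integers K"
  defines "\<Gamma> \<equiv> GL n (carrier R)"
  assumes "number_field K"
    and "unitary_reflection_group \<Gamma> n K S"
    and "subgroup G (\<Gamma>\<lparr>carrier := S\<rparr>)"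
    and "card (left_cosets \<Gamma> S G) = l"
    and "secondaries \<Gamma> n K S G l \<theta>"
    and "\<And>i. i < l \<Longrightarrow> \<gamma> i \<in> S"
    and "bij_betw (\<lambda>i. \<gamma> i <#\<^bsub>\<Gamma>\<^esub> G) {..<l} (left_cosets \<Gamma> S G)"
    and "principal_domain R"
    and "\<And>P. P \<in> reflecting_hyperplanes n K S \<Longrightarrow>
           L P \<in> polys n (carrier R) \<and> homogeneous 1 (L P) \<and>
           {v \<in> vecs n K. poly_eval v (L P) = 0} = P \<and> is_primitive R (L P)"
    and "\<And>P. P \<in> reflecting_hyperplanes n K S \<Longrightarrow>
           g P \<in> pointwise_stabilizer S P \<and>
           generate \<Gamma> {g P} = pointwise_stabilizer S P"
  shows "(\<forall>mho. is_content R (det (secondary_matrix \<Gamma> l \<gamma> \<theta>)) mho \<longrightarrow>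
            (\<exists>u\<in>Units R. det (secondary_matrix \<Gamma> l \<gamma> \<theta>) =
                mconst (u * mho) * discriminant \<Gamma> n K S G g L)) \<and>
         is_primitive_part R (det (secondary_matrix \<Gamma> l \<gamma> \<theta>)) (discriminant \<Gamma> n K S G g L)"
proof -
  have "subfield K complex_field"
    using \<open>number_field K\<close> by (simp add: number_field_def)
  then have "subring K complex_field"
    by (simp add: subfield_def subdomain_def subcring_def)
  note E = subringE[OF this]
  interpret CF: ring complex_field by (rule ring_from_type_algebra)
  have K: "subring_set K"
    using E(2,3) E(6) E(7) by (simp add: subring_set_def ring_of_type_algebra_def)
  have K_uminus: "- x \<in> K" if "x \<in> K" for x
  proof -
    have "\<ominus>\<^bsub>complex_field\<^esub> x = - x"
      by (rule CF.minus_equality) (simp_all add: ring_of_type_algebra_def)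
    then show ?thesis using E(5)[OF that] by simp
  qed
  interpret integer_ring K
    by (rule integer_ring.intro)
       (use \<open>principal_domain R\<close> K_uminus K in \<open>auto simp: R_def subring_set_def\<close>)
  have RK: "carrier R \<subseteq> K"
    by (auto simp: R_def ring_of_integers_def)
  note subR = subring_R[folded R_def]
  have S: "subgroup S \<Gamma>" "finite S"
    using \<open>unitary_reflection_group \<Gamma> n K S\<close> by (auto simp: unitary_reflection_group_def)
  have entriesR: "elements_mat \<sigma> \<subseteq> carrier R" if "\<sigma> \<in> S" for \<sigma>
    using GL_matrix_group(2)[OF subR] subgroup.mem_carrier[OF S(1) that] unfolding \<Gamma>_def by blast
  interpret coset_action n \<Gamma> S G
    using GL_matrix_group(1)[OF subR, of n] S \<open>subgroup G (\<Gamma>\<lparr>carrier := S\<rparr>)\<close>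
    unfolding \<Gamma>_def[symmetric] by (intro coset_action.intro coset_action_axioms.intro)
  have sec: "\<And>j. j < l \<Longrightarrow> \<theta> j \<in> invariants \<Gamma> n (carrier R) G"
    "module_generates (invariants \<Gamma> n K S) (invariants \<Gamma> n K G) \<theta> {..<l}"
    using \<open>secondaries \<Gamma> n K S G l \<theta>\<close> by (auto simp: secondaries_def R_def)
  interpret secondary_setting n \<Gamma> S G K L g l \<theta> \<gamma>
  proof (intro secondary_setting.intro reflection_setting.intro coset_action_axioms
      reflection_setting_axioms.intro secondary_setting_axioms.intro)
    show "elements_mat \<sigma> \<subseteq> K" if "\<sigma> \<in> S" for \<sigma>
      using entriesR[OF that] RK by blast
    then show "spans \<theta> l"
      by (rule spans_if_generates[OF K _ sec(2)])
    show "L P \<in> polys n K \<and> homogeneous 1 (L P) \<and> {v \<in> vecs n K. poly_eval v (L P) = 0} = P"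
      if "P \<in> reflecting_hyperplanes n K S" for P
      using assms(11)[OF that] polys_mono[OF RK] by blast
    show "invariant G (\<theta> j)" if "j < l" for j
      by (rule invariants_imp_invariant[OF sec(1)[OF that]])
  qed (use K K_uminus assms in auto)
  obtain c where c: "c \<noteq> 0" "sec_det = mconst c * disc"
    by (rule sec_det_eq)
  have avoids: "disc \<in> polys n (carrier R) \<and> avoids J disc" if J: "primeideal J R" for J
    unfolding discriminant_def R_def
    by (rule avoids_prod[OF J[unfolded R_def]])
       (use assms(11) primitive_avoids[OF _ J[unfolded R_def]] in \<open>auto simp: R_def\<close>)
  have discR: "disc \<in> polys n (carrier R)"
    unfolding discriminant_def using assms(11) by (intro polys_prod polys_power subR) auto
  have sec_detR: "sec_det \<in> polys n (carrier R)"
    by (rule sec_det_polys[OF subR])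
       (use minus_one_R entriesR sec(1) in \<open>auto simp: R_def invariants_def\<close>)
  have coeff: "lookup sec_det m = c * lookup disc m" for m
  proof -
    have "sec_det = Poly_Mapping.map ((*) c) disc"
      unfolding c(2) mconst_def by (rule mult_map_scale_conv_mult[symmetric])
    then show ?thesis
      by (simp add: Poly_Mapping.map.rep_eq when_def)
  qed
  have disc_coeff: "lookup disc m \<in> carrier R" for m
    using discR by (simp add: polys_def)
  have divides_c: "\<exists>y\<in>carrier R. c = d * y"
    if d: "d \<in> carrier R" and "\<And>m. \<exists>y\<in>carrier R. lookup sec_det m = d * y" for d
    using divides_from_coefficients[of disc d c] avoids disc_coeff d that(2) unfolding R_def coeff
    by blast
  have "\<exists>y\<in>carrier R. c = 1 * y"
    using sec_detR subR by (intro divides_c) (auto simp: polys_def subring_set_def)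
  then have cR: "c \<in> carrier R" by simp
  have content: "is_content R sec_det c"
    unfolding is_content_def
  proof (intro conjI allI ballI impI cR)
    show "c divides\<^bsub>R\<^esub> lookup sec_det m" for m
      using disc_coeff[of m] coeff[of m] by (auto simp: R_def divides_R)
    show "d divides\<^bsub>R\<^esub> c" if "d \<in> carrier R" "\<forall>m. d divides\<^bsub>R\<^esub> lookup sec_det m" for d
      using divides_c[OF that(1)] that(2) unfolding R_def divides_R by blast
  qed
  have "\<exists>x\<in>Units R. sec_det = mconst (x * mho) * disc" if mho: "is_content R sec_det mho" for mho
  proof -
    have "mho \<in> carrier R" "c divides\<^bsub>R\<^esub> mho" "mho divides\<^bsub>R\<^esub> c"
      using mho content cR unfolding is_content_def by blast+
    then obtain x y where x: "x \<in> carrier R" "c = mho * x" and y: "y \<in> carrier R" "mho = c * y"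
      unfolding R_def divides_R by blast
    have "c * (y * x) = c * 1"
      using x(2) y(2) by (simp add: mult.assoc)
    then have "y * x = 1"
      using c(1) by (simp only: mult_left_cancel[OF c(1)])
    then have "x \<in> Units R"
      using x(1) y(1) unfolding Units_def R_def by (auto simp: mult.commute)
    moreover have "sec_det = mconst (x * mho) * disc"
      using c(2) x(2) by (simp add: mult.commute)
    ultimately show ?thesis by blast
  qed
  moreover have "is_primitive_part R sec_det disc"
    unfolding is_primitive_part_def using content c by blast
  ultimately show ?thesis by blast
qed

end
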